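(* Let $\mathcal{T}$ be a Cauchy complete clan. Then the clan morphism $E_{\mathcal{T}}:\mathcal{T}\to\mathfrak{C}(\mathcal{T}\text{-}\mathsf{Mod})^{\mathsf{op}}$, $\Gamma\mapsto H(\Gamma)$, is an equivalence of clans, i.e. it is an equivalence of categories and an arrow $f$ of $\mathcal{T}$ is a display map if and only if $H(f)$ is an extension.
   Context: A clan is a small category $\mathcal{T}$ with a distinguished class of arrows called display maps such that: (i) pullbacks of display maps along arbitrary maps exist and are display maps; (ii) isomorphisms and composites of display maps are display maps; (iii) $\mathcal{T}$ has a terminal object and all maps to it are display maps. A clan morphism is a functor preserving display maps, pullbacks of display maps, and the terminal object. A clan is Cauchy complete if idempotents split in its underlying category and retracts of display maps are display maps. A model of $\mathcal{T}$ is a functor $A:\mathcal{T}\to\mathsf{Set}$ preserving the terminal object and pullbacks of display maps; $\mathcal{T}\text{-}\mathsf{Mod}\subseteq[\mathcal{T},\mathsf{Set}]$ is the full subcategory on models (it is locally finitely presentable). Representables $H(\Gamma)=\mathcal{T}(\Gamma,-)$ are models, giving a fully faithful functor $H:\mathcal{T}^{\mathsf{op}}\to\mathcal{T}\text{-}\mathsf{Mod}$. A map in $\mathcal{T}\text{-}\mathsf{Mod}$ is full if it has the right lifting property w.r.t. all $H(p)$, $p$ a display map; it is an extension if it has the left lifting property w.r.t. all full maps. A 0-extension is an object $A$ such that $0\to A$ is an extension. An object $A$ is compact if $\mathrm{Hom}(A,-)$ preserves small filtered colimits. $\mathfrak{C}(\mathcal{T}\text{-}\mathsf{Mod})$ is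 the full subcategory of $\mathcal{T}\text{-}\mathsf{Mod}$ on compact 0-extensions (essentially small; treat it as small by choosing an equivalent small category). Its opposite is a clan, with display maps the opposites of extensions. Each $H(\Gamma)$ is a compact 0-extension. *)

theory Defs
  imports Main "HOL-Library.FuncSet"
begin

unbundle cardinal_syntax

section \<open>Categories and functors\<close>

record ('o, 'a) cat =
  Ob :: "'o set"
  Arr :: "'a set"
  Dom :: "'a \<Rightarrow> 'o"
  Cod :: "'a \<Rightarrow> 'o"
  Id :: "'o \<Rightarrow> 'a"
  Comp :: "'a \<Rightarrow> 'a \<Rightarrow> 'a"  \<comment> \<open>\<open>Comp C g f\<close> is ``\<open>g\<close> after \<open>f\<close>''; only meaningful if \<open>Cod f = Dom g\<close>\<close>

definition hom :: "('o, 'a) cat \<Rightarrow> 'o \<Rightarrow> 'o \<Rightarrow> 'a set" where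
  "hom C X Y = {f \<in> Arr C. Dom C f = X \<and> Cod C f = Y}"

definition category :: "('o, 'a) cat \<Rightarrow> bool" where
  "category C \<longleftrightarrow>
     (\<forall>f\<in>Arr C. Dom C f \<in> Ob C \<and> Cod C f \<in> Ob C) \<and>
     (\<forall>X\<in>Ob C. Id C X \<in> hom C X X) \<and>
     (\<forall>f\<in>Arr C. \<forall>g\<in>Arr C. Cod C f = Dom C g \<longrightarrow> Comp C g f \<in> hom C (Dom C f) (Cod C g)) \<and>
     (\<forall>f\<in>Arr C. Comp C f (Id C (Dom C f)) = f \<and> Comp C (Id C (Cod C f)) f = f) \<and>
     (\<forall>f\<in>Arr C. \<forall>g\<in>Arr C. \<forall>h\<in>Arr C. Cod C f = Dom C g \<longrightarrow> Cod C g = Dom C h \<longrightarrow>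
        Comp C h (Comp C g f) = Comp C (Comp C h g) f)"

definition opposite :: "('o, 'a) cat \<Rightarrow> ('o, 'a) cat" where
  "opposite C = \<lparr>Ob = Ob C, Arr = Arr C, Dom = Cod C, Cod = Dom C, Id = Id C,
                 Comp = (\<lambda>g f. Comp C f g)\<rparr>"

definition full_subcat :: "('o, 'a) cat \<Rightarrow> 'o set \<Rightarrow> ('o, 'a) cat" where
  "full_subcat C S = C\<lparr>Ob := Ob C \<inter> S, Arr := {f \<in> Arr C. Dom C f \<in> S \<and> Cod C f \<in> S}\<rparr>"

record ('o, 'a, 'p, 'b) ftor =
  FO :: "'o \<Rightarrow> 'p"
  FA :: "'a \<Rightarrow> 'b"

text \<open>Functors are \<open>undefined\<close> off their domain, so that HOL equality of functors is the
  intended equality.\<close>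

definition is_functor :: "('o, 'a) cat \<Rightarrow> ('p, 'b) cat \<Rightarrow> ('o, 'a, 'p, 'b) ftor \<Rightarrow> bool" where
  "is_functor C D F \<longleftrightarrow>
     category C \<and> category D \<and>
     FO F \<in> Ob C \<rightarrow>\<^sub>E Ob D \<and>
     FA F \<in> Arr C \<rightarrow>\<^sub>E Arr D \<and>
     (\<forall>f\<in>Arr C. FA F f \<in> hom D (FO F (Dom C f)) (FO F (Cod C f))) \<and>
     (\<forall>X\<in>Ob C. FA F (Id C X) = Id D (FO F X)) \<and>
     (\<forall>f\<in>Arr C. \<forall>g\<in>Arr C. Cod C f = Dom C g \<longrightarrow>
        FA F (Comp C g f) = Comp D (FA F g) (FA F f))"

definition id_ftor :: "('o, 'a) cat \<Rightarrow> ('o, 'a, 'o, 'a) ftor" where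
  "id_ftor C = \<lparr>FO = restrict (\<lambda>X. X) (Ob C), FA = restrict (\<lambda>f. f) (Arr C)\<rparr>"

definition comp_ftor ::
  "('o, 'a) cat \<Rightarrow> ('p, 'b, 'q, 'c) ftor \<Rightarrow> ('o, 'a, 'p, 'b) ftor \<Rightarrow> ('o, 'a, 'q, 'c) ftor" where
  "comp_ftor C G F =
     \<lparr>FO = restrict (\<lambda>X. FO G (FO F X)) (Ob C), FA = restrict (\<lambda>f. FA G (FA F f)) (Arr C)\<rparr>"

text \<open>Functions between sets and natural transformations are arrows that carry their source and
  target with them.\<close>

datatype ('x, 'f) arrow = Arrow (src: 'x) (body: 'f) (trg: 'x)

definition nat_trans ::
  "('o, 'a) cat \<Rightarrow> ('p, 'b) cat \<Rightarrow> ('o, 'a, 'p, 'b) ftor \<Rightarrow> ('o, 'a, 'p, 'b) ftor \<Rightarrow> ('o \<Rightarrow> 'b) \<Rightarrow> bool"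
where
  "nat_trans C D F G t \<longleftrightarrow>
     is_functor C D F \<and> is_functor C D G \<and>
     t \<in> extensional (Ob C) \<and>
     (\<forall>X\<in>Ob C. t X \<in> hom D (FO F X) (FO G X)) \<and>
     (\<forall>f\<in>Arr C. Comp D (t (Cod C f)) (FA F f) = Comp D (FA G f) (t (Dom C f)))"

definition functor_cat ::
  "('o, 'a) cat \<Rightarrow> ('p, 'b) cat \<Rightarrow>
   (('o, 'a, 'p, 'b) ftor, (('o, 'a, 'p, 'b) ftor, 'o \<Rightarrow> 'b) arrow) cat" where
  "functor_cat C D =
     \<lparr>Ob = {F. is_functor C D F},
      Arr = {t. nat_trans C D (src t) (trg t) (body t)},
      Dom = src,
      Cod = trg,
      Id = (\<lambda>F. Arrow F (restrict (\<lambda>X. Id D (FO F X)) (Ob C)) F),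
      Comp = (\<lambda>t s. Arrow (src s) (restrict (\<lambda>X. Comp D (body t X) (body s X)) (Ob C)) (trg t))\<rparr>"

definition set_cat :: "('x set \<Rightarrow> bool) \<Rightarrow> ('x set, ('x set, 'x \<Rightarrow> 'x) arrow) cat" where
  "set_cat P =
     \<lparr>Ob = Collect P,
      Arr = {f. P (src f) \<and> P (trg f) \<and> body f \<in> src f \<rightarrow>\<^sub>E trg f},
      Dom = src,
      Cod = trg,
      Id = (\<lambda>X. Arrow X (restrict (\<lambda>x. x) X) X),
      Comp = (\<lambda>g f. Arrow (src f) (restrict (\<lambda>x. body g (body f x)) (src f)) (trg g))\<rparr>"

text \<open>The covariant functor \<open>Hom(A, -)\<close>, valued in sets of arrows of \<open>C\<close>.\<close>

definition hom_functor ::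
  "('o, 'a) cat \<Rightarrow> 'o \<Rightarrow> ('o, 'a, 'a set, ('a set, 'a \<Rightarrow> 'a) arrow) ftor" where
  "hom_functor C A =
     \<lparr>FO = restrict (\<lambda>B. hom C A B) (Ob C),
      FA = restrict (\<lambda>f. Arrow (hom C A (Dom C f))
                               (restrict (\<lambda>g. Comp C f g) (hom C A (Dom C f)))
                               (hom C A (Cod C f))) (Arr C)\<rparr>"

definition is_iso :: "('o, 'a) cat \<Rightarrow> 'a \<Rightarrow> bool" where
  "is_iso C f \<longleftrightarrow> f \<in> Arr C \<and>
     (\<exists>g\<in>hom C (Cod C f) (Dom C f). Comp C g f = Id C (Dom C f) \<and> Comp C f g = Id C (Cod C f))"

definition isomorphic :: "('o, 'a) cat \<Rightarrow> 'o \<Rightarrow> 'o \<Rightarrow> bool" where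
  "isomorphic C X Y \<longleftrightarrow> (\<exists>f\<in>hom C X Y. is_iso C f)"

definition is_equivalence :: "('o, 'a) cat \<Rightarrow> ('p, 'b) cat \<Rightarrow> ('o, 'a, 'p, 'b) ftor \<Rightarrow> bool" where
  "is_equivalence C D F \<longleftrightarrow> is_functor C D F \<and>
     (\<exists>G. is_functor D C G \<and>
          isomorphic (functor_cat C C) (id_ftor C) (comp_ftor C G F) \<and>
          isomorphic (functor_cat D D) (comp_ftor D F G) (id_ftor D))"

definition is_terminal :: "('o, 'a) cat \<Rightarrow> 'o \<Rightarrow> bool" where
  "is_terminal C t \<longleftrightarrow> t \<in> Ob C \<and> (\<forall>X\<in>Ob C. \<exists>!f. f \<in> hom C X t)"

definition is_initial :: "('o, 'a) cat \<Rightarrow> 'o \<Rightarrow> bool" where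
  "is_initial C z \<longleftrightarrow> z \<in> Ob C \<and> (\<forall>X\<in>Ob C. \<exists>!f. f \<in> hom C z X)"

text \<open>\<open>is_pullback C p f p' f'\<close>: the following square is a pullback.
\begin{verbatim}
      P --f'--> X
      |         |
      p'        p
      v         v
      Y --f---> B
\end{verbatim}\<close>

definition is_pullback :: "('o, 'a) cat \<Rightarrow> 'a \<Rightarrow> 'a \<Rightarrow> 'a \<Rightarrow> 'a \<Rightarrow> bool" where
  "is_pullback C p f p' f' \<longleftrightarrow>
     p \<in> Arr C \<and> f \<in> Arr C \<and> p' \<in> Arr C \<and> f' \<in> Arr C \<and>
     Cod C p = Cod C f \<and> Dom C p' = Dom C f' \<and> Cod C p' = Dom C f \<and> Cod C f' = Dom C p \<and>
     Comp C p f' = Comp C f p' \<and>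
     (\<forall>Q\<in>Ob C. \<forall>x\<in>hom C Q (Dom C p). \<forall>y\<in>hom C Q (Dom C f).
        Comp C p x = Comp C f y \<longrightarrow>
        (\<exists>!h. h \<in> hom C Q (Dom C p') \<and> Comp C f' h = x \<and> Comp C p' h = y))"

definition is_cocone ::
  "('j, 'k) cat \<Rightarrow> ('o, 'a) cat \<Rightarrow> ('j, 'k, 'o, 'a) ftor \<Rightarrow> 'o \<Rightarrow> ('j \<Rightarrow> 'a) \<Rightarrow> bool" where
  "is_cocone J C D c i \<longleftrightarrow> c \<in> Ob C \<and>
     (\<forall>j\<in>Ob J. i j \<in> hom C (FO D j) c) \<and>
     (\<forall>f\<in>Arr J. Comp C (i (Cod J f)) (FA D f) = i (Dom J f))"

definition is_colimit ::
  "('j, 'k) cat \<Rightarrow> ('o, 'a) cat \<Rightarrow> ('j, 'k, 'o, 'a) ftor \<Rightarrow> 'o \<Rightarrow> ('j \<Rightarrow> 'a) \<Rightarrow> bool" where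
  "is_colimit J C D c i \<longleftrightarrow> is_functor J C D \<and> is_cocone J C D c i \<and>
     (\<forall>c' i'. is_cocone J C D c' i' \<longrightarrow>
        (\<exists>!h. h \<in> hom C c c' \<and> (\<forall>j\<in>Ob J. Comp C h (i j) = i' j)))"

definition is_filtered :: "('j, 'k) cat \<Rightarrow> bool" where
  "is_filtered J \<longleftrightarrow> category J \<and> Ob J \<noteq> {} \<and>
     (\<forall>x\<in>Ob J. \<forall>y\<in>Ob J. \<exists>z\<in>Ob J. hom J x z \<noteq> {} \<and> hom J y z \<noteq> {}) \<and>
     (\<forall>x\<in>Ob J. \<forall>y\<in>Ob J. \<forall>f\<in>hom J x y. \<forall>g\<in>hom J x y.
        \<exists>z\<in>Ob J. \<exists>h\<in>hom J y z. Comp J h f = Comp J h g)"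

text \<open>\<open>l\<close> has the left lifting property with respect to \<open>r\<close>.\<close>

definition has_lifting :: "('o, 'a) cat \<Rightarrow> 'a \<Rightarrow> 'a \<Rightarrow> bool" where
  "has_lifting C l r \<longleftrightarrow>
     (\<forall>u\<in>hom C (Dom C l) (Dom C r). \<forall>v\<in>hom C (Cod C l) (Cod C r).
        Comp C r u = Comp C v l \<longrightarrow>
        (\<exists>h\<in>hom C (Cod C l) (Dom C r). Comp C h l = u \<and> Comp C r h = v))"

text \<open>\<open>f\<close> is a retract of \<open>g\<close> in the arrow category of \<open>C\<close>.\<close>

definition retract_of_arrow :: "('o, 'a) cat \<Rightarrow> 'a \<Rightarrow> 'a \<Rightarrow> bool" where
  "retract_of_arrow C f g \<longleftrightarrow> f \<in> Arr C \<and> g \<in> Arr C \<and>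
     (\<exists>s\<in>hom C (Dom C f) (Dom C g). \<exists>r\<in>hom C (Dom C g) (Dom C f).
      \<exists>s'\<in>hom C (Cod C f) (Cod C g). \<exists>r'\<in>hom C (Cod C g) (Cod C f).
        Comp C r s = Id C (Dom C f) \<and> Comp C r' s' = Id C (Cod C f) \<and>
        Comp C g s = Comp C s' f \<and> Comp C f r = Comp C r' g)"

definition idempotents_split :: "('o, 'a) cat \<Rightarrow> bool" where
  "idempotents_split C \<longleftrightarrow>
     (\<forall>X\<in>Ob C. \<forall>e\<in>hom C X X. Comp C e e = e \<longrightarrow>
        (\<exists>Y\<in>Ob C. \<exists>r\<in>hom C X Y. \<exists>s\<in>hom C Y X. Comp C s r = e \<and> Comp C r s = Id C Y))"


section \<open>Clans\<close>

text \<open>A clan is given by a category \<open>C\<close> and its set \<open>D\<close> of display maps. Smallness of the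
  underlying category is kept separate, see \<open>small\<close> below.\<close>

definition clan :: "('o, 'a) cat \<Rightarrow> 'a set \<Rightarrow> bool" where
  "clan C D \<longleftrightarrow> category C \<and> D \<subseteq> Arr C \<and>
     (\<forall>p\<in>D. \<forall>f\<in>Arr C. Cod C f = Cod C p \<longrightarrow>
        (\<exists>p' f'. is_pullback C p f p' f') \<and>
        (\<forall>p' f'. is_pullback C p f p' f' \<longrightarrow> p' \<in> D)) \<and>
     (\<forall>f. is_iso C f \<longrightarrow> f \<in> D) \<and>
     (\<forall>p\<in>D. \<forall>q\<in>D. Cod C p = Dom C q \<longrightarrow> Comp C q p \<in> D) \<and>
     (\<exists>t. is_terminal C t) \<and>
     (\<forall>f\<in>Arr C. is_terminal C (Cod C f) \<longrightarrow> f \<in> D)"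

definition preserves_terminal ::
  "('o, 'a) cat \<Rightarrow> ('p, 'b) cat \<Rightarrow> ('o, 'a, 'p, 'b) ftor \<Rightarrow> bool" where
  "preserves_terminal C C' F \<longleftrightarrow> (\<forall>t. is_terminal C t \<longrightarrow> is_terminal C' (FO F t))"

definition preserves_display_pullbacks ::
  "('o, 'a) cat \<Rightarrow> 'a set \<Rightarrow> ('p, 'b) cat \<Rightarrow> ('o, 'a, 'p, 'b) ftor \<Rightarrow> bool" where
  "preserves_display_pullbacks C D C' F \<longleftrightarrow>
     (\<forall>p\<in>D. \<forall>f p' f'. is_pullback C p f p' f' \<longrightarrow>
        is_pullback C' (FA F p) (FA F f) (FA F p') (FA F f'))"

definition clan_morphism ::
  "('o, 'a) cat \<Rightarrow> 'a set \<Rightarrow> ('p, 'b) cat \<Rightarrow> 'b set \<Rightarrow> ('o, 'a, 'p, 'b) ftor \<Rightarrow> bool" where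
  "clan_morphism C D C' D' F \<longleftrightarrow>
     clan C D \<and> clan C' D' \<and> is_functor C C' F \<and>
     (\<forall>f\<in>D. FA F f \<in> D') \<and>
     preserves_display_pullbacks C D C' F \<and>
     preserves_terminal C C' F"

definition clan_equivalence ::
  "('o, 'a) cat \<Rightarrow> 'a set \<Rightarrow> ('p, 'b) cat \<Rightarrow> 'b set \<Rightarrow> ('o, 'a, 'p, 'b) ftor \<Rightarrow> bool" where
  "clan_equivalence C D C' D' F \<longleftrightarrow>
     clan_morphism C D C' D' F \<and>
     is_equivalence C C' F \<and>
     (\<forall>f\<in>Arr C. f \<in> D \<longleftrightarrow> FA F f \<in> D')"

definition cauchy_complete :: "('o, 'a) cat \<Rightarrow> 'a set \<Rightarrow> bool" where
  "cauchy_complete C D \<longleftrightarrow>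
     idempotents_split C \<and> (\<forall>f. \<forall>g\<in>D. retract_of_arrow C f g \<longrightarrow> f \<in> D)"


section \<open>Small sets\<close>

text \<open>HOL has no category of all sets. A type \<open>'u\<close> plays the role of the universe: the small sets
  are the sets of elements of \<open>'u\<close> of cardinality below \<open>\<kappa> = |UNIV :: 'u set|\<close>. If \<open>\<kappa>\<close> is strongly
  inaccessible these are, up to bijection, the sets of a Grothendieck universe. We only ask \<open>\<kappa>\<close> to
  be regular and uncountable. This includes the inaccessible case, and every category in HOL
  lies below some such \<open>\<kappa>\<close>.\<close>

definition small :: "'u set \<Rightarrow> bool" where
  "small X \<longleftrightarrow> |X| <o |UNIV :: 'u set|"

definition universe :: "'u itself \<Rightarrow> bool" where
  "universe _ \<longleftrightarrow> natLeq <o |UNIV :: 'u set| \<and> regularCard |UNIV :: 'u set|"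

type_synonym 'u set_map = "('u set, 'u \<Rightarrow> 'u) arrow"

definition Sets :: "('u set, 'u set_map) cat" where
  "Sets = set_cat small"


section \<open>Models of a clan\<close>

text \<open>The arrows of \<open>T\<close> are taken from the universe \<open>'u\<close>, so that its hom-sets are objects
  of \<open>Sets\<close>.\<close>

type_synonym ('o, 'u) copresheaf = "('o, 'u, 'u set, 'u set_map) ftor"

type_synonym ('o, 'u) copresheaf_map = "(('o, 'u) copresheaf, 'o \<Rightarrow> 'u set_map) arrow"

definition is_model :: "('o, 'u) cat \<Rightarrow> 'u set \<Rightarrow> ('o, 'u) copresheaf \<Rightarrow> bool" where
  "is_model T D A \<longleftrightarrow>
     is_functor T Sets A \<and> preserves_terminal T Sets A \<and> preserves_display_pullbacks T D Sets A"

definition Mod ::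
  "('o, 'u) cat \<Rightarrow> 'u set \<Rightarrow> (('o, 'u) copresheaf, ('o, 'u) copresheaf_map) cat" where
  "Mod T D = full_subcat (functor_cat T Sets) {A. is_model T D A}"

definition H_ob :: "('o, 'u) cat \<Rightarrow> 'o \<Rightarrow> ('o, 'u) copresheaf" where
  "H_ob T X = hom_functor T X"

text \<open>For \<open>f : X \<rightarrow> Y\<close>, precomposition with \<open>f\<close> is a map \<open>H(Y) \<rightarrow> H(X)\<close>.\<close>

definition H_map :: "('o, 'u) cat \<Rightarrow> 'u \<Rightarrow> ('o, 'u) copresheaf_map" where
  "H_map T f =
     Arrow (H_ob T (Cod T f))
           (restrict (\<lambda>Z. Arrow (hom T (Cod T f) Z)
                                (restrict (\<lambda>g. Comp T g f) (hom T (Cod T f) Z))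
                                (hom T (Dom T f) Z)) (Ob T))
           (H_ob T (Dom T f))"

definition is_full :: "('o, 'u) cat \<Rightarrow> 'u set \<Rightarrow> ('o, 'u) copresheaf_map \<Rightarrow> bool" where
  "is_full T D r \<longleftrightarrow> r \<in> Arr (Mod T D) \<and> (\<forall>p\<in>D. has_lifting (Mod T D) (H_map T p) r)"

definition is_extension :: "('o, 'u) cat \<Rightarrow> 'u set \<Rightarrow> ('o, 'u) copresheaf_map \<Rightarrow> bool" where
  "is_extension T D l \<longleftrightarrow>
     l \<in> Arr (Mod T D) \<and> (\<forall>r. is_full T D r \<longrightarrow> has_lifting (Mod T D) l r)"

definition zero_extension :: "('o, 'u) cat \<Rightarrow> 'u set \<Rightarrow> ('o, 'u) copresheaf \<Rightarrow> bool" where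
  "zero_extension T D A \<longleftrightarrow>
     A \<in> Ob (Mod T D) \<and>
     (\<exists>Z f. is_initial (Mod T D) Z \<and> f \<in> hom (Mod T D) Z A \<and> is_extension T D f)"

text \<open>\<open>Hom(A, -)\<close> takes values in sets of maps of models, which are not sets of elements
  of \<open>'u\<close>. The target of \<open>Hom(A, -)\<close> is therefore the category of all sets of such maps. The index
  categories \<open>J\<close> range over the small filtered categories, with objects and arrows from \<open>'u\<close>.\<close>

definition is_compact :: "('o, 'u) cat \<Rightarrow> 'u set \<Rightarrow> ('o, 'u) copresheaf \<Rightarrow> bool" where
  "is_compact T D A \<longleftrightarrow>
     A \<in> Ob (Mod T D) \<and>
     (\<forall>(J :: ('u, 'u) cat) B c i.
        is_filtered J \<longrightarrow> small (Arr J) \<longrightarrow> is_colimit J (Mod T D) B c i \<longrightarrow>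
        is_colimit J (set_cat (\<lambda>_. True))
          (comp_ftor J (hom_functor (Mod T D) A) B)
          (FO (hom_functor (Mod T D) A) c)
          (\<lambda>j. FA (hom_functor (Mod T D) A) (i j)))"

text \<open>The category \<open>\<C>(T-Mod)\<close>, its extensions, and the functor \<open>E : T \<rightarrow> \<C>(T-Mod)\<close>\<open>\<^sup>o\<^sup>p\<close>.\<close>

definition CMod ::
  "('o, 'u) cat \<Rightarrow> 'u set \<Rightarrow> (('o, 'u) copresheaf, ('o, 'u) copresheaf_map) cat" where
  "CMod T D = full_subcat (Mod T D) {A. is_compact T D A \<and> zero_extension T D A}"

definition CMod_display :: "('o, 'u) cat \<Rightarrow> 'u set \<Rightarrow> ('o, 'u) copresheaf_map set" where
  "CMod_display T D = {f \<in> Arr (CMod T D). is_extension T D f}"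

definition E ::
  "('o, 'u) cat \<Rightarrow> ('o, 'u, ('o, 'u) copresheaf, ('o, 'u) copresheaf_map) ftor" where
  "E T = \<lparr>FO = restrict (H_ob T) (Ob T), FA = restrict (H_map T) (Arr T)\<rparr>"

end

theory Submission
  imports Defs
begin

text \<open>
  Everything rests on covers of a model \<open>A\<close> by filtered colimits of representables. Fix
  \<open>y \<in> A(Y)\<close>. A cell is a finite, downward closed set \<open>S\<close> of earlier cells, a display map
  \<open>q : \<Gamma> \<rightarrow> lim S\<close> and an element of \<open>A(\<Gamma>)\<close> lying over the given ones; the lowest cell is
  \<open>(Y, y)\<close>. By induction on \<open>S\<close>, each such limit is reached from \<open>Y\<close> by pulling back display
  maps, so it exists in \<open>T\<close>, is preserved by models, and its projection to \<open>Y\<close> is a display map.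
  Hence the cells form a directed poset, and the colimit \<open>C\<close> of the representables \<open>H(\<Gamma>)\<close> maps to
  \<open>A\<close> by a full map, since every lifting problem against a display map is solved by a new cell.

  If \<open>A\<close> is a compact 0-extension, then \<open>C \<rightarrow> A\<close> has a section, which factors through a stage of
  the colimit; so \<open>A\<close> is a retract of a representable, and it is representable because idempotents
  split. If \<open>f : X \<rightarrow> Y\<close> is such that \<open>H(f)\<close> is an extension, take \<open>A = H(X)\<close> and \<open>y = f\<close>: lifting
  \<open>H(f)\<close> against \<open>C \<rightarrow> H(X)\<close> exhibits \<open>f\<close> as a retract of a display map \<open>\<Gamma> \<rightarrow> Y\<close>. The clan
  structure of \<open>\<C>(T-Mod)\<close>\<open>\<^sup>o\<^sup>p\<close> and the preservation properties of \<open>E\<close> then follow by transport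
  along the equivalence of categories.
\<close>

section \<open>Small sets\<close>

text \<open>The usual factorization of a map into an extension followed by a full map needs pushouts
  and transfinite composites of models, and then an analysis of the finite subcomplex that a compact
  object meets. Attaching cells to finite closed sets keeps every stage representable instead, and
  the only colimits of models that occur are filtered ones, which are computed pointwise. A cell
  sits over a set of cells and not over a single one because directedness asks for an upper bound of
  any two cells; the limit over the union of their lower sets supplies it.

  The base \<open>(Y, y)\<close> serves two applications. For a compact 0-extension,
  \<open>Y\<close> is terminal and \<open>y\<close> is the unique element there. For an extension
  H(f), the element is \<open>f\<close> itself, and the display maps from the stages to
  \<open>Y\<close> are what \<open>f\<close> becomes a retract of.

  Everything must stay inside the universe: cells, pairs and elements of colimits are coded in
  \<open>'u\<close>, which calls for an infinite type to have pairing, an uncountable one for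
  countable unions, and a regular one for small unions.\<close>

lemma card_less_image:
  assumes "|A| <o r" shows "|f ` A| <o r"
  using card_of_image assms by (rule ordLeq_ordLess_trans)

lemma card_less_subset:
  assumes "A \<subseteq> B" "|B| <o r" shows "|A| <o r"
  using card_of_mono1[OF assms(1)] assms(2) by (rule ordLeq_ordLess_trans)

lemma card_less_inj:
  assumes "inj_on f A" "f ` A \<subseteq> B" "|B| <o r" shows "|A| <o r"
  using assms card_of_ordLeq[of A B] ordLeq_ordLess_trans by blast

lemma universe_infinite:
  assumes "universe TYPE('u)" shows "infinite (UNIV :: 'u set)"
  using assms unfolding universe_def
  by (metis infinite_iff_natLeq_ordLeq ordLess_imp_ordLeq)

lemma card_less_finite:
  assumes "universe TYPE('u)" "finite A" shows "|A| <o |UNIV :: 'u set|"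
  using universe_infinite[OF assms(1)] assms(2)
  by (intro finite_ordLess_infinite card_of_Well_order) (simp_all add: Field_card_of)

text \<open>Uncountability of the universe enters here; it bounds the unions over list lengths and
  over depths of cells.\<close>

lemma card_less_nat:
  assumes "universe TYPE('u)" shows "|A :: nat set| <o |UNIV :: 'u set|"
proof -
  have "|UNIV :: nat set| <o |UNIV :: 'u set|"
    using assms card_of_nat ordIso_ordLess_trans unfolding universe_def by blast
  then show ?thesis by (rule card_less_subset[OF subset_UNIV])
qed

text \<open>Regularity of the universe enters here; the bounds on sums, lists, colimits and cells
  are all derived from it.\<close>

lemma card_less_UN:
  assumes U: "universe TYPE('u)" and I: "|I| <o |UNIV :: 'u set|"
    and A: "\<And>i. i \<in> I \<Longrightarrow> |A i| <o |UNIV :: 'u set|"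
  shows "|\<Union>i\<in>I. A i| <o |UNIV :: 'u set|"
proof (rule card_of_UNION_ordLess_infinite_Field_regularCard[OF _ _ I])
  show "regularCard |UNIV :: 'u set|" using U unfolding universe_def by blast
  show "Cinfinite |UNIV :: 'u set|"
    using universe_infinite[OF U] unfolding cinfinite_def Field_card_of
    by (intro conjI card_of_card_order_on)
qed (use A in blast)

lemma card_less_Sigma:
  assumes U: "universe TYPE('u)" and I: "|I| <o |UNIV :: 'u set|"
    and A: "\<And>i. i \<in> I \<Longrightarrow> |A i| <o |UNIV :: 'u set|"
  shows "|Sigma I A| <o |UNIV :: 'u set|"
proof -
  have "Sigma I A = (\<Union>i\<in>I. Pair i ` A i)" by auto
  moreover have "|\<Union>i\<in>I. Pair i ` A i| <o |UNIV :: 'u set|"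
    by (rule card_less_UN[OF U I card_less_image[OF A]])
  ultimately show ?thesis by simp
qed

lemma card_less_lists:
  assumes U: "universe TYPE('u)" and A: "|A| <o |UNIV :: 'u set|"
  shows "|lists A| <o |UNIV :: 'u set|"
proof -
  have n: "|{xs \<in> lists A. length xs = n}| <o |UNIV :: 'u set|" for n
  proof (induction n)
    case 0
    have "{xs \<in> lists A. length xs = 0} = {[]}" by auto
    moreover have "|{[]}| <o |UNIV :: 'u set|" by (rule card_less_finite[OF U]) simp
    ultimately show ?case by simp
  next
    case (Suc n)
    have "{xs \<in> lists A. length xs = Suc n}
        = (\<lambda>(x, xs). x # xs) ` (A \<times> {xs \<in> lists A. length xs = n})"
      by (auto simp: length_Suc_conv image_iff)
    then show ?case using card_less_image[OF card_less_Sigma[OF U A Suc]] by simp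
  qed
  have "lists A = (\<Union>n\<in>UNIV. {xs \<in> lists A. length xs = n})" by auto
  moreover have "|\<Union>n\<in>UNIV. {xs \<in> lists A. length xs = n}| <o |UNIV :: 'u set|"
    by (rule card_less_UN[OF U card_less_nat[OF U] n])
  ultimately show ?thesis by simp
qed

text \<open>Elements of a filtered colimit are classes of pairs (stage, element), and arrows of the
  index category are pairs of cells; both have to be elements of \<open>'u\<close>.\<close>

lemma universe_pairing:
  assumes "universe TYPE('u)" shows "\<exists>e :: 'u \<times> 'u \<Rightarrow> 'u. inj e"
proof -
  have "|(UNIV :: 'u set) \<times> (UNIV :: 'u set)| =o |UNIV :: 'u set|"
    using card_of_Times_same_infinite universe_infinite[OF assms] by blast
  then have "|UNIV :: ('u \<times> 'u) set| \<le>o |UNIV :: 'u set|"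
    using ordIso_imp_ordLeq by (simp only: UNIV_Times_UNIV)
  then show ?thesis by (subst (asm) card_of_ordLeq[symmetric]) auto
qed

section \<open>Categories\<close>

lemma homD:
  assumes "f \<in> hom C X Y" shows "f \<in> Arr C" "Dom C f = X" "Cod C f = Y"
  using assms by (auto simp: hom_def)

lemma Arr_hom: "f \<in> Arr C \<Longrightarrow> f \<in> hom C (Dom C f) (Cod C f)"
  by (simp add: hom_def)

lemma Dom_Ob: "category C \<Longrightarrow> f \<in> Arr C \<Longrightarrow> Dom C f \<in> Ob C"
  and Cod_Ob: "category C \<Longrightarrow> f \<in> Arr C \<Longrightarrow> Cod C f \<in> Ob C"
  by (auto simp: category_def)

lemma hom_Ob:
  assumes "category C" "f \<in> hom C X Y" shows "X \<in> Ob C" "Y \<in> Ob C"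
  using assms by (auto simp: category_def hom_def)

lemma Id_hom: "category C \<Longrightarrow> X \<in> Ob C \<Longrightarrow> Id C X \<in> hom C X X"
  by (simp add: category_def)

lemma Comp_hom:
  "category C \<Longrightarrow> f \<in> hom C X Y \<Longrightarrow> g \<in> hom C Y Z \<Longrightarrow> Comp C g f \<in> hom C X Z"
  by (auto simp: category_def hom_def)

lemma Comp_Id:
  assumes "category C" "f \<in> hom C X Y"
  shows "Comp C f (Id C X) = f" "Comp C (Id C Y) f = f"
  using assms by (auto simp: category_def hom_def)

lemma Comp_assoc:
  "category C \<Longrightarrow> f \<in> hom C W X \<Longrightarrow> g \<in> hom C X Y \<Longrightarrow> h \<in> hom C Y Z \<Longrightarrow>
    Comp C h (Comp C g f) = Comp C (Comp C h g) f"
  by (auto simp: category_def hom_def)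

lemma categoryI:
  assumes "\<And>f. f \<in> Arr C \<Longrightarrow> Dom C f \<in> Ob C" "\<And>f. f \<in> Arr C \<Longrightarrow> Cod C f \<in> Ob C"
    and "\<And>X. X \<in> Ob C \<Longrightarrow> Id C X \<in> hom C X X"
    and "\<And>X Y Z f g. f \<in> hom C X Y \<Longrightarrow> g \<in> hom C Y Z \<Longrightarrow> Comp C g f \<in> hom C X Z"
    and "\<And>X Y f. f \<in> hom C X Y \<Longrightarrow> Comp C f (Id C X) = f"
    and "\<And>X Y f. f \<in> hom C X Y \<Longrightarrow> Comp C (Id C Y) f = f"
    and "\<And>W X Y Z f g h. f \<in> hom C W X \<Longrightarrow> g \<in> hom C X Y \<Longrightarrow> h \<in> hom C Y Z \<Longrightarrow>
      Comp C h (Comp C g f) = Comp C (Comp C h g) f"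
  shows "category C"
  unfolding category_def
  apply (intro conjI ballI impI)
  using assms by (auto simp: hom_def)

lemma opposite_simps [simp]:
  "Ob (opposite C) = Ob C" "Arr (opposite C) = Arr C" "Dom (opposite C) = Cod C"
  "Cod (opposite C) = Dom C" "Id (opposite C) = Id C" "Comp (opposite C) g f = Comp C f g"
  "hom (opposite C) X Y = hom C Y X"
  by (auto simp: opposite_def hom_def)

lemma category_opposite: "category C \<Longrightarrow> category (opposite C)"
  by (rule categoryI) (simp_all add: Dom_Ob Cod_Ob Id_hom Comp_hom Comp_Id Comp_assoc)

lemma full_subcat_simps [simp]:
  "Ob (full_subcat C S) = Ob C \<inter> S" "Dom (full_subcat C S) = Dom C"
  "Cod (full_subcat C S) = Cod C" "Id (full_subcat C S) = Id C"
  "Comp (full_subcat C S) = Comp C"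
  "Arr (full_subcat C S) = {f \<in> Arr C. Dom C f \<in> S \<and> Cod C f \<in> S}"
  "f \<in> hom (full_subcat C S) X Y \<longleftrightarrow> X \<in> S \<and> Y \<in> S \<and> f \<in> hom C X Y"
  by (auto simp: full_subcat_def hom_def)

lemma category_full_subcat: "category C \<Longrightarrow> category (full_subcat C S)"
  by (rule categoryI) (auto simp: Dom_Ob Cod_Ob Id_hom Comp_hom Comp_Id Comp_assoc)

lemma ftorD:
  assumes "is_functor C D F"
  shows "category C" "category D" "FO F \<in> extensional (Ob C)" "FA F \<in> extensional (Arr C)"
    and "X \<in> Ob C \<Longrightarrow> FO F X \<in> Ob D"
    and "f \<in> hom C X Y \<Longrightarrow> FA F f \<in> hom D (FO F X) (FO F Y)"
    and "X \<in> Ob C \<Longrightarrow> FA F (Id C X) = Id D (FO F X)"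
    and "f \<in> hom C X Y \<Longrightarrow> g \<in> hom C Y Z \<Longrightarrow> FA F (Comp C g f) = Comp D (FA F g) (FA F f)"
  using assms by (auto simp: is_functor_def hom_def PiE_def Pi_def)

lemma ftorI:
  assumes "category C" "category D" "FO F \<in> extensional (Ob C)" "FA F \<in> extensional (Arr C)"
    and "\<And>X. X \<in> Ob C \<Longrightarrow> FO F X \<in> Ob D"
    and "\<And>X Y f. f \<in> hom C X Y \<Longrightarrow> FA F f \<in> hom D (FO F X) (FO F Y)"
    and "\<And>X. X \<in> Ob C \<Longrightarrow> FA F (Id C X) = Id D (FO F X)"
    and "\<And>X Y Z f g. f \<in> hom C X Y \<Longrightarrow> g \<in> hom C Y Z \<Longrightarrow>
      FA F (Comp C g f) = Comp D (FA F g) (FA F f)"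
  shows "is_functor C D F"
proof -
  have "FA F f \<in> hom D (FO F (Dom C f)) (FO F (Cod C f))" if "f \<in> Arr C" for f
    using assms(6) that by (auto simp: hom_def)
  moreover from this have "FA F \<in> Arr C \<rightarrow>\<^sub>E Arr D"
    using assms(4) by (auto simp: hom_def PiE_def Pi_def)
  ultimately show ?thesis
    unfolding is_functor_def using assms by (auto simp: hom_def PiE_def)
qed

lemma isoD:
  assumes "is_iso C f" "f \<in> hom C X Y"
  obtains g where "g \<in> hom C Y X" "Comp C g f = Id C X" "Comp C f g = Id C Y"
  using assms unfolding is_iso_def hom_def by auto

lemma isoI:
  "f \<in> hom C X Y \<Longrightarrow> g \<in> hom C Y X \<Longrightarrow> Comp C g f = Id C X \<Longrightarrow> Comp C f g = Id C Y \<Longrightarrow> is_iso C f"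
  unfolding is_iso_def hom_def by auto

lemma pullbackD:
  assumes "is_pullback C p f p' f'"
  shows "p \<in> hom C (Dom C p) (Cod C p)" "f \<in> hom C (Dom C f) (Cod C p)"
    "p' \<in> hom C (Dom C p') (Dom C f)" "f' \<in> hom C (Dom C p') (Dom C p)"
    "Comp C p f' = Comp C f p'"
  using assms unfolding is_pullback_def hom_def by auto

lemma pullback_univ:
  assumes "is_pullback C p f p' f'" "Q \<in> Ob C" "x \<in> hom C Q (Dom C p)" "y \<in> hom C Q (Dom C f)"
    "Comp C p x = Comp C f y"
  shows "\<exists>!h. h \<in> hom C Q (Dom C p') \<and> Comp C f' h = x \<and> Comp C p' h = y"
  using assms unfolding is_pullback_def by blast

section \<open>Copresheaves\<close>

lemma category_set_cat: "category (set_cat P)"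
proof (rule categoryI, goal_cases)
  case (7 W X Y Z f g h)
  then show ?case
    by (auto simp: set_cat_def hom_def restrict_def PiE_def Pi_def fun_eq_iff)
next
  case (5 X Y f)
  then show ?case
    by (cases f) (auto simp: set_cat_def hom_def fun_eq_iff PiE_def Pi_def extensional_def)
next
  case (6 X Y f)
  then show ?case
    by (cases f) (auto simp: set_cat_def hom_def fun_eq_iff PiE_def Pi_def extensional_def)
qed (auto simp: set_cat_def hom_def PiE_def Pi_def)

lemma category_Sets: "category Sets"
  unfolding Sets_def by (rule category_set_cat)

lemma Sets_hom:
  "f \<in> hom Sets X Y \<longleftrightarrow> small X \<and> small Y \<and> f = Arrow X (body f) Y \<and> body f \<in> X \<rightarrow>\<^sub>E Y"
  by (cases f) (auto simp: Sets_def set_cat_def hom_def)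

lemma Sets_simps [simp]:
  "X \<in> Ob Sets \<longleftrightarrow> small X" "Dom Sets = src" "Cod Sets = trg"
  "Id Sets X = Arrow X (restrict (\<lambda>x. x) X) X"
  "Comp Sets g f = Arrow (src f) (restrict (\<lambda>x. body g (body f x)) (src f)) (trg g)"
  by (auto simp: Sets_def set_cat_def)

text \<open>Models and their maps are handled through elements from here on, so the functions
  underlying the arrows of \<open>Sets\<close> get names of their own.\<close>

definition act :: "('o, 'u) copresheaf \<Rightarrow> 'u \<Rightarrow> 'u \<Rightarrow> 'u" where
  "act A f = body (FA A f)"

definition app :: "('o, 'u) copresheaf_map \<Rightarrow> 'o \<Rightarrow> 'u \<Rightarrow> 'u" where
  "app t X = body (body t X)"

lemma copresheafD:
  assumes "is_functor T Sets A"
  shows "X \<in> Ob T \<Longrightarrow> small (FO A X)"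
    and "f \<in> hom T X Y \<Longrightarrow> FA A f = Arrow (FO A X) (act A f) (FO A Y)"
    and "f \<in> hom T X Y \<Longrightarrow> act A f \<in> FO A X \<rightarrow>\<^sub>E FO A Y"
    and "f \<in> hom T X Y \<Longrightarrow> x \<in> FO A X \<Longrightarrow> act A f x \<in> FO A Y"
    and "X \<in> Ob T \<Longrightarrow> x \<in> FO A X \<Longrightarrow> act A (Id T X) x = x"
    and "f \<in> hom T X Y \<Longrightarrow> g \<in> hom T Y Z \<Longrightarrow> x \<in> FO A X \<Longrightarrow>
      act A (Comp T g f) x = act A g (act A f x)"
proof -
  note F = ftorD[OF assms]
  show "X \<in> Ob T \<Longrightarrow> small (FO A X)" using F(5) by simp
  have *: "FA A f = Arrow (FO A X) (act A f) (FO A Y) \<and> act A f \<in> FO A X \<rightarrow>\<^sub>E FO A Y"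
    if "f \<in> hom T X Y" for f X Y
    using F(6)[OF that] unfolding act_def Sets_hom by blast
  then show "f \<in> hom T X Y \<Longrightarrow> FA A f = Arrow (FO A X) (act A f) (FO A Y)"
    and "f \<in> hom T X Y \<Longrightarrow> act A f \<in> FO A X \<rightarrow>\<^sub>E FO A Y"
    and "f \<in> hom T X Y \<Longrightarrow> x \<in> FO A X \<Longrightarrow> act A f x \<in> FO A Y"
    by blast+
  show "X \<in> Ob T \<Longrightarrow> x \<in> FO A X \<Longrightarrow> act A (Id T X) x = x"
    using F(7)[of X] by (simp add: act_def)
  show "act A (Comp T g f) x = act A g (act A f x)"
    if "f \<in> hom T X Y" "g \<in> hom T Y Z" "x \<in> FO A X"
  proof -
    have "src (FA A f) = FO A X" using *[OF that(1)] by (metis arrow.sel(1))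
    then show ?thesis using F(8)[OF that(1,2)] that(3) by (simp add: act_def)
  qed
qed

definition mk_psh ::
  "('o, 'u) cat \<Rightarrow> ('o \<Rightarrow> 'u set) \<Rightarrow> ('u \<Rightarrow> 'u \<Rightarrow> 'u) \<Rightarrow> ('o, 'u) copresheaf" where
  "mk_psh T S a =
     \<lparr>FO = restrict S (Ob T),
      FA = restrict (\<lambda>f. Arrow (S (Dom T f)) (restrict (a f) (S (Dom T f))) (S (Cod T f))) (Arr T)\<rparr>"

lemma FO_mk_psh [simp]: "X \<in> Ob T \<Longrightarrow> FO (mk_psh T S a) X = S X"
  by (simp add: mk_psh_def)

lemma act_mk_psh [simp]:
  "f \<in> hom T X Y \<Longrightarrow> x \<in> S X \<Longrightarrow> act (mk_psh T S a) f x = a f x"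
  by (simp add: mk_psh_def act_def hom_def)

lemma mk_psh_functor:
  assumes T: "category T" and S: "\<And>X. X \<in> Ob T \<Longrightarrow> small (S X)"
    and a: "\<And>X Y f x. f \<in> hom T X Y \<Longrightarrow> x \<in> S X \<Longrightarrow> a f x \<in> S Y"
    and i: "\<And>X x. X \<in> Ob T \<Longrightarrow> x \<in> S X \<Longrightarrow> a (Id T X) x = x"
    and c: "\<And>X Y Z f g x. f \<in> hom T X Y \<Longrightarrow> g \<in> hom T Y Z \<Longrightarrow> x \<in> S X \<Longrightarrow>
      a (Comp T g f) x = a g (a f x)"
  shows "is_functor T Sets (mk_psh T S a)"
proof (rule ftorI, goal_cases)
  case (6 X Y f)
  then show ?case
    using hom_Ob[OF T 6] S a[OF 6] homD[OF 6] by (auto simp: Sets_hom mk_psh_def)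
next
  case (7 X)
  then show ?case using Id_hom[OF T 7] i[OF 7]
    by (auto simp: mk_psh_def fun_eq_iff hom_def)
next
  case (8 X Y Z f g)
  then show ?case using Comp_hom[OF T 8] a[OF 8(1)] c[OF 8] homD[OF 8(1)] homD[OF 8(2)]
    by (auto simp: mk_psh_def fun_eq_iff hom_def)
qed (use T S category_Sets in \<open>auto simp: mk_psh_def\<close>)

definition mk_map ::
  "('o, 'u) cat \<Rightarrow> ('o, 'u) copresheaf \<Rightarrow> ('o, 'u) copresheaf \<Rightarrow> ('o \<Rightarrow> 'u \<Rightarrow> 'u)
    \<Rightarrow> ('o, 'u) copresheaf_map" where
  "mk_map T A B h =
     Arrow A (restrict (\<lambda>X. Arrow (FO A X) (restrict (h X) (FO A X)) (FO B X)) (Ob T)) B"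

lemma app_mk_map [simp]: "X \<in> Ob T \<Longrightarrow> x \<in> FO A X \<Longrightarrow> app (mk_map T A B h) X x = h X x"
  by (simp add: mk_map_def app_def)

section \<open>The category of functors and natural transformations\<close>

lemma functor_cat_simps [simp]:
  "Dom (functor_cat C D) = src" "Cod (functor_cat C D) = trg"
  "F \<in> Ob (functor_cat C D) \<longleftrightarrow> is_functor C D F"
  "t \<in> Arr (functor_cat C D) \<longleftrightarrow> nat_trans C D (src t) (trg t) (body t)"
  "Id (functor_cat C D) F = Arrow F (restrict (\<lambda>X. Id D (FO F X)) (Ob C)) F"
  "Comp (functor_cat C D) t s =
     Arrow (src s) (restrict (\<lambda>X. Comp D (body t X) (body s X)) (Ob C)) (trg t)"
  by (auto simp: functor_cat_def)

lemma functor_cat_hom: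
  "t \<in> hom (functor_cat C D) F G \<longleftrightarrow> nat_trans C D F G (body t) \<and> t = Arrow F (body t) G"
  by (cases t) (auto simp: hom_def)

lemma category_functor_cat: "category (functor_cat C D)"
proof (rule categoryI, goal_cases)
  case (3 F)
  then have F: "is_functor C D F" by simp
  note D = ftorD[OF F]
  show ?case
    unfolding functor_cat_hom nat_trans_def
  proof (intro conjI ballI)
    show "body (Id (functor_cat C D) F) X \<in> hom D (FO F X) (FO F X)" if "X \<in> Ob C" for X
      using that Id_hom[OF D(2) D(5)] by simp
    show "Comp D (body (Id (functor_cat C D) F) (Cod C f)) (FA F f) =
      Comp D (FA F f) (body (Id (functor_cat C D) F) (Dom C f))" if "f \<in> Arr C" for f
      using Comp_Id[OF D(2) D(6)[OF Arr_hom[OF that]]] Dom_Ob[OF D(1) that] Cod_Ob[OF D(1) that]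
      by simp
  qed (use F in auto)
next
  case (4 F G H s t)
  from 4 have s: "nat_trans C D F G (body s)" and ss: "src s = F" "trg s = G"
    and t: "nat_trans C D G H (body t)" and tt: "src t = G" "trg t = H"
    by (auto simp: functor_cat_hom) (metis arrow.sel)+
  note FG = s[unfolded nat_trans_def] t[unfolded nat_trans_def]
  note c = ftorD(1,2)[OF FG(1)[THEN conjunct1]]
  show ?case
    unfolding functor_cat_hom nat_trans_def
  proof (intro conjI ballI)
    show "body (Comp (functor_cat C D) t s) X \<in> hom D (FO F X) (FO H X)" if "X \<in> Ob C" for X
      using that FG Comp_hom c by fastforce
    show "Comp D (body (Comp (functor_cat C D) t s) (Cod C f)) (FA F f) =
      Comp D (FA H f) (body (Comp (functor_cat C D) t s) (Dom C f))" if f: "f \<in> Arr C" for f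
    proof -
      let ?X = "Dom C f" and ?Y = "Cod C f"
      have X: "?X \<in> Ob C" "?Y \<in> Ob C" using Dom_Ob[OF c(1) f] Cod_Ob[OF c(1) f] .
      have F: "FA F f \<in> hom D (FO F ?X) (FO F ?Y)" "FA G f \<in> hom D (FO G ?X) (FO G ?Y)"
        "FA H f \<in> hom D (FO H ?X) (FO H ?Y)"
        using FG ftorD(6)[OF _ Arr_hom[OF f]] by blast+
      have S: "body s ?X \<in> hom D (FO F ?X) (FO G ?X)" "body s ?Y \<in> hom D (FO F ?Y) (FO G ?Y)"
        "body t ?X \<in> hom D (FO G ?X) (FO H ?X)" "body t ?Y \<in> hom D (FO G ?Y) (FO H ?Y)"
        using FG X by auto
      have N: "Comp D (body s ?Y) (FA F f) = Comp D (FA G f) (body s ?X)"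
        "Comp D (body t ?Y) (FA G f) = Comp D (FA H f) (body t ?X)" using FG f by auto
      have "Comp D (Comp D (body t ?Y) (body s ?Y)) (FA F f)
        = Comp D (body t ?Y) (Comp D (FA G f) (body s ?X))"
        using Comp_assoc[OF c(2) F(1) S(2,4)] N by simp
      also have "\<dots> = Comp D (FA H f) (Comp D (body t ?X) (body s ?X))"
        using Comp_assoc[OF c(2) S(1) F(2) S(4)] N Comp_assoc[OF c(2) S(1,3) F(3)] by simp
      finally show ?thesis using X by simp
    qed
  qed (use FG ss tt in auto)
next
  case (5 F G t)
  then obtain b where t: "t = Arrow F b G" "nat_trans C D F G b" by (auto simp: functor_cat_hom)
  then have "Comp D (b X) (Id D (FO F X)) = b X" if "X \<in> Ob C" for X
    using that unfolding nat_trans_def by (meson Comp_Id(1) ftorD(2))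
  then have "restrict (\<lambda>X. Comp D (b X) (Id D (FO F X))) (Ob C) = b"
    using t(2) unfolding nat_trans_def by (auto simp: fun_eq_iff extensional_def)
  then show ?case by (simp add: t(1) cong: restrict_cong)
next
  case (6 F G t)
  then obtain b where t: "t = Arrow F b G" "nat_trans C D F G b" by (auto simp: functor_cat_hom)
  then have "Comp D (Id D (FO G X)) (b X) = b X" if "X \<in> Ob C" for X
    using that unfolding nat_trans_def by (meson Comp_Id(2) ftorD(2))
  then have "restrict (\<lambda>X. Comp D (Id D (FO G X)) (b X)) (Ob C) = b"
    using t(2) unfolding nat_trans_def by (auto simp: fun_eq_iff extensional_def)
  then show ?case by (simp add: t(1) cong: restrict_cong)
next
  case (7 W X Y Z f g h)
  obtain bf where f: "f = Arrow W bf X" "nat_trans C D W X bf"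
    using 7 by (auto simp: functor_cat_hom)
  obtain bg where g: "g = Arrow X bg Y" "nat_trans C D X Y bg"
    using 7 by (auto simp: functor_cat_hom)
  obtain bh where h: "h = Arrow Y bh Z" "nat_trans C D Y Z bh"
    using 7 by (auto simp: functor_cat_hom)
  have "Comp D (bh U) (Comp D (bg U) (bf U)) = Comp D (Comp D (bh U) (bg U)) (bf U)"
    if "U \<in> Ob C" for U
    using f(2) g(2) h(2) that ftorD(2) Comp_assoc unfolding nat_trans_def by meson
  then show ?case by (simp add: f(1) g(1) h(1) cong: restrict_cong)
qed (auto simp: nat_trans_def)

section \<open>Models\<close>

lemma small_singleton: "universe TYPE('u) \<Longrightarrow> small {x :: 'u}"
  unfolding small_def by (rule card_less_finite) auto

lemma terminal_Sets:
  assumes U: "universe TYPE('u)"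
  shows "is_terminal Sets S \<longleftrightarrow> (\<exists>!x :: 'u. x \<in> S) \<and> small S"
proof
  assume S: "is_terminal Sets S"
  \<comment> \<open>Types are inhabited, so the universe contains a one-point set to test
    against.\<close>
  obtain z :: 'u where True by blast
  have "small {z}" using small_singleton[OF U] .
  with S have ex: "\<exists>!f. f \<in> hom Sets {z} S" and sm: "small S" unfolding is_terminal_def by auto
  have in_hom: "Arrow {z} (\<lambda>u\<in>{z}. x) S \<in> hom Sets {z} S" if "x \<in> S" for x
    using that sm \<open>small {z}\<close> by (auto simp: Sets_hom)
  obtain f where f: "f \<in> hom Sets {z} S" using ex by blast
  then have "body f z \<in> S" by (auto simp: Sets_hom)
  moreover have "x = y" if "x \<in> S" "y \<in> S" for x y
  proof -
    have "Arrow {z} (\<lambda>u\<in>{z}. x) S = Arrow {z} (\<lambda>u\<in>{z}. y) S"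
      using ex in_hom that by blast
    then show ?thesis by (auto dest: fun_cong[of _ _ z])
  qed
  ultimately show "(\<exists>!x. x \<in> S) \<and> small S" using sm by blast
next
  assume S: "(\<exists>!x. x \<in> S) \<and> small S"
  then obtain x where x: "S = {x}" by blast
  have "\<exists>!f. f \<in> hom Sets X S" if "small X" for X
  proof
    show "Arrow X (\<lambda>u\<in>X. x) S \<in> hom Sets X S" using that S x by (auto simp: Sets_hom)
    show "f = Arrow X (\<lambda>u\<in>X. x) S" if "f \<in> hom Sets X S" for f
    proof -
      have "body f = (\<lambda>u\<in>X. x)"
        using that by (auto simp: Sets_hom x PiE_def Pi_def extensional_def fun_eq_iff)
      then show ?thesis using that by (metis Sets_hom)
    qed
  qed
  then show "is_terminal Sets S" using S unfolding is_terminal_def by auto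
qed

text \<open>Maps out of a one-point set are elements, which gives one direction; for the other, the
  mediating map is assembled pointwise by unique choice.\<close>

lemma pullback_Sets:
  fixes X Y Z B :: "'u set"
  assumes U: "universe TYPE('u)"
    and P: "Arrow X p B \<in> hom Sets X B" and F: "Arrow Y f B \<in> hom Sets Y B"
    and P': "Arrow Z p' Y \<in> hom Sets Z Y" and F': "Arrow Z f' X \<in> hom Sets Z X"
    and comm: "\<And>z. z \<in> Z \<Longrightarrow> p (f' z) = f (p' z)"
  shows "is_pullback Sets (Arrow X p B) (Arrow Y f B) (Arrow Z p' Y) (Arrow Z f' X) \<longleftrightarrow>
    (\<forall>x\<in>X. \<forall>y\<in>Y. p x = f y \<longrightarrow> (\<exists>!z. z \<in> Z \<and> f' z = x \<and> p' z = y))"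
    (is "?L \<longleftrightarrow> ?R")
proof
  assume L: ?L
  show ?R
  proof (intro ballI impI)
    fix x y assume x: "x \<in> X" and y: "y \<in> Y" and xy: "p x = f y"
    \<comment> \<open>The singleton \<open>{x}\<close> is the one-point test object, and
      \<open>c v S\<close> is the map that names the element \<open>v\<close> of
      \<open>S\<close>.\<close>
    define c where "c = (\<lambda>(v :: 'u) S. Arrow {x} (\<lambda>u\<in>{x}. v) S)"
    have sm: "small {x}" "small X" "small Y" "small Z"
      using small_singleton[OF U] P P' Sets_hom by auto
    have ch: "c v S \<in> hom Sets {x} S" if "v \<in> S" "small S" for v S
      using that sm by (auto simp: c_def Sets_hom)
    have inj: "v = w" if "c v S = c w S" for v w S
      using that unfolding c_def by (auto dest: fun_cong[of _ _ x])
    have "Comp Sets (Arrow X p B) (c x X) = Comp Sets (Arrow Y f B) (c y Y)"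
      using xy by (auto simp: c_def fun_eq_iff)
    then have "\<exists>!h. h \<in> hom Sets {x} Z \<and> Comp Sets (Arrow Z f' X) h = c x X \<and>
        Comp Sets (Arrow Z p' Y) h = c y Y"
      using pullback_univ[OF L, of "{x}" "c x X" "c y Y"] ch[OF x] ch[OF y] sm
      by (simp only: Sets_simps(1-3) arrow.sel)
    then obtain h
      where h: "h \<in> hom Sets {x} Z" "Comp Sets (Arrow Z f' X) h = c x X"
        "Comp Sets (Arrow Z p' Y) h = c y Y"
        and un: "\<And>h'. h' \<in> hom Sets {x} Z \<Longrightarrow> Comp Sets (Arrow Z f' X) h' = c x X \<Longrightarrow>
          Comp Sets (Arrow Z p' Y) h' = c y Y \<Longrightarrow> h' = h"
      by blast
    show "\<exists>!z. z \<in> Z \<and> f' z = x \<and> p' z = y"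
    proof (rule ex1I[of _ "body h x"])
      have "h = Arrow {x} (body h) Z" using h(1) unfolding Sets_hom by blast
      then have "src h = {x}" by (metis arrow.sel(1))
      then show "body h x \<in> Z \<and> f' (body h x) = x \<and> p' (body h x) = y"
        using h(1) arg_cong[OF h(2), of "\<lambda>a. body a x"] arg_cong[OF h(3), of "\<lambda>a. body a x"]
        by (auto simp: c_def Sets_hom)
      show "z = body h x" if z: "z \<in> Z \<and> f' z = x \<and> p' z = y" for z
      proof -
        have "c z Z = h"
        proof (rule un)
          show "c z Z \<in> hom Sets {x} Z" using ch z sm by blast
        qed (use z in \<open>auto simp: c_def fun_eq_iff\<close>)
        then show ?thesis unfolding c_def by auto
      qed
    qed
  qed
next
  assume R: ?R
  have sm: "small X" "small Y" "small Z" "small B" using P P' Sets_hom by auto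
  have fn: "p \<in> X \<rightarrow>\<^sub>E B" "f \<in> Y \<rightarrow>\<^sub>E B" "p' \<in> Z \<rightarrow>\<^sub>E Y" "f' \<in> Z \<rightarrow>\<^sub>E X"
    using P F P' F' by (auto simp: Sets_hom)
  show ?L
    unfolding is_pullback_def
  proof (intro conjI ballI impI)
    show "Comp Sets (Arrow X p B) (Arrow Z f' X) = Comp Sets (Arrow Y f B) (Arrow Z p' Y)"
      using comm by (auto simp: fun_eq_iff)
    fix Q x y
    assume "Q \<in> Ob Sets" and "x \<in> hom Sets Q (Dom Sets (Arrow X p B))"
      and "y \<in> hom Sets Q (Dom Sets (Arrow Y f B))"
      and e: "Comp Sets (Arrow X p B) x = Comp Sets (Arrow Y f B) y"
    then obtain bx by' where x: "x = Arrow Q bx X" "bx \<in> Q \<rightarrow>\<^sub>E X"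
      and y: "y = Arrow Q by' Y" "by' \<in> Q \<rightarrow>\<^sub>E Y" and Q: "small Q"
      by (metis Sets_hom Sets_simps(2) arrow.sel(1))
    have pq: "p (bx q) = f (by' q)" if "q \<in> Q" for q
      using e that by (auto simp: x y dest: fun_cong[of _ _ q])
    define g where "g q = (THE z. z \<in> Z \<and> f' z = bx q \<and> p' z = by' q)" for q
    have g: "g q \<in> Z \<and> f' (g q) = bx q \<and> p' (g q) = by' q" if "q \<in> Q" for q
      unfolding g_def by (rule theI') (use R pq that x y in blast)
    have g': "z = g q" if "q \<in> Q" "z \<in> Z" "f' z = bx q" "p' z = by' q" for q z
    proof -
      have "bx q \<in> X" "by' q \<in> Y" using that(1) x y by auto
      then show ?thesis using R pq[OF that(1)] g[OF that(1)] that by blast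
    qed
    show "\<exists>!h. h \<in> hom Sets Q (Dom Sets (Arrow Z p' Y)) \<and>
        Comp Sets (Arrow Z f' X) h = x \<and> Comp Sets (Arrow Z p' Y) h = y"
    proof (rule ex1I[of _ "Arrow Q (restrict g Q) Z"], goal_cases)
      case 1
      have "(\<lambda>q\<in>Q. f' (restrict g Q q)) = bx" "(\<lambda>q\<in>Q. p' (restrict g Q q)) = by'"
        using g x(2) y(2) by (auto simp: fun_eq_iff PiE_def extensional_def)
      then show ?case using g Q sm by (auto simp: Sets_hom x y)
    next
      case (2 h)
      then obtain b where h: "h = Arrow Q b Z" "b \<in> Q \<rightarrow>\<^sub>E Z" by (metis Sets_hom Sets_simps(2) arrow.sel(1))
      have "f' (b q) = bx q" "p' (b q) = by' q" if "q \<in> Q" for q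
        using 2 that by (auto simp: h(1) x(1) y(1) dest: fun_cong[of _ _ q])
      then have "b q = g q" if "q \<in> Q" for q
        using g'[OF that] h(2) that by blast
      then have "b = restrict g Q"
        using h(2) by (auto simp: fun_eq_iff PiE_def extensional_def)
      then show ?case using h(1) by simp
    qed
  qed (use P F P' F' homD in \<open>auto simp: hom_def\<close>)
qed

locale small_clan =
  fixes T :: "('o, 'u) cat" and D :: "'u set"
  assumes U: "universe TYPE('u)" and clan: "clan T D" and small_Arr: "small (Arr T)"
begin

abbreviation "M \<equiv> Mod T D"

lemma T: "category T" and D_Arr: "p \<in> D \<Longrightarrow> p \<in> Arr T"
  using clan by (auto simp: clan_def)

lemma D_iso: "is_iso T f \<Longrightarrow> f \<in> D"
  using clan by (auto simp: clan_def)

lemma D_Id: "X \<in> Ob T \<Longrightarrow> Id T X \<in> D"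
  by (rule D_iso, rule isoI[OF Id_hom[OF T] Id_hom[OF T]]) (auto simp: Comp_Id[OF T Id_hom[OF T]])

lemma D_Comp: "p \<in> D \<Longrightarrow> q \<in> D \<Longrightarrow> p \<in> hom T X Y \<Longrightarrow> q \<in> hom T Y Z \<Longrightarrow> Comp T q p \<in> D"
  using clan by (auto simp: clan_def hom_def)

lemma D_pullback:
  assumes "p \<in> D" "p \<in> hom T X B" "f \<in> hom T Y B"
  obtains P p' f' where "is_pullback T p f p' f'" "p' \<in> D" "p' \<in> hom T P Y" "f' \<in> hom T P X"
    "Comp T p f' = Comp T f p'" "P \<in> Ob T"
proof -
  obtain p' f' where *: "is_pullback T p f p' f'" "p' \<in> D"
    using clan assms unfolding clan_def hom_def by blast
  then show ?thesis
    using that[of p' f' "Dom T p'"] pullbackD[OF *(1)] homD[OF assms(2)] homD[OF assms(3)]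
      hom_Ob[OF T pullbackD(3)[OF *(1)]] by auto
qed

lemma terminal: obtains t where "is_terminal T t"
  using clan by (auto simp: clan_def)

lemma D_terminal: "is_terminal T t \<Longrightarrow> f \<in> hom T X t \<Longrightarrow> f \<in> D"
  using clan by (auto simp: clan_def hom_def)

text \<open>The objects have a type of their own; identities embed them into the small set of
  arrows.\<close>

lemma card_Ob: "|Ob T| <o |UNIV :: 'u set|"
proof (rule card_less_inj)
  show "inj_on (Id T) (Ob T)"
  proof (rule inj_onI)
    fix X Y assume "X \<in> Ob T" "Y \<in> Ob T" "Id T X = Id T Y"
    then show "X = Y" using homD(2)[OF Id_hom[OF T]] by metis
  qed
  show "Id T ` Ob T \<subseteq> Arr T" using homD(1)[OF Id_hom[OF T]] by blast
  show "|Arr T| <o |UNIV :: 'u set|" using small_Arr unfolding small_def .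
qed

lemma small_hom: "small (hom T X Y)"
  using small_Arr card_less_subset unfolding small_def hom_def by (metis (no_types, lifting) mem_Collect_eq subsetI)

text \<open>Both preservation properties in terms of elements: this is the form in which models are
  constructed and used.\<close>

lemma model_iff:
  "is_model T D A \<longleftrightarrow> is_functor T Sets A \<and>
    (\<forall>t. is_terminal T t \<longrightarrow> (\<exists>!x. x \<in> FO A t)) \<and>
    (\<forall>p\<in>D. \<forall>f p' f'. is_pullback T p f p' f' \<longrightarrow>
      (\<forall>x\<in>FO A (Dom T p). \<forall>y\<in>FO A (Dom T f). act A p x = act A f y \<longrightarrow>
        (\<exists>!z. z \<in> FO A (Dom T p') \<and> act A f' z = x \<and> act A p' z = y)))"
proof (cases "is_functor T Sets A")
  case F: True
  note A = copresheafD[OF F]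
  have "preserves_terminal T Sets A \<longleftrightarrow> (\<forall>t. is_terminal T t \<longrightarrow> (\<exists>!x. x \<in> FO A t))"
    unfolding preserves_terminal_def terminal_Sets[OF U]
    using A(1) by (auto simp: is_terminal_def)
  moreover have *: "is_pullback Sets (FA A p) (FA A f) (FA A p') (FA A f') \<longleftrightarrow>
      (\<forall>x\<in>FO A (Dom T p). \<forall>y\<in>FO A (Dom T f). act A p x = act A f y \<longrightarrow>
        (\<exists>!z. z \<in> FO A (Dom T p') \<and> act A f' z = x \<and> act A p' z = y))"
    if "is_pullback T p f p' f'" for p f p' f'
  proof -
    note h = pullbackD[OF that]
    note e = A(2)[OF h(1)] A(2)[OF h(2)] A(2)[OF h(3)] A(2)[OF h(4)]
    note m = ftorD(6)[OF F h(1)] ftorD(6)[OF F h(2)] ftorD(6)[OF F h(3)] ftorD(6)[OF F h(4)]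
    show ?thesis
      unfolding e
    proof (rule pullback_Sets[OF U m[unfolded e]])
      show "act A p (act A f' z) = act A f (act A p' z)" if "z \<in> FO A (Dom T p')" for z
        using A(6)[OF h(4,1) that] A(6)[OF h(3,2) that] h(5) by simp
    qed
  qed
  have "preserves_display_pullbacks T D Sets A \<longleftrightarrow>
    (\<forall>p\<in>D. \<forall>f p' f'. is_pullback T p f p' f' \<longrightarrow>
      (\<forall>x\<in>FO A (Dom T p). \<forall>y\<in>FO A (Dom T f). act A p x = act A f y \<longrightarrow>
        (\<exists>!z. z \<in> FO A (Dom T p') \<and> act A f' z = x \<and> act A p' z = y)))"
    unfolding preserves_display_pullbacks_def
    by (intro ball_cong[OF refl] iff_allI imp_cong[OF refl]) (rule *)
  ultimately show ?thesis using F unfolding is_model_def by simp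
qed (simp add: is_model_def)

lemma modelD:
  assumes "is_model T D A"
  shows "is_functor T Sets A" and "is_terminal T t \<Longrightarrow> \<exists>!x. x \<in> FO A t"
    and "p \<in> D \<Longrightarrow> is_pullback T p f p' f' \<Longrightarrow> x \<in> FO A (Dom T p) \<Longrightarrow> y \<in> FO A (Dom T f) \<Longrightarrow>
      act A p x = act A f y \<Longrightarrow> \<exists>!z. z \<in> FO A (Dom T p') \<and> act A f' z = x \<and> act A p' z = y"
  using assms unfolding model_iff by blast+

lemmas act = copresheafD[OF modelD(1)]

lemma M_Ob: "A \<in> Ob M \<longleftrightarrow> is_model T D A"
  by (auto simp: Mod_def is_model_def)

lemma M: "category M"
  unfolding Mod_def by (intro category_full_subcat category_functor_cat)

lemma M_homD:
  assumes "t \<in> hom M A B"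
  shows "is_model T D A" "is_model T D B" "t = Arrow A (body t) B" "body t \<in> extensional (Ob T)"
    and "X \<in> Ob T \<Longrightarrow> body t X = Arrow (FO A X) (app t X) (FO B X)"
    and "X \<in> Ob T \<Longrightarrow> app t X \<in> extensional (FO A X)"
    and "X \<in> Ob T \<Longrightarrow> x \<in> FO A X \<Longrightarrow> app t X x \<in> FO B X"
    and "f \<in> hom T X Y \<Longrightarrow> x \<in> FO A X \<Longrightarrow> app t Y (act A f x) = act B f (app t X x)"
proof -
  show m: "is_model T D A" "is_model T D B" and t: "t = Arrow A (body t) B"
    using assms unfolding Mod_def full_subcat_simps functor_cat_hom by auto
  have n: "nat_trans T Sets A B (body t)"
    using assms unfolding Mod_def full_subcat_simps functor_cat_hom by auto
  then show "body t \<in> extensional (Ob T)" unfolding nat_trans_def by blast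
  have h: "body t X \<in> hom Sets (FO A X) (FO B X)" if "X \<in> Ob T" for X
    using n that unfolding nat_trans_def by blast
  then show b: "body t X = Arrow (FO A X) (app t X) (FO B X)" if "X \<in> Ob T" for X
    using that unfolding app_def Sets_hom by blast
  show "X \<in> Ob T \<Longrightarrow> app t X \<in> extensional (FO A X)"
    and "X \<in> Ob T \<Longrightarrow> x \<in> FO A X \<Longrightarrow> app t X x \<in> FO B X"
    using h unfolding app_def Sets_hom PiE_def Pi_def by blast+
  show "app t Y (act A f x) = act B f (app t X x)" if f: "f \<in> hom T X Y" and x: "x \<in> FO A X"
  proof -
    have "Comp Sets (body t Y) (FA A f) = Comp Sets (FA B f) (body t X)"
      using n homD[OF f] unfolding nat_trans_def by blast
    then show ?thesis
      using b[OF hom_Ob(1)[OF T f]] b[OF hom_Ob(2)[OF T f]] act(2)[OF m(1) f] act(2)[OF m(2) f] x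
      by (auto dest: fun_cong[of _ _ x])
  qed
qed

text \<open>Components are \<open>extensional\<close> over objects and over elements, so agreement
  on elements forces equality of the arrows in HOL.\<close>

lemma M_hom_eqI:
  assumes s: "s \<in> hom M A B" and t: "t \<in> hom M A B"
    and e: "\<And>X x. X \<in> Ob T \<Longrightarrow> x \<in> FO A X \<Longrightarrow> app s X x = app t X x"
  shows "s = t"
proof -
  have "body s X = body t X" for X
  proof (cases "X \<in> Ob T")
    case True
    have "app s X = app t X"
      using M_homD(6)[OF s True] M_homD(6)[OF t True] e[OF True] by (rule extensionalityI)
    then show ?thesis using M_homD(5)[OF s True] M_homD(5)[OF t True] by simp
  next
    case False
    then show ?thesis using M_homD(4)[OF s] M_homD(4)[OF t] by (simp add: extensional_def)
  qed
  then show ?thesis using M_homD(3)[OF s] M_homD(3)[OF t] by (metis ext)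
qed

lemma mk_map_hom:
  assumes A: "is_model T D A" and B: "is_model T D B"
    and h: "\<And>X x. X \<in> Ob T \<Longrightarrow> x \<in> FO A X \<Longrightarrow> h X x \<in> FO B X"
    and n: "\<And>X Y f x. f \<in> hom T X Y \<Longrightarrow> x \<in> FO A X \<Longrightarrow> h Y (act A f x) = act B f (h X x)"
  shows "mk_map T A B h \<in> hom M A B"
  unfolding Mod_def full_subcat_simps functor_cat_hom nat_trans_def
proof (intro conjI ballI)
  let ?b = "body (mk_map T A B h)"
  show "?b X \<in> hom Sets (FO A X) (FO B X)" if "X \<in> Ob T" for X
    using that h act(1)[OF A that] act(1)[OF B that] by (auto simp: mk_map_def Sets_hom)
  show "Comp Sets (?b (Cod T f)) (FA A f) = Comp Sets (FA B f) (?b (Dom T f))"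
    if f: "f \<in> Arr T" for f
    using n[OF Arr_hom[OF f]] act(2)[OF A Arr_hom[OF f]] act(2)[OF B Arr_hom[OF f]]
      act(4)[OF A Arr_hom[OF f]] Dom_Ob[OF T f] Cod_Ob[OF T f]
    by (auto simp: mk_map_def fun_eq_iff)
qed (use A B modelD(1) in \<open>auto simp: mk_map_def\<close>)

lemma app_Comp [simp]:
  assumes "s \<in> hom M A B" "t \<in> hom M B C" "X \<in> Ob T" "x \<in> FO A X"
  shows "app (Comp M t s) X x = app t X (app s X x)"
proof -
  have "Comp M t s = Comp (functor_cat T Sets) t s" by (simp add: Mod_def)
  moreover have "src (body s X) = FO A X"
    using M_homD(5)[OF assms(1,3)] by (metis arrow.sel(1))
  ultimately show ?thesis using assms(3,4) by (simp add: app_def)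
qed

lemma app_Id [simp]:
  assumes "X \<in> Ob T" "x \<in> FO A X"
  shows "app (Id M A) X x = x"
  using assms by (simp add: app_def Mod_def)

section \<open>Representable models\<close>

lemma H_ob_mk_psh: "H_ob T X = mk_psh T (hom T X) (Comp T)"
  by (simp add: H_ob_def hom_functor_def mk_psh_def)

lemma FO_H [simp]: "Y \<in> Ob T \<Longrightarrow> FO (H_ob T X) Y = hom T X Y"
  by (simp add: H_ob_mk_psh)

lemma act_H [simp]: "f \<in> hom T Y Z \<Longrightarrow> g \<in> hom T X Y \<Longrightarrow> act (H_ob T X) f g = Comp T f g"
  by (simp add: H_ob_mk_psh)

text \<open>On elements, preservation of a limit by T(X,-) is its universal property tested at the
  object \<open>X\<close>.\<close>

lemma H_model:
  assumes X: "X \<in> Ob T" shows "is_model T D (H_ob T X)"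
  unfolding model_iff
proof (intro conjI allI impI ballI)
  show "is_functor T Sets (H_ob T X)"
    unfolding H_ob_mk_psh
  proof (rule mk_psh_functor[OF T])
    show "Comp T (Comp T g f) x = Comp T g (Comp T f x)"
      if "f \<in> hom T Y Z" "g \<in> hom T Z W" "x \<in> hom T X Y" for Y Z W f g x
      using Comp_assoc[OF T that(3,1,2)] by simp
  qed (use small_hom Comp_hom[OF T] Comp_Id[OF T] in auto)
  show "\<exists>!f. f \<in> FO (H_ob T X) t" if "is_terminal T t" for t
    using that X unfolding is_terminal_def by simp
  fix p f p' f' x y
  assume p: "p \<in> D" and pb: "is_pullback T p f p' f'"
    and x: "x \<in> FO (H_ob T X) (Dom T p)" and y: "y \<in> FO (H_ob T X) (Dom T f)"
    and e: "act (H_ob T X) p x = act (H_ob T X) f y"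
  note h = pullbackD[OF pb]
  note O = hom_Ob[OF T h(1)] hom_Ob[OF T h(2)] hom_Ob[OF T h(3)]
  have x': "x \<in> hom T X (Dom T p)" and y': "y \<in> hom T X (Dom T f)" using x y O by simp_all
  have "Comp T p x = Comp T f y" using e x' y' h by simp
  then have "\<exists>!z. z \<in> hom T X (Dom T p') \<and> Comp T f' z = x \<and> Comp T p' z = y"
    using pb x' y' X unfolding is_pullback_def by blast
  then show "\<exists>!z. z \<in> FO (H_ob T X) (Dom T p') \<and> act (H_ob T X) f' z = x \<and> act (H_ob T X) p' z = y"
    using O h by (simp cong: conj_cong)
qed

text \<open>The map H(X) \<rightarrow> A that the Yoneda lemma assigns to an element
  \<open>a\<close> of A(X).\<close>

definition yo :: "('o, 'u) copresheaf \<Rightarrow> 'o \<Rightarrow> 'u \<Rightarrow> ('o, 'u) copresheaf_map" where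
  "yo A X a = mk_map T (H_ob T X) A (\<lambda>Z g. act A g a)"

lemma yo_hom:
  assumes A: "is_model T D A" and X: "X \<in> Ob T" and a: "a \<in> FO A X"
  shows "yo A X a \<in> hom M (H_ob T X) A"
  unfolding yo_def
proof (rule mk_map_hom[OF H_model[OF X] A])
  fix Y Z f x assume f: "f \<in> hom T Y Z" "x \<in> FO (H_ob T X) Y"
  then have "x \<in> hom T X Y" using hom_Ob[OF T f(1)] by simp
  then show "act A (act (H_ob T X) f x) a = act A f (act A x a)"
    using act(6)[OF A _ f(1) a] f(1) by simp
qed (use act(4)[OF A _ a] in simp)

lemma app_yo [simp]: "g \<in> hom T X Z \<Longrightarrow> app (yo A X a) Z g = act A g a"
  using hom_Ob(2)[OF T] unfolding yo_def by simp

lemma app_yo_Id: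
  "is_model T D A \<Longrightarrow> X \<in> Ob T \<Longrightarrow> a \<in> FO A X \<Longrightarrow> app (yo A X a) X (Id T X) = a"
  using Id_hom[OF T] act(5) by simp

lemma yoneda:
  assumes t: "t \<in> hom M (H_ob T X) A" and X: "X \<in> Ob T"
  shows "app t X (Id T X) \<in> FO A X" "t = yo A X (app t X (Id T X))"
proof -
  show a: "app t X (Id T X) \<in> FO A X" using M_homD(7)[OF t X] Id_hom[OF T X] X by simp
  show "t = yo A X (app t X (Id T X))"
  proof (rule M_hom_eqI[OF t yo_hom[OF M_homD(2)[OF t] X a]])
    fix Z g assume Z: "Z \<in> Ob T" and "g \<in> FO (H_ob T X) Z"
    then have g: "g \<in> hom T X Z" by simp
    have "app t Z (act (H_ob T X) g (Id T X)) = act A g (app t X (Id T X))"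
      using M_homD(8)[OF t g] Id_hom[OF T X] X by simp
    then show "app t Z g = app (yo A X (app t X (Id T X))) Z g"
      using g Id_hom[OF T X] Comp_Id[OF T g] by simp
  qed
qed

lemma yo_inj:
  assumes "is_model T D A" "X \<in> Ob T" "a \<in> FO A X" "b \<in> FO A X" "yo A X a = yo A X b"
  shows "a = b"
  using assms app_yo_Id by metis

lemma yo_Comp:
  assumes t: "t \<in> hom M A B" and X: "X \<in> Ob T" and a: "a \<in> FO A X"
  shows "Comp M t (yo A X a) = yo B X (app t X a)"
proof -
  have A: "is_model T D A" and B: "is_model T D B" using M_homD[OF t] by auto
  note y = yo_hom[OF A X a] and y' = yo_hom[OF B X M_homD(7)[OF t X a]]
  show ?thesis
  proof (rule M_hom_eqI[OF Comp_hom[OF M y t] y'])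
    fix Z g assume Z: "Z \<in> Ob T" and "g \<in> FO (H_ob T X) Z"
    then have g: "g \<in> hom T X Z" by simp
    then show "app (Comp M t (yo A X a)) Z g = app (yo B X (app t X a)) Z g"
      using app_Comp[OF y t Z] Z M_homD(8)[OF t g a] by simp
  qed
qed

text \<open>With H(f) recognized as the Yoneda map of the element \<open>f\<close> of H(X)(Y),
  functoriality, fullness and faithfulness of H become statements about \<open>yo\<close>.\<close>

lemma H_map_yo:
  assumes f: "f \<in> hom T X Y"
  shows "H_map T f = yo (H_ob T X) Y f"
proof -
  have "(\<lambda>g\<in>hom T Y Z. Comp T g f) = (\<lambda>g\<in>hom T Y Z. act (H_ob T X) g f)" if "Z \<in> Ob T" for Z
    using f by (auto simp: fun_eq_iff)
  then show ?thesis
    using homD[OF f] unfolding H_map_def yo_def mk_map_def by (simp cong: restrict_cong)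
qed

lemma H_map_hom: "f \<in> hom T X Y \<Longrightarrow> H_map T f \<in> hom M (H_ob T Y) (H_ob T X)"
  using yo_hom[OF H_model] hom_Ob[OF T] H_map_yo by simp

text \<open>The Yoneda correspondence turns precomposition with H(f) into the action of
  \<open>f\<close>; lifting problems against H(f) thereby become equations between elements.\<close>

lemma yo_H_map:
  assumes A: "is_model T D A" and f: "f \<in> hom T X Y" and a: "a \<in> FO A X"
  shows "Comp M (yo A X a) (H_map T f) = yo A Y (act A f a)"
  using yo_Comp[OF yo_hom[OF A _ a], of Y f] hom_Ob[OF T f] f H_map_yo[OF f] by simp

lemma H_map_Comp:
  assumes f: "f \<in> hom T X Y" and g: "g \<in> hom T Y Z"
  shows "H_map T (Comp T g f) = Comp M (H_map T f) (H_map T g)"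
  using yo_H_map[OF H_model[OF hom_Ob(1)[OF T f]] g, of f] f g hom_Ob[OF T f]
    H_map_yo[OF f] H_map_yo[OF Comp_hom[OF T f g]] by simp

lemma H_map_Id: "X \<in> Ob T \<Longrightarrow> H_map T (Id T X) = Id M (H_ob T X)"
  using H_map_yo[OF Id_hom[OF T]] yoneda(2)[OF Id_hom[OF M], of X] H_model Id_hom[OF T]
  by (simp add: M_Ob)

lemma H_map_full:
  assumes t: "t \<in> hom M (H_ob T Y) (H_ob T X)" and X: "X \<in> Ob T" and Y: "Y \<in> Ob T"
  shows "\<exists>f\<in>hom T X Y. t = H_map T f"
  using yoneda[OF t Y] X Y H_map_yo by (metis FO_H)

lemma H_map_inj:
  assumes "f \<in> hom T X Y" "g \<in> hom T X Y" "H_map T f = H_map T g"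
  shows "f = g"
  using assms yo_inj[OF H_model, of X Y f g] hom_Ob[OF T assms(1)] by (simp add: H_map_yo)

end

section \<open>Filtered colimits of models\<close>

lemma filteredD:
  assumes "is_filtered J"
  shows "category J" "Ob J \<noteq> {}"
    and "x \<in> Ob J \<Longrightarrow> y \<in> Ob J \<Longrightarrow> \<exists>z\<in>Ob J. (\<exists>f. f \<in> hom J x z) \<and> (\<exists>g. g \<in> hom J y z)"
    and "f \<in> hom J x y \<Longrightarrow> g \<in> hom J x y \<Longrightarrow> \<exists>z\<in>Ob J. \<exists>h\<in>hom J y z. Comp J h f = Comp J h g"
proof -
  show J: "category J" "Ob J \<noteq> {}"
    using assms unfolding is_filtered_def by blast+
  show "x \<in> Ob J \<Longrightarrow> y \<in> Ob J \<Longrightarrow> \<exists>z\<in>Ob J. (\<exists>f. f \<in> hom J x z) \<and> (\<exists>g. g \<in> hom J y z)"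
    using assms unfolding is_filtered_def by blast
  show "f \<in> hom J x y \<Longrightarrow> g \<in> hom J x y \<Longrightarrow> \<exists>z\<in>Ob J. \<exists>h\<in>hom J y z. Comp J h f = Comp J h g"
    using assms hom_Ob[OF J(1), of f x y] unfolding is_filtered_def by blast
qed

text \<open>Bound the two targets first, then coequalize the two composites out of
  \<open>a\<close>.\<close>

lemma filtered_span:
  assumes J: "is_filtered J" and f: "f \<in> hom J a b" and g: "g \<in> hom J a c"
  obtains d u v where "d \<in> Ob J" "u \<in> hom J b d" "v \<in> hom J c d" "Comp J u f = Comp J v g"
proof -
  note F = filteredD[OF J]
  obtain e u v where e: "u \<in> hom J b e" "v \<in> hom J c e"
    using F(3) hom_Ob[OF F(1) f] hom_Ob[OF F(1) g] by blast
  have "Comp J u f \<in> hom J a e" "Comp J v g \<in> hom J a e"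
    using Comp_hom[OF F(1)] f g e by blast+
  then obtain d h where d: "d \<in> Ob J" "h \<in> hom J e d"
    "Comp J h (Comp J u f) = Comp J h (Comp J v g)"
    using F(4) by blast
  then show ?thesis
    using that[of d "Comp J h u" "Comp J h v"] Comp_hom[OF F(1)] e
      Comp_assoc[OF F(1) f e(1) d(2)] Comp_assoc[OF F(1) g e(2) d(2)] by auto
qed

section \<open>Images of cocones, hom functors, and colimits of sets\<close>

lemma is_cocone_functor:
  assumes B: "is_functor J C B" and G: "is_functor C C' G" and c: "is_cocone J C B c i"
  shows "is_cocone J C' (comp_ftor J G B) (FO G c) (\<lambda>j. FA G (i j))"
  unfolding is_cocone_def
proof (intro conjI ballI)
  have c': "c \<in> Ob C" "\<And>j. j \<in> Ob J \<Longrightarrow> i j \<in> hom C (FO B j) c"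
    "\<And>f. f \<in> Arr J \<Longrightarrow> Comp C (i (Cod J f)) (FA B f) = i (Dom J f)"
    using c unfolding is_cocone_def by blast+
  show "FO G c \<in> Ob C'" using ftorD(5)[OF G c'(1)] .
  show "FA G (i j) \<in> hom C' (FO (comp_ftor J G B) j) (FO G c)" if "j \<in> Ob J" for j
    using that ftorD(6)[OF G c'(2)[OF that]] by (simp add: comp_ftor_def)
  show "Comp C' (FA G (i (Cod J f))) (FA (comp_ftor J G B) f) = FA G (i (Dom J f))"
    if f: "f \<in> Arr J" for f
    using f c'(3)[OF f] ftorD(8)[OF G ftorD(6)[OF B Arr_hom[OF f]]
        c'(2)[OF Cod_Ob[OF ftorD(1)[OF B] f]]]
    by (simp add: comp_ftor_def)
qed

lemma comp_ftor_functor: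
  assumes F: "is_functor C D F" and G: "is_functor D C' G"
  shows "is_functor C C' (comp_ftor C G F)"
proof (rule ftorI, goal_cases)
  case (6 X Y f)
  then show ?case
    using ftorD(6)[OF G ftorD(6)[OF F 6]] homD[OF 6] hom_Ob[OF ftorD(1)[OF F] 6]
    by (simp add: comp_ftor_def)
next
  case (7 X)
  then show ?case
    using ftorD(7)[OF F 7] ftorD(7)[OF G ftorD(5)[OF F 7]] homD(1)[OF Id_hom[OF ftorD(1)[OF F] 7]]
    by (simp add: comp_ftor_def)
next
  case (8 X Y Z f g)
  then show ?case
    using ftorD(8)[OF F 8] ftorD(8)[OF G ftorD(6)[OF F 8(1)] ftorD(6)[OF F 8(2)]]
      homD(1)[OF 8(1)] homD(1)[OF 8(2)] homD(1)[OF Comp_hom[OF ftorD(1)[OF F] 8]]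
    by (simp add: comp_ftor_def)
qed (use ftorD[OF F] ftorD[OF G] in \<open>auto simp: comp_ftor_def\<close>)

lemma set_cat_hom:
  "f \<in> hom (set_cat P) X Y \<longleftrightarrow> P X \<and> P Y \<and> f = Arrow X (body f) Y \<and> body f \<in> X \<rightarrow>\<^sub>E Y"
  by (cases f) (auto simp: set_cat_def hom_def)

lemma set_cat_simps [simp]:
  "X \<in> Ob (set_cat P) \<longleftrightarrow> P X" "Dom (set_cat P) = src" "Cod (set_cat P) = trg"
  "Id (set_cat P) X = Arrow X (restrict (\<lambda>x. x) X) X"
  "Comp (set_cat P) g f = Arrow (src f) (restrict (\<lambda>x. body g (body f x)) (src f)) (trg g)"
  by (auto simp: set_cat_def)

lemma hom_functor_functor:
  assumes C: "category C"
  shows "is_functor C (set_cat (\<lambda>_. True)) (hom_functor C A)"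
proof (rule ftorI, goal_cases)
  case (6 X Y f)
  then show ?case
    using Comp_hom[OF C _ 6] homD[OF 6] hom_Ob[OF C 6]
    by (auto simp: hom_functor_def set_cat_hom)
next
  case (7 X)
  then show ?case
    using Id_hom[OF C 7] Comp_Id[OF C] homD[OF Id_hom[OF C 7]]
    by (auto simp: hom_functor_def intro!: restrict_ext)
next
  case (8 X Y Z f g)
  then show ?case
    using Comp_hom[OF C 8] Comp_hom[OF C _ 8(1)] homD[OF 8(1)] homD[OF 8(2)]
      homD[OF Comp_hom[OF C 8]] Comp_assoc[OF C _ 8]
    by (auto simp: hom_functor_def intro!: restrict_ext)
qed (use C category_set_cat in \<open>auto simp: hom_functor_def\<close>)

text \<open>Joint surjectivity defines the mediating map on every element and makes it unique;
  \<open>germ\<close> makes its value independent of the representative.\<close>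

lemma colimit_set_cat:
  fixes F :: "('j, 'k, 'm set, ('m set, 'm \<Rightarrow> 'm) arrow) ftor"
  defines "S \<equiv> set_cat (\<lambda>_ :: 'm set. True)"
  assumes F: "is_functor J S F" and c: "is_cocone J S F c i"
    and surj: "\<And>z. z \<in> c \<Longrightarrow> \<exists>j\<in>Ob J. \<exists>x\<in>FO F j. z = body (i j) x"
    and germ: "\<And>j k x y. j \<in> Ob J \<Longrightarrow> k \<in> Ob J \<Longrightarrow> x \<in> FO F j \<Longrightarrow> y \<in> FO F k \<Longrightarrow>
      body (i j) x = body (i k) y \<Longrightarrow>
      \<exists>l\<in>Ob J. \<exists>f\<in>hom J j l. \<exists>g\<in>hom J k l. body (FA F f) x = body (FA F g) y"
  shows "is_colimit J S F c i"
  unfolding is_colimit_def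
proof (intro conjI allI impI)
  fix c' i' assume c': "is_cocone J S F c' i'"
  have ij: "i j = Arrow (FO F j) (body (i j)) c" "body (i j) \<in> FO F j \<rightarrow>\<^sub>E c" if "j \<in> Ob J" for j
    using c that unfolding is_cocone_def S_def set_cat_hom by blast+
  have ij': "i' j = Arrow (FO F j) (body (i' j)) c'" "body (i' j) \<in> FO F j \<rightarrow>\<^sub>E c'"
    if "j \<in> Ob J" for j
    using c' that unfolding is_cocone_def S_def set_cat_hom by blast+
  have nat: "body (i' l) (body (FA F f) x) = body (i' j) x"
    if "f \<in> hom J j l" "x \<in> FO F j" for f j l x
  proof -
    have e: "Comp S (i' l) (FA F f) = i' j"
      using c' homD[OF that(1)] unfolding is_cocone_def by blast
    have "FA F f = Arrow (FO F j) (body (FA F f)) (FO F l)"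
      using ftorD(6)[OF F that(1)] unfolding S_def set_cat_hom by blast
    then have "src (FA F f) = FO F j" by (metis arrow.sel(1))
    then show ?thesis using that(2) by (subst e[symmetric]) (simp add: S_def)
  qed
  have wd: "body (i' j) x = body (i' k) y"
    if "j \<in> Ob J" "k \<in> Ob J" "x \<in> FO F j" "y \<in> FO F k" "body (i j) x = body (i k) y" for j k x y
    using germ[OF that] nat that(3,4) by metis
  define h where
    "h z = (SOME w. \<exists>j\<in>Ob J. \<exists>x\<in>FO F j. z = body (i j) x \<and> w = body (i' j) x)" for z
  have h: "h (body (i j) x) = body (i' j) x" if "j \<in> Ob J" "x \<in> FO F j" for j x
    unfolding h_def
  proof (rule some_equality)
    show "\<exists>k\<in>Ob J. \<exists>y\<in>FO F k. body (i j) x = body (i k) y \<and> body (i' j) x = body (i' k) y"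
      using that by blast
    show "w = body (i' j) x"
      if "\<exists>k\<in>Ob J. \<exists>y\<in>FO F k. body (i j) x = body (i k) y \<and> w = body (i' k) y" for w
      using that wd \<open>j \<in> Ob J\<close> \<open>x \<in> FO F j\<close> by metis
  qed
  show "\<exists>!h. h \<in> hom S c c' \<and> (\<forall>j\<in>Ob J. Comp S h (i j) = i' j)"
  proof (rule ex1I[of _ "Arrow c (restrict h c) c'"], goal_cases)
    case 1
    have "h z \<in> c'" if "z \<in> c" for z
      using surj[OF that] h ij'(2) by fastforce
    moreover have "Comp S (Arrow c (restrict h c) c') (i j) = i' j" if j: "j \<in> Ob J" for j
    proof -
      have "(\<lambda>x\<in>FO F j. restrict h c (body (i j) x)) = body (i' j)"
        using ij(2)[OF j] ij'(2)[OF j] h[OF j]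
        by (auto simp: fun_eq_iff PiE_def Pi_def extensional_def)
      moreover have "src (i j) = FO F j" using ij(1)[OF j] by (metis arrow.sel(1))
      ultimately show ?thesis
        using ij'(1)[OF j] unfolding S_def set_cat_simps arrow.sel by simp
    qed
    ultimately show ?case unfolding S_def set_cat_hom by auto
  next
    case (2 g)
    then have g: "g = Arrow c (body g) c'" "body g \<in> c \<rightarrow>\<^sub>E c'"
      unfolding S_def set_cat_hom by blast+
    have "body g (body (i j) x) = body (i' j) x" if j: "j \<in> Ob J" "x \<in> FO F j" for j x
    proof -
      have e: "Comp S g (i j) = i' j" using 2 j by blast
      have "src (i j) = FO F j" using ij(1)[OF j(1)] by (metis arrow.sel(1))
      then show ?thesis using j(2) by (subst e[symmetric]) (simp add: S_def)
    qed
    then have "body g z = h z" if "z \<in> c" for z using surj[OF that] h by metis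
    then have "body g = restrict h c"
      using g(2) by (auto simp: fun_eq_iff PiE_def extensional_def)
    then show ?case using g(1) by simp
  qed
qed (use F c in auto)

text \<open>The union \<open>I\<close> of the images is the vertex of a cocone itself. The induced
  map to \<open>I\<close>, followed by the inclusion, fixes the cocone and is therefore the
  identity, so \<open>I\<close> is all of \<open>c\<close>. Applied to Hom(A,-), this is how
  compactness factors a map through a stage.\<close>

lemma colimit_set_cat_surj:
  fixes F :: "('j, 'k, 'm set, ('m set, 'm \<Rightarrow> 'm) arrow) ftor"
  defines "S \<equiv> set_cat (\<lambda>_ :: 'm set. True)"
  assumes c: "is_colimit J S F c i" and z: "z \<in> c"
  shows "\<exists>j\<in>Ob J. \<exists>x\<in>FO F j. z = body (i j) x"
proof -
  define I where "I = {body (i j) x | j x. j \<in> Ob J \<and> x \<in> FO F j}"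
  have cc: "is_cocone J S F c i" and F: "is_functor J S F"
    and uni: "\<And>c' i'. is_cocone J S F c' i' \<Longrightarrow>
      \<exists>!h. h \<in> hom S c c' \<and> (\<forall>j\<in>Ob J. Comp S h (i j) = i' j)"
    using c unfolding is_colimit_def by blast+
  have ij: "i j = Arrow (FO F j) (body (i j)) c" "body (i j) \<in> FO F j \<rightarrow>\<^sub>E c" if "j \<in> Ob J" for j
    using cc that unfolding is_cocone_def S_def set_cat_hom by blast+
  have src: "src (i j) = FO F j" if "j \<in> Ob J" for j using ij(1)[OF that] by (metis arrow.sel(1))
  let ?i = "\<lambda>j. Arrow (FO F j) (body (i j)) I"
  have Ic: "I \<subseteq> c" using ij(2) unfolding I_def by blast
  have "is_cocone J S F I ?i"
    unfolding is_cocone_def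
  proof (intro conjI ballI)
    show "?i j \<in> hom S (FO F j) I" if "j \<in> Ob J" for j
      using ij(2)[OF that] that unfolding S_def set_cat_hom I_def by auto
    show "Comp S (?i (Cod J f)) (FA F f) = ?i (Dom J f)" if f: "f \<in> Arr J" for f
    proof -
      have "Comp S (i (Cod J f)) (FA F f) = i (Dom J f)"
        using cc f unfolding is_cocone_def by blast
      then show ?thesis
        using ij(1)[OF Dom_Ob[OF ftorD(1)[OF F] f]] unfolding S_def set_cat_simps
        by (metis arrow.sel)
    qed
  qed (simp add: S_def)
  from uni[OF this] obtain h where h: "h \<in> hom S c I" "\<And>j. j \<in> Ob J \<Longrightarrow> Comp S h (i j) = ?i j"
    by blast
  have hb: "h = Arrow c (body h) I" "body h \<in> c \<rightarrow>\<^sub>E I"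
    using h(1) unfolding S_def set_cat_hom by blast+
  have "Id S c = Arrow c (body h) c"
  proof (rule ex1E[OF uni[OF cc]])
    fix g assume g: "\<forall>h. h \<in> hom S c c \<and> (\<forall>j\<in>Ob J. Comp S h (i j) = i j) \<longrightarrow> h = g"
    have cS: "category S" unfolding S_def by (rule category_set_cat)
    have "i j \<in> hom S (FO F j) c" if "j \<in> Ob J" for j
      using cc that unfolding is_cocone_def by blast
    then have "Comp S (Id S c) (i j) = i j" if "j \<in> Ob J" for j
      using Comp_Id(2)[OF cS] that by blast
    moreover have "Id S c \<in> hom S c c" using Id_hom[OF cS, of c] unfolding S_def by simp
    ultimately have "Id S c = g" using g by blast
    moreover have "Arrow c (body h) c = g"
    proof (rule g[rule_format], intro conjI ballI)
      show "Arrow c (body h) c \<in> hom S c c"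
        using hb(2) Ic unfolding S_def set_cat_hom by auto
      show "Comp S (Arrow c (body h) c) (i j) = i j" if "j \<in> Ob J" for j
        using h(2)[OF that] ij(1)[OF that] src[OF that] unfolding S_def set_cat_simps
        by (metis arrow.sel)
    qed
    ultimately show ?thesis by simp
  qed
  then have "body h z = z" using z unfolding S_def by (auto dest: fun_cong[of _ _ z])
  then have "z \<in> I" using hb(2) z PiE_mem by metis
  then show ?thesis unfolding I_def by auto
qed

context small_clan
begin

section \<open>Pointwise filtered colimits of models\<close>

lemma diagD:
  assumes B: "is_functor J M B"
  shows "j \<in> Ob J \<Longrightarrow> is_model T D (FO B j)"
    and "f \<in> hom J j k \<Longrightarrow> FA B f \<in> hom M (FO B j) (FO B k)"
    and "f \<in> hom J j k \<Longrightarrow> X \<in> Ob T \<Longrightarrow> x \<in> FO (FO B j) X \<Longrightarrow> app (FA B f) X x \<in> FO (FO B k) X"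
    and "j \<in> Ob J \<Longrightarrow> X \<in> Ob T \<Longrightarrow> x \<in> FO (FO B j) X \<Longrightarrow> app (FA B (Id J j)) X x = x"
    and "f \<in> hom J j k \<Longrightarrow> g \<in> hom J k l \<Longrightarrow> X \<in> Ob T \<Longrightarrow> x \<in> FO (FO B j) X \<Longrightarrow>
      app (FA B (Comp J g f)) X x = app (FA B g) X (app (FA B f) X x)"
    and "f \<in> hom J j k \<Longrightarrow> t \<in> hom T X Y \<Longrightarrow> x \<in> FO (FO B j) X \<Longrightarrow>
      app (FA B f) Y (act (FO B j) t x) = act (FO B k) t (app (FA B f) X x)"
proof -
  note F = ftorD[OF B]
  show "j \<in> Ob J \<Longrightarrow> is_model T D (FO B j)" using F(5) M_Ob by blast
  show h: "f \<in> hom J j k \<Longrightarrow> FA B f \<in> hom M (FO B j) (FO B k)" for f j k using F(6) .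
  show "f \<in> hom J j k \<Longrightarrow> X \<in> Ob T \<Longrightarrow> x \<in> FO (FO B j) X \<Longrightarrow> app (FA B f) X x \<in> FO (FO B k) X"
    using M_homD(7)[OF h] .
  show "j \<in> Ob J \<Longrightarrow> X \<in> Ob T \<Longrightarrow> x \<in> FO (FO B j) X \<Longrightarrow> app (FA B (Id J j)) X x = x"
    using F(7)[of j] by simp
  show "f \<in> hom J j k \<Longrightarrow> g \<in> hom J k l \<Longrightarrow> X \<in> Ob T \<Longrightarrow> x \<in> FO (FO B j) X \<Longrightarrow>
      app (FA B (Comp J g f)) X x = app (FA B g) X (app (FA B f) X x)"
    using F(8)[of f j k g l] app_Comp[OF h h] by simp
  show "f \<in> hom J j k \<Longrightarrow> t \<in> hom T X Y \<Longrightarrow> x \<in> FO (FO B j) X \<Longrightarrow>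
      app (FA B f) Y (act (FO B j) t x) = act (FO B k) t (app (FA B f) X x)"
    using M_homD(8)[OF h] .
qed

text \<open>The relation whose classes are the elements at \<open>X\<close> of the filtered
  colimit.\<close>

definition germ where
  "germ J B X j x k y \<longleftrightarrow>
    (\<exists>l\<in>Ob J. \<exists>f\<in>hom J j l. \<exists>g\<in>hom J k l. app (FA B f) X x = app (FA B g) X y)"

text \<open>The usual description of a filtered colimit of sets, required at every object of
  \<open>T\<close>. Unlike the universal property in \<open>M\<close>, it speaks about elements
  directly.\<close>

definition pointwise_colimit where
  "pointwise_colimit J B c i \<longleftrightarrow> is_functor J M B \<and> is_cocone J M B c i \<and>
    (\<forall>X\<in>Ob T. \<forall>z\<in>FO c X. \<exists>j\<in>Ob J. \<exists>x\<in>FO (FO B j) X. z = app (i j) X x) \<and>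
    (\<forall>X\<in>Ob T. \<forall>j\<in>Ob J. \<forall>k\<in>Ob J. \<forall>x\<in>FO (FO B j) X. \<forall>y\<in>FO (FO B k) X.
      app (i j) X x = app (i k) X y \<longrightarrow> germ J B X j x k y)"

lemma pointwiseD:
  assumes "pointwise_colimit J B c i"
  shows "is_functor J M B" "is_cocone J M B c i" "is_model T D c"
    and "j \<in> Ob J \<Longrightarrow> i j \<in> hom M (FO B j) c"
    and "f \<in> hom J j k \<Longrightarrow> Comp M (i k) (FA B f) = i j"
    and "X \<in> Ob T \<Longrightarrow> z \<in> FO c X \<Longrightarrow> \<exists>j\<in>Ob J. \<exists>x\<in>FO (FO B j) X. z = app (i j) X x"
    and "X \<in> Ob T \<Longrightarrow> j \<in> Ob J \<Longrightarrow> k \<in> Ob J \<Longrightarrow> x \<in> FO (FO B j) X \<Longrightarrow> y \<in> FO (FO B k) X \<Longrightarrow>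
      app (i j) X x = app (i k) X y \<Longrightarrow> germ J B X j x k y"
  using assms unfolding pointwise_colimit_def is_cocone_def M_Ob by (blast, blast, blast, blast)
    (use assms in \<open>auto simp: pointwise_colimit_def is_cocone_def hom_def\<close>)

lemma pointwise_is_colimit:
  assumes "pointwise_colimit J B c i"
  shows "is_colimit J M B c i"
  unfolding is_colimit_def
proof (intro conjI allI impI)
  note P = pointwiseD[OF assms]
  note B = diagD[OF P(1)]
  show "is_functor J M B" "is_cocone J M B c i" by (fact P)+
  fix c' i' assume c': "is_cocone J M B c' i'"
  have m': "is_model T D c'" and i': "\<And>j. j \<in> Ob J \<Longrightarrow> i' j \<in> hom M (FO B j) c'"
    and n': "\<And>f j k. f \<in> hom J j k \<Longrightarrow> Comp M (i' k) (FA B f) = i' j"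
    using c' unfolding is_cocone_def M_Ob by (auto simp: hom_def)
  note J = ftorD(1)[OF P(1)]
  have nat: "app (i' k) X (app (FA B f) X x) = app (i' j) X x"
    if "f \<in> hom J j k" "X \<in> Ob T" "x \<in> FO (FO B j) X" for f j k X x
    using app_Comp[OF B(2)[OF that(1)] i'[OF hom_Ob(2)[OF J that(1)]] that(2,3)] n'[OF that(1)]
    by simp
  have wd: "app (i' j) X x = app (i' k) X y"
    if "X \<in> Ob T" "j \<in> Ob J" "k \<in> Ob J" "x \<in> FO (FO B j) X" "y \<in> FO (FO B k) X"
      "app (i j) X x = app (i k) X y" for X j k x y
    using P(7)[OF that] nat that unfolding germ_def by metis
  define h where "h X z =
    (SOME w. \<exists>j\<in>Ob J. \<exists>x\<in>FO (FO B j) X. z = app (i j) X x \<and> w = app (i' j) X x)" for X z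
  have h: "h X (app (i j) X x) = app (i' j) X x"
    if "X \<in> Ob T" "j \<in> Ob J" "x \<in> FO (FO B j) X" for X j x
    unfolding h_def
  proof (rule some_equality)
    show "\<exists>k\<in>Ob J. \<exists>y\<in>FO (FO B k) X. app (i j) X x = app (i k) X y \<and>
      app (i' j) X x = app (i' k) X y" using that by blast
    show "w = app (i' j) X x" if "\<exists>k\<in>Ob J. \<exists>y\<in>FO (FO B k) X. app (i j) X x = app (i k) X y \<and>
      w = app (i' k) X y" for w
      using that wd \<open>j \<in> Ob J\<close> \<open>X \<in> Ob T\<close> \<open>x \<in> FO (FO B j) X\<close> by metis
  qed
  have hm: "mk_map T c c' h \<in> hom M c c'"
  proof (rule mk_map_hom[OF P(3) m'])
    fix X z assume X: "X \<in> Ob T" and "z \<in> FO c X"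
    then obtain j x where "j \<in> Ob J" "x \<in> FO (FO B j) X" "z = app (i j) X x" using P(6) by blast
    then show "h X z \<in> FO c' X" using h[OF X] M_homD(7)[OF i' X] by simp
  next
    fix X Y f z assume f: "f \<in> hom T X Y" and z: "z \<in> FO c X"
    note O = hom_Ob[OF T f]
    obtain j x where j: "j \<in> Ob J" "x \<in> FO (FO B j) X" "z = app (i j) X x"
      using P(6)[OF O(1) z] by blast
    have "h Y (act c f z) = h Y (app (i j) Y (act (FO B j) f x))"
      using M_homD(8)[OF P(4)[OF j(1)] f j(2)] j(3) by simp
    also have "\<dots> = app (i' j) Y (act (FO B j) f x)"
      using h[OF O(2) j(1) act(4)[OF B(1)[OF j(1)] f j(2)]] .
    also have "\<dots> = act c' f (h X z)"
      using M_homD(8)[OF i'[OF j(1)] f j(2)] h[OF O(1) j(1,2)] j(3) by simp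
    finally show "h Y (act c f z) = act c' f (h X z)" .
  qed
  show "\<exists>!h. h \<in> hom M c c' \<and> (\<forall>j\<in>Ob J. Comp M h (i j) = i' j)"
  proof (rule ex1I, intro conjI ballI)
    show "mk_map T c c' h \<in> hom M c c'" by (fact hm)
    show "Comp M (mk_map T c c' h) (i j) = i' j" if j: "j \<in> Ob J" for j
    proof (rule M_hom_eqI[OF Comp_hom[OF M P(4)[OF j] hm] i'[OF j]])
      fix X x assume X: "X \<in> Ob T" and x: "x \<in> FO (FO B j) X"
      then show "app (Comp M (mk_map T c c' h) (i j)) X x = app (i' j) X x"
        using app_Comp[OF P(4)[OF j] hm X x] M_homD(7)[OF P(4)[OF j] X x] h[OF X j x] by simp
    qed
    fix g assume g: "g \<in> hom M c c' \<and> (\<forall>j\<in>Ob J. Comp M g (i j) = i' j)"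
    show "g = mk_map T c c' h"
    proof (rule M_hom_eqI[OF _ hm])
      fix X z assume X: "X \<in> Ob T" and z: "z \<in> FO c X"
      then obtain j x where j: "j \<in> Ob J" "x \<in> FO (FO B j) X" "z = app (i j) X x"
        using P(6) by blast
      then have "app g X z = app (i' j) X x" using app_Comp[OF P(4)[OF j(1)] _ X j(2)] g by metis
      then show "app g X z = app (mk_map T c c' h) X z" using h[OF X j(1,2)] j(3) X z by simp
    qed (use g in blast)
  qed
qed

text \<open>Filtered colimits of sets commute with the terminal object and with pullbacks, so the
  pointwise colimit of models is a model. Its elements have to lie in \<open>'u\<close>, hence each
  class is replaced by the code of a chosen member.\<close>

lemma pointwise_colimit_exists:
  fixes J :: "('u, 'u) cat"
  assumes J: "is_filtered J" and sm: "small (Arr J)" and BF: "is_functor J M B"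
  shows "\<exists>c i. pointwise_colimit J B c i"
proof -
  note F = filteredD[OF J]
  note B = diagD[OF BF]
  obtain enc :: "'u \<times> 'u \<Rightarrow> 'u" where enc: "inj enc" using universe_pairing[OF U] by blast
  have refl: "germ J B X j x j x" if "j \<in> Ob J" for X j x
    using Id_hom[OF F(1) that] that unfolding germ_def by blast
  have sym: "germ J B X k y j x" if "germ J B X j x k y" for X j k x y
    using that unfolding germ_def by metis
  have trans: "germ J B X j x m z" if X: "X \<in> Ob T" and x: "x \<in> FO (FO B j) X"
    and y: "y \<in> FO (FO B k) X" and z: "z \<in> FO (FO B m) X"
    and g1: "germ J B X j x k y" and g2: "germ J B X k y m z" for X j x k y m z
  proof -
    obtain l f g where l: "f \<in> hom J j l" "g \<in> hom J k l" "app (FA B f) X x = app (FA B g) X y"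
      using g1 unfolding germ_def by blast
    obtain l' f' g' where l': "f' \<in> hom J k l'" "g' \<in> hom J m l'"
      "app (FA B f') X y = app (FA B g') X z"
      using g2 unfolding germ_def by blast
    \<comment> \<open>Transitivity rests on filteredness: the two legs \<open>g\<close> and
      \<open>f'\<close> out of the middle stage \<open>k\<close> are merged.\<close>
    obtain d u v where d: "d \<in> Ob J" "u \<in> hom J l d" "v \<in> hom J l' d" "Comp J u g = Comp J v f'"
      using filtered_span[OF J l(2) l'(1)] .
    have "app (FA B (Comp J u f)) X x = app (FA B (Comp J v g')) X z"
      using B(5)[OF l(1) d(2) X x] B(5)[OF l(2) d(2) X y] B(5)[OF l'(1) d(3) X y]
        B(5)[OF l'(2) d(3) X z] l(3) l'(3) d(4) by simp
    then show ?thesis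
      using d(1) Comp_hom[OF F(1) l(1) d(2)] Comp_hom[OF F(1) l'(2) d(3)] unfolding germ_def by blast
  qed
  \<comment> \<open>The choice depends only on the predicate that describes the class of
    \<open>(j, x)\<close>; equivalent pairs have equal predicates and thus the same code.\<close>
  define rep where "rep X j x = enc (SOME q. case q of (k, y) \<Rightarrow>
    k \<in> Ob J \<and> y \<in> FO (FO B k) X \<and> germ J B X j x k y)" for X j x
  have rep_eq: "rep X j x = rep X k y \<longleftrightarrow> germ J B X j x k y"
    if X: "X \<in> Ob T" and j: "j \<in> Ob J" and k: "k \<in> Ob J"
      and x: "x \<in> FO (FO B j) X" and y: "y \<in> FO (FO B k) X" for X j x k y
  proof
    assume g: "germ J B X j x k y"
    have "germ J B X j x l z \<longleftrightarrow> germ J B X k y l z" if z: "z \<in> FO (FO B l) X" for l z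
      using trans[OF X x y z g] trans[OF X y x z sym[OF g]] by blast
    then have "(\<lambda>q. case q of (l, z) \<Rightarrow> l \<in> Ob J \<and> z \<in> FO (FO B l) X \<and> germ J B X j x l z)
      = (\<lambda>q. case q of (l, z) \<Rightarrow> l \<in> Ob J \<and> z \<in> FO (FO B l) X \<and> germ J B X k y l z)"
      by (auto simp: fun_eq_iff)
    then show "rep X j x = rep X k y" unfolding rep_def by simp
  next
    assume e: "rep X j x = rep X k y"
    have some: "\<exists>l z. (SOME q. case q of (k, y) \<Rightarrow>
        k \<in> Ob J \<and> y \<in> FO (FO B k) X \<and> germ J B X j x k y) = (l, z) \<and>
        l \<in> Ob J \<and> z \<in> FO (FO B l) X \<and> germ J B X j x l z"
      if "j \<in> Ob J" "x \<in> FO (FO B j) X" for j x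
      using someI[of "\<lambda>q. case q of (k, y) \<Rightarrow> k \<in> Ob J \<and> y \<in> FO (FO B k) X \<and> germ J B X j x k y"
          "(j, x)"] refl[OF that(1)] that by fastforce
    obtain l z where lz: "l \<in> Ob J" "z \<in> FO (FO B l) X" "germ J B X j x l z" "germ J B X k y l z"
      using some[OF j x] some[OF k y] injD[OF enc e[unfolded rep_def]] by auto
    show "germ J B X j x k y" using trans[OF X x lz(2) y lz(3) sym[OF lz(4)]] .
  qed
  have push: "rep X l (app (FA B f) X x) = rep X j x"
    if "X \<in> Ob T" "f \<in> hom J j l" "x \<in> FO (FO B j) X" for X f j l x
  proof (subst rep_eq)
    note O = hom_Ob[OF F(1) that(2)]
    show "X \<in> Ob T" "l \<in> Ob J" "j \<in> Ob J" "x \<in> FO (FO B j) X" "app (FA B f) X x \<in> FO (FO B l) X"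
      using that O B(3)[OF that(2,1,3)] by auto
    show "germ J B X l (app (FA B f) X x) j x"
      unfolding germ_def
      using Id_hom[OF F(1) O(2)] O that B(4)[OF O(2) that(1) B(3)[OF that(2,1,3)]] by blast
  qed
  define S where "S X = {rep X j x | j x. j \<in> Ob J \<and> x \<in> FO (FO B j) X}" for X
  define a where "a f z = (SOME w. \<exists>j\<in>Ob J. \<exists>x\<in>FO (FO B j) (Dom T f). z = rep (Dom T f) j x \<and>
    w = rep (Cod T f) j (act (FO B j) f x))" for f z
  have a: "a f (rep X j x) = rep Y j (act (FO B j) f x)"
    if f: "f \<in> hom T X Y" and j: "j \<in> Ob J" and x: "x \<in> FO (FO B j) X" for f X Y j x
    unfolding a_def homD(2,3)[OF f]
  proof (rule some_equality)
    show "\<exists>k\<in>Ob J. \<exists>y\<in>FO (FO B k) X. rep X j x = rep X k y \<and>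
      rep Y j (act (FO B j) f x) = rep Y k (act (FO B k) f y)" using j x by blast
    fix w assume "\<exists>k\<in>Ob J. \<exists>y\<in>FO (FO B k) X. rep X j x = rep X k y \<and> w = rep Y k (act (FO B k) f y)"
    then obtain k y where k: "k \<in> Ob J" and y: "y \<in> FO (FO B k) X" and e: "rep X j x = rep X k y"
      and w: "w = rep Y k (act (FO B k) f y)" by blast
    note O = hom_Ob[OF T f]
    obtain l u v where l: "u \<in> hom J j l" "v \<in> hom J k l" "app (FA B u) X x = app (FA B v) X y"
      using e rep_eq[OF O(1) j k x y] unfolding germ_def by blast
    have "rep Y j (act (FO B j) f x) = rep Y l (app (FA B u) Y (act (FO B j) f x))"
      using push[OF O(2) l(1) act(4)[OF B(1)[OF j] f x]] by simp
    also have "\<dots> = rep Y l (app (FA B v) Y (act (FO B k) f y))"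
      using B(6)[OF l(1) f x] B(6)[OF l(2) f y] l(3) by simp
    also have "\<dots> = w"
      using push[OF O(2) l(2) act(4)[OF B(1)[OF k] f y]] w by simp
    finally show "w = rep Y j (act (FO B j) f x)" by simp
  qed
  have S_I: "rep X j x \<in> S X" if "j \<in> Ob J" "x \<in> FO (FO B j) X" for X j x
    using that unfolding S_def by blast
  have S_E: "\<exists>j\<in>Ob J. \<exists>x\<in>FO (FO B j) X. z = rep X j x" if "z \<in> S X" for X z
    using that unfolding S_def by blast
  have stage: "\<exists>j\<in>Ob J. \<exists>x\<in>FO (FO B j) X. \<exists>y\<in>FO (FO B j) Y. z = rep X j x \<and> w = rep Y j y"
    if X: "X \<in> Ob T" and Y: "Y \<in> Ob T" and z: "z \<in> S X" and w: "w \<in> S Y" for X Y z w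
  proof -
    obtain j x where j: "j \<in> Ob J" "x \<in> FO (FO B j) X" "z = rep X j x" using S_E[OF z] by blast
    obtain k y where k: "k \<in> Ob J" "y \<in> FO (FO B k) Y" "w = rep Y k y" using S_E[OF w] by blast
    obtain l f g where l: "l \<in> Ob J" "f \<in> hom J j l" "g \<in> hom J k l" using F(3)[OF j(1) k(1)] by blast
    then show ?thesis
      using B(3)[OF l(2) X j(2)] B(3)[OF l(3) Y k(2)] push[OF X l(2) j(2)] push[OF Y l(3) k(2)]
        j(3) k(3) by metis
  qed
  \<comment> \<open>Two arrows \<open>u\<close> and \<open>v\<close> witness the equality; since
    both start at \<open>j\<close>, they can be coequalized, which leaves a single arrow.\<close>
  have same: "\<exists>l. \<exists>h\<in>hom J j l. app (FA B h) X x = app (FA B h) X y"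
    if X: "X \<in> Ob T" and j: "j \<in> Ob J" and x: "x \<in> FO (FO B j) X" and y: "y \<in> FO (FO B j) X"
      and e: "rep X j x = rep X j y" for X j x y
  proof -
    obtain l u v where l: "u \<in> hom J j l" "v \<in> hom J j l" "app (FA B u) X x = app (FA B v) X y"
      using e rep_eq[OF X j j x y] unfolding germ_def by blast
    obtain d h where d: "h \<in> hom J l d" "Comp J h u = Comp J h v" using F(4)[OF l(1,2)] by blast
    have "app (FA B (Comp J h u)) X x = app (FA B (Comp J h u)) X y"
      using B(5)[OF l(1) d(1) X x] B(5)[OF l(2) d(1) X y] l(3) d(2) by simp
    then show ?thesis using Comp_hom[OF F(1) l(1) d(1)] by blast
  qed
  define L where "L = mk_psh T S a"
  have smallS: "small (S X)" if X: "X \<in> Ob T" for X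
  proof -
    have "|Ob J| <o |UNIV :: 'u set|"
    proof (rule card_less_inj)
      show "inj_on (Id J) (Ob J)" using homD(2)[OF Id_hom[OF F(1)]] by (metis inj_onI)
      show "Id J ` Ob J \<subseteq> Arr J" using homD(1)[OF Id_hom[OF F(1)]] by blast
      show "|Arr J| <o |UNIV :: 'u set|" using sm unfolding small_def .
    qed
    then have "|Sigma (Ob J) (\<lambda>j. FO (FO B j) X)| <o |UNIV :: 'u set|"
      by (rule card_less_Sigma[OF U]) (use act(1)[OF B(1) X] in \<open>simp add: small_def\<close>)
    then have "|(\<lambda>(j, x). rep X j x) ` Sigma (Ob J) (\<lambda>j. FO (FO B j) X)| <o |UNIV :: 'u set|"
      by (rule card_less_image)
    moreover have "S X = (\<lambda>(j, x). rep X j x) ` Sigma (Ob J) (\<lambda>j. FO (FO B j) X)"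
      unfolding S_def by auto
    ultimately show ?thesis unfolding small_def by simp
  qed
  have LF: "is_functor T Sets L"
    unfolding L_def
  proof (rule mk_psh_functor[OF T smallS])
    fix X Y f z assume f: "f \<in> hom T X Y" and "z \<in> S X"
    then obtain j x where j: "j \<in> Ob J" "x \<in> FO (FO B j) X" "z = rep X j x" using S_E by blast
    show "a f z \<in> S Y" using a[OF f j(1,2)] j(3) S_I[OF j(1) act(4)[OF B(1)[OF j(1)] f j(2)]] by simp
    fix Z g assume g: "g \<in> hom T Y Z"
    show "a (Comp T g f) z = a g (a f z)"
      using a[OF f j(1,2)] a[OF g j(1) act(4)[OF B(1)[OF j(1)] f j(2)]]
        a[OF Comp_hom[OF T f g] j(1,2)] act(6)[OF B(1)[OF j(1)] f g j(2)] j(3) by simp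
  next
    fix X z assume X: "X \<in> Ob T" and "z \<in> S X"
    then obtain j x where j: "j \<in> Ob J" "x \<in> FO (FO B j) X" "z = rep X j x" using S_E by blast
    then show "a (Id T X) z = z" using a[OF Id_hom[OF T X] j(1,2)] act(5)[OF B(1)[OF j(1)] X j(2)] by simp
  qed
  have LS: "FO L X = S X" if "X \<in> Ob T" for X using that unfolding L_def by simp
  have La: "act L f (rep X j x) = rep Y j (act (FO B j) f x)"
    if f: "f \<in> hom T X Y" and j: "j \<in> Ob J" and x: "x \<in> FO (FO B j) X" for f X Y j x
    using a[OF that] act_mk_psh[OF f, of "rep X j x" S a] S_I[OF j x] unfolding L_def by simp
  have LM: "is_model T D L"
    unfolding model_iff
  proof (intro conjI allI impI ballI LF)
    fix t assume t: "is_terminal T t"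
    have tO: "t \<in> Ob T" using t unfolding is_terminal_def by blast
    obtain j where j: "j \<in> Ob J" using F(2) by blast
    obtain x where x: "x \<in> FO (FO B j) t" using modelD(2)[OF B(1)[OF j] t] by blast
    show "\<exists>!x. x \<in> FO L t"
    proof (rule ex1I)
      show "rep t j x \<in> FO L t" using LS[OF tO] S_I[OF j x] by simp
      fix z assume "z \<in> FO L t"
      then have "z \<in> S t" using LS[OF tO] by simp
      then obtain k y w where "k \<in> Ob J" "y \<in> FO (FO B k) t" "w \<in> FO (FO B k) t"
        "z = rep t k y" "rep t j x = rep t k w" using stage[OF tO tO _ S_I[OF j x]] by metis
      then show "z = rep t j x" using modelD(2)[OF B(1) t] by metis
    qed
  next
    fix p f p' f' x y
    assume p: "p \<in> D" and pb: "is_pullback T p f p' f'"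
      and x: "x \<in> FO L (Dom T p)" and y: "y \<in> FO L (Dom T f)" and e: "act L p x = act L f y"
    note h = pullbackD[OF pb]
    let ?X = "Dom T p" and ?Y = "Dom T f" and ?Z = "Cod T p" and ?P = "Dom T p'"
    note O = hom_Ob[OF T h(1)] hom_Ob[OF T h(3)]
    have comm: "\<exists>!z. z \<in> FO (FO B j) ?P \<and> act (FO B j) f' z = v \<and> act (FO B j) p' z = w"
      if "j \<in> Ob J" "v \<in> FO (FO B j) ?X" "w \<in> FO (FO B j) ?Y" "act (FO B j) p v = act (FO B j) f w"
      for j v w
      using modelD(3)[OF B(1)[OF that(1)] p pb that(2-4)] .
    obtain j v w where j: "j \<in> Ob J" "v \<in> FO (FO B j) ?X" "w \<in> FO (FO B j) ?Y"
      "x = rep ?X j v" "y = rep ?Y j w"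
      using stage[OF O(1) O(4)] x y LS O by metis
    have ac: "act (FO B j) p v \<in> FO (FO B j) ?Z" "act (FO B j) f w \<in> FO (FO B j) ?Z"
      using act(4)[OF B(1)[OF j(1)] h(1) j(2)] act(4)[OF B(1)[OF j(1)] h(2) j(3)] .
    have "rep ?Z j (act (FO B j) p v) = rep ?Z j (act (FO B j) f w)"
      using e La[OF h(1) j(1,2)] La[OF h(2) j(1,3)] j(4,5) by simp
    \<comment> \<open>The equation between \<open>x\<close> and \<open>y\<close> over the base
      already holds at a stage \<open>l\<close>, and the model there supplies the element of the
      pullback.\<close>
    then obtain l u where u: "u \<in> hom J j l"
      "app (FA B u) ?Z (act (FO B j) p v) = app (FA B u) ?Z (act (FO B j) f w)"
      using same[OF O(2) j(1) ac] by blast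
    have l: "l \<in> Ob J" using hom_Ob[OF F(1) u(1)] by blast
    obtain z where z: "z \<in> FO (FO B l) ?P" "act (FO B l) f' z = app (FA B u) ?X v"
      "act (FO B l) p' z = app (FA B u) ?Y w"
      using comm[OF l B(3)[OF u(1) O(1) j(2)] B(3)[OF u(1) O(4) j(3)]] u(2)
        B(6)[OF u(1) h(1) j(2)] B(6)[OF u(1) h(2) j(3)] by auto
    show "\<exists>!z. z \<in> FO L ?P \<and> act L f' z = x \<and> act L p' z = y"
    proof (rule ex1I[of _ "rep ?P l z"], intro conjI)
      show "rep ?P l z \<in> FO L ?P" using LS[OF O(3)] S_I[OF l z(1)] by simp
      show "act L f' (rep ?P l z) = x"
        using La[OF h(4) l z(1)] z(2) push[OF O(1) u(1) j(2)] j(4) by simp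
      show "act L p' (rep ?P l z) = y"
        using La[OF h(3) l z(1)] z(3) push[OF O(4) u(1) j(3)] j(5) by simp
    next
      fix z' assume z': "z' \<in> FO L ?P \<and> act L f' z' = x \<and> act L p' z' = y"
      obtain k c c' where k: "k \<in> Ob J" "c \<in> FO (FO B k) ?P" "c' \<in> FO (FO B k) ?P"
        "rep ?P l z = rep ?P k c" "z' = rep ?P k c'"
        using stage[OF O(3) O(3) S_I[OF l z(1)], of z'] z' LS[OF O(3)] by metis
      note Bk = act(4)[OF B(1)[OF k(1)]]
      have "rep ?X k (act (FO B k) f' c) = rep ?X k (act (FO B k) f' c')"
        using La[OF h(4) k(1,2)] La[OF h(4) k(1,3)] z' k(4,5) La[OF h(4) l z(1)] z(2)
          push[OF O(1) u(1) j(2)] j(4) by simp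
      then obtain m1 g1 where g1: "g1 \<in> hom J k m1"
        "app (FA B g1) ?X (act (FO B k) f' c) = app (FA B g1) ?X (act (FO B k) f' c')"
        using same[OF O(1) k(1) Bk[OF h(4) k(2)] Bk[OF h(4) k(3)]] by blast
      have "rep ?Y k (act (FO B k) p' c) = rep ?Y k (act (FO B k) p' c')"
        using La[OF h(3) k(1,2)] La[OF h(3) k(1,3)] z' k(4,5) La[OF h(3) l z(1)] z(3)
          push[OF O(4) u(1) j(3)] j(5) by simp
      then obtain m2 g2 where g2: "g2 \<in> hom J k m2"
        "app (FA B g2) ?Y (act (FO B k) p' c) = app (FA B g2) ?Y (act (FO B k) p' c')"
        using same[OF O(4) k(1) Bk[OF h(3) k(2)] Bk[OF h(3) k(3)]] by blast
      \<comment> \<open>The two projections of \<open>c\<close> and \<open>c'\<close> become equal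
        at possibly different stages \<open>m1\<close> and \<open>m2\<close>. Along the common arrow
        \<open>r\<close> both equations hold at once, so uniqueness in the model at \<open>d\<close>
        applies.\<close>
      obtain d s t where d: "d \<in> Ob J" "s \<in> hom J m1 d" "t \<in> hom J m2 d" "Comp J s g1 = Comp J t g2"
        using filtered_span[OF J g1(1) g2(1)] .
      define r where "r = Comp J s g1"
      have r: "r \<in> hom J k d" "r = Comp J t g2" using Comp_hom[OF F(1) g1(1) d(2)] d(4) by (auto simp: r_def)
      have "app (FA B r) ?X (act (FO B k) f' c) = app (FA B r) ?X (act (FO B k) f' c')"
        using B(5)[OF g1(1) d(2) O(1) Bk[OF h(4) k(2)]] B(5)[OF g1(1) d(2) O(1) Bk[OF h(4) k(3)]] g1(2)
        unfolding r_def by simp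
      then have e1: "act (FO B d) f' (app (FA B r) ?P c) = act (FO B d) f' (app (FA B r) ?P c')"
        using B(6)[OF r(1) h(4) k(2)] B(6)[OF r(1) h(4) k(3)] by simp
      have "app (FA B r) ?Y (act (FO B k) p' c) = app (FA B r) ?Y (act (FO B k) p' c')"
        using B(5)[OF g2(1) d(3) O(4) Bk[OF h(3) k(2)]] B(5)[OF g2(1) d(3) O(4) Bk[OF h(3) k(3)]] g2(2)
        unfolding r(2) by simp
      then have e2: "act (FO B d) p' (app (FA B r) ?P c) = act (FO B d) p' (app (FA B r) ?P c')"
        using B(6)[OF r(1) h(3) k(2)] B(6)[OF r(1) h(3) k(3)] by simp
      note c = B(3)[OF r(1) O(3) k(2)] and c' = B(3)[OF r(1) O(3) k(3)]
      have "act (FO B d) p (act (FO B d) f' (app (FA B r) ?P c))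
          = act (FO B d) f (act (FO B d) p' (app (FA B r) ?P c))"
        using act(6)[OF B(1)[OF d(1)] h(4,1) c] act(6)[OF B(1)[OF d(1)] h(3,2) c] h(5) by simp
      from comm[OF d(1) act(4)[OF B(1)[OF d(1)] h(4) c] act(4)[OF B(1)[OF d(1)] h(3) c] this]
      have "app (FA B r) ?P c = app (FA B r) ?P c'" using c c' e1 e2 by metis
      then have "rep ?P k c = rep ?P k c'"
        using push[OF O(3) r(1) k(2)] push[OF O(3) r(1) k(3)] by simp
      then show "z' = rep ?P l z" using k(4,5) by simp
    qed
  qed
  define i where "i j = mk_map T (FO B j) L (\<lambda>X. rep X j)" for j
  have ih: "i j \<in> hom M (FO B j) L" if j: "j \<in> Ob J" for j
    unfolding i_def
    by (rule mk_map_hom[OF B(1)[OF j] LM]) (use LS S_I[OF j] La[OF _ j] in auto)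
  have ia: "app (i j) X x = rep X j x" if "X \<in> Ob T" "x \<in> FO (FO B j) X" for X j x
    using that unfolding i_def by simp
  have "pointwise_colimit J B L i"
    unfolding pointwise_colimit_def
  proof (intro conjI ballI impI BF)
    show "is_cocone J M B L i"
      unfolding is_cocone_def M_Ob
    proof (intro conjI ballI LM ih)
      fix f assume "f \<in> Arr J"
      then have f: "f \<in> hom J (Dom J f) (Cod J f)" by (rule Arr_hom)
      note O = hom_Ob[OF F(1) f]
      show "Comp M (i (Cod J f)) (FA B f) = i (Dom J f)"
      proof (rule M_hom_eqI[OF Comp_hom[OF M B(2)[OF f] ih[OF O(2)]] ih[OF O(1)]])
        fix X x assume X: "X \<in> Ob T" and x: "x \<in> FO (FO B (Dom J f)) X"
        then show "app (Comp M (i (Cod J f)) (FA B f)) X x = app (i (Dom J f)) X x"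
          using app_Comp[OF B(2)[OF f] ih[OF O(2)] X x] ia[OF X x] ia[OF X B(3)[OF f X x]]
            push[OF X f x] by simp
      qed
    qed
    show "\<exists>j\<in>Ob J. \<exists>x\<in>FO (FO B j) X. z = app (i j) X x" if "X \<in> Ob T" "z \<in> FO L X" for X z
      using S_E[of z X] LS[OF that(1)] that ia[OF that(1)] by metis
    show "germ J B X j x k y"
      if "X \<in> Ob T" "j \<in> Ob J" "k \<in> Ob J" "x \<in> FO (FO B j) X" "y \<in> FO (FO B k) X"
        "app (i j) X x = app (i k) X y" for X j k x y
      using that rep_eq[OF that(1-5)] ia by simp
  qed
  then show ?thesis by blast
qed

text \<open>Compactness speaks of arbitrary colimit cocones in \<open>M\<close>. The comparison with
  the constructed colimit satisfies \<open>gh\<close>, so surjectivity is brought back along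
  \<open>g\<close> and equality of elements is carried forward along \<open>h\<close>.\<close>

lemma colimit_pointwise:
  fixes J :: "('u, 'u) cat"
  assumes J: "is_filtered J" and sm: "small (Arr J)" and c: "is_colimit J M B c i"
  shows "pointwise_colimit J B c i"
proof -
  have C: "is_functor J M B" "is_cocone J M B c i"
    and uni: "\<And>c' i'. is_cocone J M B c' i' \<Longrightarrow>
      \<exists>!h. h \<in> hom M c c' \<and> (\<forall>j\<in>Ob J. Comp M h (i j) = i' j)"
    using c unfolding is_colimit_def by blast+
  have ih: "\<And>j. j \<in> Ob J \<Longrightarrow> i j \<in> hom M (FO B j) c" and cO: "c \<in> Ob M"
    using C(2) unfolding is_cocone_def by blast+
  obtain L l where L: "pointwise_colimit J B L l" using pointwise_colimit_exists[OF J sm C(1)] by blast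
  note P = pointwiseD[OF L]
  obtain h where h: "h \<in> hom M c L" "\<And>j. j \<in> Ob J \<Longrightarrow> Comp M h (i j) = l j"
    using uni[OF P(2)] by blast
  obtain g where g: "g \<in> hom M L c" "\<And>j. j \<in> Ob J \<Longrightarrow> Comp M g (l j) = i j"
    using pointwise_is_colimit[OF L] C(2) unfolding is_colimit_def by blast
  have gh: "Comp M g h = Id M c"
  proof -
    have "Comp M (Comp M g h) (i j) = i j" if "j \<in> Ob J" for j
      using Comp_assoc[OF M ih[OF that] h(1) g(1)] h(2) g(2) that by simp
    moreover have "Comp M (Id M c) (i j) = i j" if "j \<in> Ob J" for j
      using Comp_Id(2)[OF M ih[OF that]] .
    ultimately show ?thesis
      using uni[OF C(2)] Comp_hom[OF M h(1) g(1)] Id_hom[OF M cO] by blast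
  qed
  have hi: "app h X (app (i j) X x) = app (l j) X x"
    if "j \<in> Ob J" "X \<in> Ob T" "x \<in> FO (FO B j) X" for j X x
    using app_Comp[OF ih[OF that(1)] h(1) that(2,3)] h(2)[OF that(1)] by simp
  have gl: "app g X (app (l j) X x) = app (i j) X x"
    if "j \<in> Ob J" "X \<in> Ob T" "x \<in> FO (FO B j) X" for j X x
    using app_Comp[OF P(4)[OF that(1)] g(1) that(2,3)] g(2)[OF that(1)] by simp
  show ?thesis
    unfolding pointwise_colimit_def
  proof (intro conjI ballI impI C)
    fix X z assume X: "X \<in> Ob T" and z: "z \<in> FO c X"
    have gz: "app g X (app h X z) = z" using app_Comp[OF h(1) g(1) X z] gh X z by simp
    obtain j x where "j \<in> Ob J" "x \<in> FO (FO B j) X" "app h X z = app (l j) X x"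
      using P(6)[OF X M_homD(7)[OF h(1) X z]] by blast
    then show "\<exists>j\<in>Ob J. \<exists>x\<in>FO (FO B j) X. z = app (i j) X x" using gl X gz by metis
  next
    fix X j k x y
    assume a: "X \<in> Ob T" "j \<in> Ob J" "k \<in> Ob J" "x \<in> FO (FO B j) X" "y \<in> FO (FO B k) X"
      "app (i j) X x = app (i k) X y"
    then have "app (l j) X x = app (l k) X y" using hi by metis
    then show "germ J B X j x k y" using P(7) a by blast
  qed
qed

text \<open>By Yoneda, Hom(H(X),-) is evaluation at \<open>X\<close>, and filtered colimits of
  models are evaluated pointwise.\<close>

lemma H_compact:
  assumes X: "X \<in> Ob T" shows "is_compact T D (H_ob T X)"
  unfolding is_compact_def M_Ob
proof (intro conjI allI impI H_model[OF X])
  fix J :: "('u, 'u) cat" and B c i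
  assume J: "is_filtered J" "small (Arr J)" and c: "is_colimit J M B c i"
  note P = pointwiseD[OF colimit_pointwise[OF J c]]
  note B = diagD[OF P(1)]
  let ?H = "hom_functor M (H_ob T X)"
  note HF = hom_functor_functor[OF M, of "H_ob T X"]
  have FOH: "FO (comp_ftor J ?H B) j = hom M (H_ob T X) (FO B j)" if "j \<in> Ob J" for j
    using that B(1)[OF that] by (simp add: comp_ftor_def hom_functor_def M_Ob)
  have bodyi: "body (FA ?H (i j)) s = Comp M (i j) s"
    if "j \<in> Ob J" "s \<in> hom M (H_ob T X) (FO B j)" for j s
    using that P(4)[OF that(1)] by (simp add: hom_functor_def hom_def)
  have bodyf: "body (FA (comp_ftor J ?H B) f) s = Comp M (FA B f) s"
    if "f \<in> hom J j k" "s \<in> hom M (H_ob T X) (FO B j)" for f j k s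
    using that B(2)[OF that(1)] by (simp add: comp_ftor_def hom_functor_def hom_def)
  show "is_colimit J (set_cat (\<lambda>_. True)) (comp_ftor J ?H B) (FO ?H c) (\<lambda>j. FA ?H (i j))"
  proof (rule colimit_set_cat)
    show "is_functor J (set_cat (\<lambda>_. True)) (comp_ftor J ?H B)"
      by (rule comp_ftor_functor[OF P(1) HF])
    show "is_cocone J (set_cat (\<lambda>_. True)) (comp_ftor J ?H B) (FO ?H c) (\<lambda>j. FA ?H (i j))"
      by (rule is_cocone_functor[OF P(1) HF P(2)])
  next
    fix s assume "s \<in> FO ?H c"
    then have s: "s \<in> hom M (H_ob T X) c" using P(3) by (simp add: hom_functor_def M_Ob)
    note y = yoneda[OF s X]
    obtain j x where j: "j \<in> Ob J" "x \<in> FO (FO B j) X" "app s X (Id T X) = app (i j) X x"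
      using P(6)[OF X y(1)] by blast
    have "s = Comp M (i j) (yo (FO B j) X x)"
      using yo_Comp[OF P(4)[OF j(1)] X j(2)] y(2) j(3) by simp
    then show "\<exists>j\<in>Ob J. \<exists>x\<in>FO (comp_ftor J ?H B) j. s = body (FA ?H (i j)) x"
      using j(1) FOH[OF j(1)] bodyi[OF j(1)] yo_hom[OF B(1)[OF j(1)] X j(2)] by metis
  next
    fix j k s t
    assume j: "j \<in> Ob J" and k: "k \<in> Ob J" and "s \<in> FO (comp_ftor J ?H B) j"
      and "t \<in> FO (comp_ftor J ?H B) k" and e: "body (FA ?H (i j)) s = body (FA ?H (i k)) t"
    then have s: "s \<in> hom M (H_ob T X) (FO B j)" and t: "t \<in> hom M (H_ob T X) (FO B k)"
      using FOH by auto
    note ys = yoneda[OF s X] and yt = yoneda[OF t X]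
    have IdX: "Id T X \<in> FO (H_ob T X) X" using Id_hom[OF T X] X by simp
    have "app (i j) X (app s X (Id T X)) = app (i k) X (app t X (Id T X))"
      using e bodyi[OF j s] bodyi[OF k t] app_Comp[OF s P(4)[OF j] X IdX]
        app_Comp[OF t P(4)[OF k] X IdX] by simp
    then obtain l f g where l: "l \<in> Ob J" "f \<in> hom J j l" "g \<in> hom J k l"
      "app (FA B f) X (app s X (Id T X)) = app (FA B g) X (app t X (Id T X))"
      using P(7)[OF X j k ys(1) yt(1)] unfolding germ_def by blast
    have "Comp M (FA B f) s = Comp M (FA B g) t"
      using yo_Comp[OF B(2)[OF l(2)] X ys(1)] yo_Comp[OF B(2)[OF l(3)] X yt(1)] ys(2) yt(2) l(4)
      by simp
    then show "\<exists>l\<in>Ob J. \<exists>f\<in>hom J j l. \<exists>g\<in>hom J k l.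
        body (FA (comp_ftor J ?H B) f) s = body (FA (comp_ftor J ?H B) g) t"
      using l bodyf[OF l(2) s] bodyf[OF l(3) t] by metis
  qed
qed

text \<open>Maps out of H(t) are elements of A(t), which is a singleton for every model A.\<close>

lemma H_terminal_initial:
  assumes t: "is_terminal T t" shows "is_initial M (H_ob T t)"
  unfolding is_initial_def
proof (intro conjI ballI)
  have tO: "t \<in> Ob T" using t unfolding is_terminal_def by blast
  show "H_ob T t \<in> Ob M" unfolding M_Ob by (rule H_model[OF tO])
  fix A assume "A \<in> Ob M"
  then have A: "is_model T D A" unfolding M_Ob .
  obtain a where a: "a \<in> FO A t" "\<And>b. b \<in> FO A t \<Longrightarrow> b = a" using modelD(2)[OF A t] by blast
  show "\<exists>!f. f \<in> hom M (H_ob T t) A"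
    using yo_hom[OF A tO a(1)] yoneda[OF _ tO] a(2) by metis
qed

lemma H_extension: "p \<in> D \<Longrightarrow> is_extension T D (H_map T p)"
  using H_map_hom[OF Arr_hom[OF D_Arr]] unfolding is_extension_def is_full_def hom_def by blast

text \<open>The arrow from \<open>X\<close> to the terminal object is a display map, and its image
  under H starts at an initial model.\<close>

lemma H_zero_extension:
  assumes X: "X \<in> Ob T" shows "zero_extension T D (H_ob T X)"
proof -
  obtain t where t: "is_terminal T t" using terminal .
  then obtain f where f: "f \<in> hom T X t" using X unfolding is_terminal_def by blast
  show ?thesis
    unfolding zero_extension_def M_Ob
    using H_model[OF X] H_terminal_initial[OF t] H_map_hom[OF f] H_extension[OF D_terminal[OF t f]]
    by blast
qed

end

section \<open>Cell complexes over a model\<close>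

text \<open>A cell lists its lower cells, each with the arrow from the context of the cell to that of the
  lower cell.\<close>

datatype ('o, 'u) cell =
  Cell (faces: "(('o, 'u) cell \<times> 'u) list") (ctx: 'o) (elt: 'u)

definition below :: "('o, 'u) cell \<Rightarrow> ('o, 'u) cell set" where
  "below j = fst ` set (faces j)"

text \<open>The descent measure: it keeps a cell out of its own faces and lets missing cells be
  added in order of size.\<close>

lemma size_below: "s \<in> below j \<Longrightarrow> size s < size j"
proof (cases j)
  case (Cell l k a)
  assume "s \<in> below j"
  then obtain u where "(s, u) \<in> set l" by (auto simp: below_def Cell)
  then have "size s \<le> size_list (size_prod size (\<lambda>_. 0)) l" by (induction l) auto
  then show ?thesis unfolding Cell by simp
qed

lemma finite_below: "finite (below j)"
  by (simp add: below_def)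

lemma not_below_self: "j \<notin> below j"
  using size_below by blast

definition lower :: "('o, 'u) cell \<Rightarrow> ('o, 'u) cell set" where
  "lower j = insert j (below j)"

locale cell_complex = small_clan T D for T :: "('o, 'u) cat" and D :: "'u set" +
  fixes A :: "('o, 'u) copresheaf" and Y :: 'o and y :: 'u
  assumes A: "is_model T D A" and Y: "Y \<in> Ob T" and y: "y \<in> FO A Y"
begin

text \<open>The transition from the context of \<open>j\<close> to that of \<open>s\<close>,
  meaningful for \<open>s\<close> in \<open>lower j\<close>. A well-founded cell never lists itself,
  so the identity at \<open>s = j\<close> does not clash with an entry.\<close>

definition tr :: "('o, 'u) cell \<Rightarrow> ('o, 'u) cell \<Rightarrow> 'u" where
  "tr j s = (if s = j then Id T (ctx j) else the (map_of (faces j) s))"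

text \<open>For a downward closed \<open>S\<close>: an element of the limit over \<open>S\<close> of
  the sets B(ctx s).\<close>

definition family :: "('o, 'u) copresheaf \<Rightarrow> ('o, 'u) cell set \<Rightarrow> (('o, 'u) cell \<Rightarrow> 'u) \<Rightarrow> bool" where
  "family B S x \<longleftrightarrow> (\<forall>s\<in>S. x s \<in> FO B (ctx s)) \<and>
     (\<forall>s\<in>S. \<forall>r\<in>below s. act B (tr s r) (x s) = x r)"

text \<open>Testing against all models covers the universal property of a limit in \<open>T\<close>, by taking
  representable models, and at the same time says that models preserve this limit.\<close>

definition lim :: "('o, 'u) cell set \<Rightarrow> 'o \<Rightarrow> (('o, 'u) cell \<Rightarrow> 'u) \<Rightarrow> bool" where
  "lim S L \<pi> \<longleftrightarrow> L \<in> Ob T \<and> (\<forall>s\<in>S. \<pi> s \<in> hom T L (ctx s)) \<and>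
     (\<forall>s\<in>S. \<forall>r\<in>below s. Comp T (tr s r) (\<pi> s) = \<pi> r) \<and>
     (\<forall>B x. is_model T D B \<longrightarrow> family B S x \<longrightarrow>
        (\<exists>!z. z \<in> FO B L \<and> (\<forall>s\<in>S. act B (\<pi> s) z = x s)))"

definition bot :: "('o, 'u) cell" where
  "bot = Cell [] Y y"

text \<open>The limit \<open>L\<close>, its projections and \<open>q\<close> are not stored in the
  cell; it is only required that its transitions arise from some such choice. The condition that
  \<open>\<pi> bot\<close> is a display map lets the composite to \<open>Y\<close> be one. All
  arrows in the list are required to lie in \<open>T\<close>, including entries shadowed in
  \<open>map_of\<close>, so that the cells can be counted.\<close>

inductive wf :: "('o, 'u) cell \<Rightarrow> bool" where
  wf_bot: "wf (Cell [] Y y)"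
| wf_Cell: "l \<noteq> [] \<Longrightarrow> (\<And>s u. (s, u) \<in> set l \<Longrightarrow> wf s) \<Longrightarrow> (\<And>s u. (s, u) \<in> set l \<Longrightarrow> u \<in> Arr T) \<Longrightarrow>
    (\<And>s. s \<in> fst ` set l \<Longrightarrow> below s \<subseteq> fst ` set l) \<Longrightarrow> lim (fst ` set l) L \<pi> \<Longrightarrow> \<pi> bot \<in> D \<Longrightarrow>
    q \<in> D \<Longrightarrow> q \<in> hom T k L \<Longrightarrow>
    (\<And>s. s \<in> fst ` set l \<Longrightarrow> the (map_of l s) = Comp T (\<pi> s) q) \<Longrightarrow>
    a \<in> FO A k \<Longrightarrow> (\<And>s. s \<in> fst ` set l \<Longrightarrow> act A (the (map_of l s)) a = elt s) \<Longrightarrow>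
    wf (Cell l k a)"

lemma limD:
  assumes "lim S L \<pi>"
  shows "L \<in> Ob T" and "s \<in> S \<Longrightarrow> \<pi> s \<in> hom T L (ctx s)"
    and "s \<in> S \<Longrightarrow> r \<in> below s \<Longrightarrow> Comp T (tr s r) (\<pi> s) = \<pi> r"
    and "is_model T D B \<Longrightarrow> family B S x \<Longrightarrow> \<exists>!z. z \<in> FO B L \<and> (\<forall>s\<in>S. act B (\<pi> s) z = x s)"
  using assms unfolding lim_def by blast+

lemma limI:
  assumes "L \<in> Ob T" "\<And>s. s \<in> S \<Longrightarrow> \<pi> s \<in> hom T L (ctx s)"
    "\<And>s r. s \<in> S \<Longrightarrow> r \<in> below s \<Longrightarrow> Comp T (tr s r) (\<pi> s) = \<pi> r"
    "\<And>B x. is_model T D B \<Longrightarrow> family B S x \<Longrightarrow> \<exists>!z. z \<in> FO B L \<and> (\<forall>s\<in>S. act B (\<pi> s) z = x s)"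
  shows "lim S L \<pi>"
  using assms unfolding lim_def by blast

lemma wf_bot': "wf bot"
  unfolding bot_def by (rule wf_bot)

lemma bot_simps [simp]: "below bot = {}" "ctx bot = Y" "elt bot = y" "lower bot = {bot}"
  by (simp_all add: bot_def below_def lower_def)

lemma wf_ctx: "wf j \<Longrightarrow> ctx j \<in> Ob T"
  by (induction rule: wf.induct) (use Y hom_Ob[OF T] in auto)

lemma wf_elt: "wf j \<Longrightarrow> elt j \<in> FO A (ctx j)"
  by (induction rule: wf.induct) (use y in auto)

lemma wf_below: "wf j \<Longrightarrow> s \<in> below j \<Longrightarrow> wf s"
  by (induction rule: wf.induct) (auto simp: below_def)

lemma wf_below_closed: "wf j \<Longrightarrow> s \<in> below j \<Longrightarrow> below s \<subseteq> below j"
  by (induction rule: wf.induct) (auto simp: below_def)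

text \<open>The list of a cell other than \<open>bot\<close> is nonempty; by induction
  \<open>bot\<close> is its first face or lies below that face.\<close>

lemma wf_bot_below: "wf j \<Longrightarrow> j \<noteq> bot \<Longrightarrow> bot \<in> below j"
proof (induction rule: wf.induct)
  case (wf_Cell l L \<pi> q k a)
  then obtain s u where s: "(s, u) \<in> set l" by (metis list.set_intros(1) neq_Nil_conv surj_pair)
  show ?case
  proof (cases "s = bot")
    case True
    then show ?thesis using s by (force simp: below_def)
  next
    case False
    then have "bot \<in> below s" using wf_Cell.IH[OF s] by blast
    then show ?thesis using wf_Cell.hyps(4)[of s] s by (force simp: below_def)
  qed
qed (simp add: bot_def)

lemma wf_top:
  assumes "wf j" "j \<noteq> bot"
  obtains L \<pi> q where "lim (below j) L \<pi>" "\<pi> bot \<in> D" "q \<in> D" "q \<in> hom T (ctx j) L"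
    "\<And>s. s \<in> below j \<Longrightarrow> tr j s = Comp T (\<pi> s) q"
    "\<And>s. s \<in> below j \<Longrightarrow> act A (tr j s) (elt j) = elt s"
  using assms(1)
proof cases
  case wf_bot
  then show ?thesis using assms(2) by (simp add: bot_def)
next
  case (wf_Cell l L \<pi> q k a)
  have b: "below j = fst ` set l" by (simp add: below_def wf_Cell(1))
  have "tr j s = the (map_of l s)" if "s \<in> below j" for s
    using that not_below_self[of j] by (auto simp: tr_def wf_Cell(1))
  then show ?thesis using that[of L \<pi> q] wf_Cell(5-) wf_Cell(1) b by simp
qed

lemma tr_self [simp]: "tr j j = Id T (ctx j)"
  by (simp add: tr_def)

lemma tr_hom:
  assumes "wf j" "s \<in> lower j" shows "tr j s \<in> hom T (ctx j) (ctx s)"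
proof (cases "s = j")
  case True
  then show ?thesis using Id_hom[OF T wf_ctx[OF assms(1)]] by simp
next
  case False
  then have s: "s \<in> below j" and "j \<noteq> bot" using assms by (auto simp: lower_def)
  then obtain L \<pi> q where *: "lim (below j) L \<pi>" "q \<in> hom T (ctx j) L" "tr j s = Comp T (\<pi> s) q"
    using wf_top[OF assms(1)] by metis
  show ?thesis using Comp_hom[OF T *(2) limD(2)[OF *(1) s]] *(3) by simp
qed

lemma tr_comp_below:
  assumes "wf j" "s \<in> lower j" "r \<in> below s" shows "Comp T (tr s r) (tr j s) = tr j r"
proof (cases "s = j")
  case True
  then show ?thesis using tr_hom[OF assms(1), of r] assms(3) Comp_Id(1)[OF T] by (simp add: lower_def)
next
  case False
  then have s: "s \<in> below j" and j: "j \<noteq> bot" using assms(2) by (auto simp: lower_def)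
  then obtain L \<pi> q where *: "lim (below j) L \<pi>" "q \<in> hom T (ctx j) L"
    "\<And>s. s \<in> below j \<Longrightarrow> tr j s = Comp T (\<pi> s) q"
    using wf_top[OF assms(1)] by metis
  have r: "r \<in> below j" using wf_below_closed[OF assms(1) s] assms(3) by blast
  have "Comp T (tr s r) (Comp T (\<pi> s) q) = Comp T (Comp T (tr s r) (\<pi> s)) q"
    by (rule Comp_assoc[OF T *(2) limD(2)[OF *(1) s] tr_hom[OF wf_below[OF assms(1) s]]])
      (use assms(3) in \<open>simp add: lower_def\<close>)
  then show ?thesis using *(3)[OF s] *(3)[OF r] limD(3)[OF *(1) s assms(3)] by simp
qed

lemma lower_trans: "wf j \<Longrightarrow> s \<in> lower j \<Longrightarrow> r \<in> lower s \<Longrightarrow> r \<in> lower j"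
  using wf_below_closed unfolding lower_def by blast

lemma wf_lower: "wf j \<Longrightarrow> s \<in> lower j \<Longrightarrow> wf s"
  using wf_below unfolding lower_def by blast

lemma tr_comp:
  assumes "wf j" "s \<in> lower j" "r \<in> lower s" shows "Comp T (tr s r) (tr j s) = tr j r"
  using assms tr_comp_below tr_hom[OF assms(1,2)] Comp_Id(2)[OF T] unfolding lower_def by fastforce

lemma act_tr_elt:
  assumes "wf j" "s \<in> lower j" shows "act A (tr j s) (elt j) = elt s"
proof (cases "s = j")
  case True
  then show ?thesis using act(5)[OF A wf_ctx wf_elt] assms(1) by simp
next
  case False
  then have "s \<in> below j" "j \<noteq> bot" using assms by (auto simp: lower_def)
  then show ?thesis using wf_top[OF assms(1)] by metis
qed

lemma bot_lower: "wf j \<Longrightarrow> bot \<in> lower j"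
  using wf_bot_below unfolding lower_def by blast

text \<open>The arrow to \<open>Y\<close> is the top display map \<open>q\<close> followed by the
  projection of the limit to \<open>Y\<close>, and display maps compose.\<close>

lemma tr_bot:
  assumes "wf j" shows "tr j bot \<in> D" "tr j bot \<in> hom T (ctx j) Y"
proof -
  show h: "tr j bot \<in> hom T (ctx j) Y" using tr_hom[OF assms bot_lower[OF assms]] by simp
  show "tr j bot \<in> D"
  proof (cases "j = bot")
    case True
    then show ?thesis using D_Id[OF Y] by simp
  next
    case False
    note b = wf_bot_below[OF assms False]
    from False obtain L \<pi> q where *: "lim (below j) L \<pi>" "\<pi> bot \<in> D" "q \<in> D" "q \<in> hom T (ctx j) L"
      "tr j bot = Comp T (\<pi> bot) q"
      using wf_top[OF assms] b by metis
    show ?thesis using D_Comp[OF *(3,2,4) limD(2)[OF *(1) b]] *(5) by simp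
  qed
qed

section \<open>Limits over finite downward closed sets of cells\<close>

definition closed :: "('o, 'u) cell set \<Rightarrow> bool" where
  "closed S \<longleftrightarrow> finite S \<and> S \<noteq> {} \<and> (\<forall>s\<in>S. wf s \<and> below s \<subseteq> S)"

lemma closed_lower: "wf j \<Longrightarrow> closed (lower j)"
  using wf_lower wf_below_closed finite_below unfolding closed_def lower_def by blast

text \<open>Nonemptiness in \<open>closed\<close> is there for this: every limit over a closed set
  then projects to \<open>Y\<close>.\<close>

lemma closed_bot: "closed S \<Longrightarrow> bot \<in> S"
  using wf_bot_below unfolding closed_def by blast

lemma closed_Un: "closed R \<Longrightarrow> closed S \<Longrightarrow> closed (R \<union> S)"
  unfolding closed_def by auto

lemma lim_bot: "lim {bot} Y (\<lambda>_. Id T Y)"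
proof (rule limI, goal_cases)
  case (4 B x)
  then have "x bot \<in> FO B Y" by (simp add: family_def)
  then show ?case using act(5)[OF 4(1) Y] by auto
qed (use Y Id_hom[OF T Y] in auto)

text \<open>The projections of \<open>L\<close> to the cells below \<open>m\<close> induce an arrow
  from \<open>L\<close> to the limit over \<open>below m\<close>. The new limit is the pullback
  along it of the display map of \<open>m\<close>, and \<open>d\<close> is the pulled back display
  map.\<close>

lemma lim_insert:
  assumes R: "closed R" and LR: "lim R L \<pi>" and m: "wf m" "m \<notin> R" and b: "below m \<subseteq> R"
  obtains L' \<pi>' d where "lim (insert m R) L' \<pi>'" "d \<in> D" "d \<in> hom T L' L"
    "\<And>s. s \<in> R \<Longrightarrow> \<pi>' s = Comp T (\<pi> s) d"
proof -
  have "m \<noteq> bot" using closed_bot[OF R] m(2) by blast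
  then obtain L0 \<pi>0 q where L0: "lim (below m) L0 \<pi>0" and q: "q \<in> D" "q \<in> hom T (ctx m) L0"
    and trm: "\<And>s. s \<in> below m \<Longrightarrow> tr m s = Comp T (\<pi>0 s) q"
    using wf_top[OF m(1)] by metis
  have O: "L \<in> Ob T" "ctx m \<in> Ob T" using limD(1)[OF LR] wf_ctx[OF m(1)] by auto
  have Rs: "wf s" "below s \<subseteq> R" "\<pi> s \<in> hom T L (ctx s)" "ctx s \<in> Ob T" if "s \<in> R" for s
    using R that limD(2)[OF LR] wf_ctx unfolding closed_def by auto
  \<comment> \<open>Taking the test model to be representable recovers the universal property of
    \<open>L0\<close> in \<open>T\<close>: a compatible family with values in H(L) is a cone with
    vertex \<open>L\<close>.\<close>
  have "family (H_ob T L) (below m) \<pi>"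
    unfolding family_def
  proof (intro conjI ballI)
    show "\<pi> s \<in> FO (H_ob T L) (ctx s)" if "s \<in> below m" for s
      using that b Rs by auto
    show "act (H_ob T L) (tr s r) (\<pi> s) = \<pi> r" if "s \<in> below m" "r \<in> below s" for s r
      using that b Rs[of s] tr_hom[of s r] limD(3)[OF LR, of s r] by (auto simp: lower_def)
  qed
  then obtain h where "h \<in> FO (H_ob T L) L0" and h2: "\<forall>s\<in>below m. act (H_ob T L) (\<pi>0 s) h = \<pi> s"
    using limD(4)[OF L0 H_model[OF O(1)]] by blast
  then have h1: "h \<in> hom T L L0" using limD(1)[OF L0] by simp
  have "Comp T (\<pi>0 s) h = \<pi> s" if "s \<in> below m" for s
    using act_H[OF limD(2)[OF L0 that] h1] h2 that by simp
  note h = h1 this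
  obtain P q' h' where P: "is_pullback T q h q' h'" "q' \<in> D" "q' \<in> hom T P L" "h' \<in> hom T P (ctx m)"
    "Comp T q h' = Comp T h q'" "P \<in> Ob T"
    using D_pullback[OF q h(1)] .
  define \<pi>' where "\<pi>' s = (if s = m then h' else Comp T (\<pi> s) q')" for s
  have \<pi>'m: "\<pi>' m = h'" and \<pi>'R: "\<And>s. s \<in> R \<Longrightarrow> \<pi>' s = Comp T (\<pi> s) q'"
    using m(2) by (auto simp: \<pi>'_def)
  have "lim (insert m R) P \<pi>'"
  proof (rule limI[OF P(6)])
    show "\<pi>' s \<in> hom T P (ctx s)" if "s \<in> insert m R" for s
      using that \<pi>'m \<pi>'R P(4) Comp_hom[OF T P(3) Rs(3)] by auto
    show "Comp T (tr s r) (\<pi>' s) = \<pi>' r" if s: "s \<in> insert m R" and r: "r \<in> below s" for s r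
    proof (cases "s = m")
      case True
      then have rm: "r \<in> below m" and rR: "r \<in> R" using r b by auto
      note p0 = limD(2)[OF L0 rm]
      have "Comp T (tr m r) h' = Comp T (\<pi>0 r) (Comp T q h')"
        using trm[OF rm] Comp_assoc[OF T P(4) q(2) p0] by simp
      also have "\<dots> = Comp T (\<pi> r) q'"
        using P(5) Comp_assoc[OF T P(3) h(1) p0] h(2)[OF rm] by simp
      finally show ?thesis using True \<pi>'m \<pi>'R[OF rR] by simp
    next
      case False
      then have sR: "s \<in> R" and rR: "r \<in> R" using s r Rs(2) by auto
      have "Comp T (tr s r) (Comp T (\<pi> s) q') = Comp T (Comp T (tr s r) (\<pi> s)) q'"
        by (rule Comp_assoc[OF T P(3) Rs(3)[OF sR] tr_hom[OF Rs(1)[OF sR]]])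
          (use r in \<open>simp add: lower_def\<close>)
      then show ?thesis using limD(3)[OF LR sR r] \<pi>'R sR rR by simp
    qed
    fix B x assume B: "is_model T D B" and x: "family B (insert m R) x"
    note aB = act(6)[OF B]
    have xR: "family B R x" and x0: "family B (below m) x" and xm: "x m \<in> FO B (ctx m)"
      and xc: "\<And>r. r \<in> below m \<Longrightarrow> act B (tr m r) (x m) = x r"
      using x b unfolding family_def by auto
    obtain zR where zR: "zR \<in> FO B L" "\<And>s. s \<in> R \<Longrightarrow> act B (\<pi> s) zR = x s"
      and zRu: "\<And>z. z \<in> FO B L \<Longrightarrow> (\<And>s. s \<in> R \<Longrightarrow> act B (\<pi> s) z = x s) \<Longrightarrow> z = zR"
      using limD(4)[OF LR B xR] by metis
    \<comment> \<open>Both are elements of B(L0) with projections \<open>x s\<close>, so they agree;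
      this is the matching condition for the pullback.\<close>
    have "act B q (x m) = act B h zR"
    proof (rule ex1E[OF limD(4)[OF L0 B x0]])
      fix z0 assume z0: "\<forall>z. z \<in> FO B L0 \<and> (\<forall>s\<in>below m. act B (\<pi>0 s) z = x s) \<longrightarrow> z = z0"
      have "act B (\<pi>0 s) (act B h zR) = x s" if s: "s \<in> below m" for s
        using aB[OF h(1) limD(2)[OF L0 s] zR(1)] h(2)[OF s] zR(2) b s by auto
      moreover have "act B (\<pi>0 s) (act B q (x m)) = x s" if s: "s \<in> below m" for s
        using aB[OF q(2) limD(2)[OF L0 s] xm] trm[OF s] xc[OF s] by simp
      ultimately have "act B h zR = z0" "act B q (x m) = z0"
        using z0 act(4)[OF B h(1) zR(1)] act(4)[OF B q(2) xm] by blast+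
      then show ?thesis by simp
    qed
    then obtain z where z: "z \<in> FO B P" "act B h' z = x m" "act B q' z = zR"
      and zu: "\<And>w. w \<in> FO B P \<Longrightarrow> act B h' w = x m \<Longrightarrow> act B q' w = zR \<Longrightarrow> w = z"
      using modelD(3)[OF B q(1) P(1)] homD(2)[OF q(2)] homD(2)[OF h(1)] homD(2)[OF P(3)] xm zR(1)
      by metis
    show "\<exists>!z. z \<in> FO B P \<and> (\<forall>s\<in>insert m R. act B (\<pi>' s) z = x s)"
    proof (rule ex1I[of _ z], intro conjI ballI)
      show "z \<in> FO B P" by (fact z)
      show "act B (\<pi>' s) z = x s" if "s \<in> insert m R" for s
        using that \<pi>'m z(2) \<pi>'R aB[OF P(3) Rs(3) z(1)] z(3) zR(2) by auto
      fix w assume w: "w \<in> FO B P \<and> (\<forall>s\<in>insert m R. act B (\<pi>' s) w = x s)"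
      have "act B q' w = zR"
      proof (rule zRu)
        show "act B q' w \<in> FO B L" using act(4)[OF B P(3)] w by blast
        show "act B (\<pi> s) (act B q' w) = x s" if "s \<in> R" for s
          using aB[OF P(3) Rs(3)[OF that], of w] w \<pi>'R[OF that] that by (metis insertI2)
      qed
      then show "w = z" using zu w \<pi>'m by auto
    qed
  qed
  then show ?thesis using that P(2,3) \<pi>'R by blast
qed

text \<open>Induction on the number of missing cells. A missing cell of least size has all its lower
  cells in \<open>R\<close>, so it can be inserted; the display maps of the single steps compose to
  \<open>d\<close>.\<close>

lemma lim_grow:
  assumes S: "closed S" and R: "closed R" "R \<subseteq> S" and L: "lim R L \<pi>"
  shows "\<exists>L' \<pi>' d. lim S L' \<pi>' \<and> d \<in> D \<and> d \<in> hom T L' L \<and> (\<forall>s\<in>R. \<pi>' s = Comp T (\<pi> s) d)"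
  using R L
proof (induction "card (S - R)" arbitrary: R L \<pi>)
  case 0
  have "finite (S - R)" using S unfolding closed_def by simp
  then have "S = R" using 0 by auto
  then have "lim S L \<pi> \<and> Id T L \<in> D \<and> Id T L \<in> hom T L L \<and> (\<forall>s\<in>R. \<pi> s = Comp T (\<pi> s) (Id T L))"
    using 0 limD(1,2)[OF 0(4)] D_Id Id_hom[OF T] Comp_Id(1)[OF T] by metis
  then show ?case by blast
next
  case (Suc n)
  have fin: "finite (S - R)" using S unfolding closed_def by simp
  have "S - R \<noteq> {}" using Suc(2) by force
  then obtain m where m: "m \<in> S - R" "\<And>s. s \<in> S - R \<Longrightarrow> size m \<le> size s"
    using ex_has_least_nat[of "\<lambda>s. s \<in> S - R" _ size] by blast
  have wm: "wf m" and "below m \<subseteq> S" using S m(1) unfolding closed_def by auto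
  then have b: "below m \<subseteq> R" using m(2) size_below by (meson DiffI linorder_not_le subset_iff)
  obtain L1 \<pi>1 d1 where L1: "lim (insert m R) L1 \<pi>1" "d1 \<in> D" "d1 \<in> hom T L1 L"
    "\<And>s. s \<in> R \<Longrightarrow> \<pi>1 s = Comp T (\<pi> s) d1"
    using lim_insert[OF Suc(3,5) wm _ b] m(1) by blast
  have cl: "closed (insert m R)" using Suc(3) wm b unfolding closed_def by auto
  have "S - insert m R = (S - R) - {m}" by auto
  then have "n = card (S - insert m R)" using Suc(2) fin m(1) by simp
  from Suc(1)[OF this cl _ L1(1)] m(1) Suc(4) obtain L2 \<pi>2 d2 where
    L2: "lim S L2 \<pi>2" "d2 \<in> D" "d2 \<in> hom T L2 L1" "\<And>s. s \<in> insert m R \<Longrightarrow> \<pi>2 s = Comp T (\<pi>1 s) d2"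
    by blast
  have "\<pi>2 s = Comp T (\<pi> s) (Comp T d1 d2)" if "s \<in> R" for s
    using L2(4)[of s] L1(4)[OF that] that Comp_assoc[OF T L2(3) L1(3) limD(2)[OF Suc(5) that]] by simp
  then show ?case
    using L2(1) D_Comp[OF L2(2) L1(2) L2(3) L1(3)] Comp_hom[OF T L2(3) L1(3)] by blast
qed

text \<open>Growing from \<open>{bot}\<close>, whose limit is \<open>Y\<close>, makes the projection
  to \<open>Y\<close> the accumulated display map.\<close>

lemma lim_exists:
  assumes S: "closed S"
  obtains L \<pi> where "lim S L \<pi>" "\<pi> bot \<in> D"
proof -
  have "closed {bot}" using wf_bot' unfolding closed_def by simp
  then obtain L \<pi> d where L: "lim S L \<pi>" "d \<in> D" "d \<in> hom T L Y" "\<pi> bot = Comp T (Id T Y) d"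
    using lim_grow[OF S _ _ lim_bot] closed_bot[OF S] by auto
  then show ?thesis using that[of L \<pi>] Comp_Id(2)[OF T L(3)] by simp
qed

text \<open>A compatible family on \<open>lower j\<close> is determined by its value at the top cell
  \<open>j\<close>.\<close>

lemma lim_lower:
  assumes j: "wf j" shows "lim (lower j) (ctx j) (tr j)"
proof (rule limI)
  fix B x assume B: "is_model T D B" and x: "family B (lower j) x"
  have xj: "x j \<in> FO B (ctx j)" using x by (simp add: family_def lower_def)
  show "\<exists>!z. z \<in> FO B (ctx j) \<and> (\<forall>s\<in>lower j. act B (tr j s) z = x s)"
  proof (rule ex1I[of _ "x j"], intro conjI ballI xj)
    show "act B (tr j s) (x j) = x s" if "s \<in> lower j" for s
      using that x xj act(5)[OF B wf_ctx[OF j]] by (auto simp: family_def lower_def)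
    show "z = x j" if "z \<in> FO B (ctx j) \<and> (\<forall>s\<in>lower j. act B (tr j s) z = x s)" for z
      using that act(5)[OF B wf_ctx[OF j], of z] by (auto simp: lower_def)
  qed
qed (use j wf_ctx tr_hom tr_comp_below in auto)

section \<open>Attaching new cells: directedness, lifting and cardinality\<close>

lemma wf_new:
  assumes S: "closed S" and L: "lim S L \<pi>" "\<pi> bot \<in> D" and q: "q \<in> D" "q \<in> hom T k L"
    and a: "a \<in> FO A k" "\<And>s. s \<in> S \<Longrightarrow> act A (Comp T (\<pi> s) q) a = elt s"
  obtains j where "wf j" "below j = S" "ctx j = k" "elt j = a"
    "\<And>s. s \<in> S \<Longrightarrow> tr j s = Comp T (\<pi> s) q"
proof -
  have "finite S" using S by (simp add: closed_def)
  \<comment> \<open>Another enumeration of \<open>S\<close> gives a different cell with the same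
    transitions; such duplicates are harmless, since only directedness of the order matters.\<close>
  then obtain xs where xs: "set xs = S" using finite_list by blast
  define l where "l = map (\<lambda>s. (s, Comp T (\<pi> s) q)) xs"
  have fl: "fst ` set l = S" unfolding l_def using xs by force
  have ml: "the (map_of l s) = Comp T (\<pi> s) q" if "s \<in> S" for s
    using that xs unfolding l_def by (simp add: map_of_map_restrict)
  have "wf (Cell l k a)"
  proof (rule wf_Cell[of l L \<pi> q])
    show "l \<noteq> []" using S xs unfolding l_def closed_def by auto
    show "u \<in> Arr T" if "(s, u) \<in> set l" for s u
      using that xs homD(1)[OF Comp_hom[OF T q(2) limD(2)[OF L(1)]]] unfolding l_def by auto
    show "wf s" if "(s, u) \<in> set l" for s u
      using that xs S unfolding l_def closed_def by auto
  qed (use fl ml L q a S in \<open>auto simp: closed_def\<close>)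
  moreover have b: "below (Cell l k a) = S" using fl by (simp add: below_def)
  moreover have "tr (Cell l k a) s = Comp T (\<pi> s) q" if "s \<in> S" for s
    using ml[OF that] that not_below_self[of "Cell l k a"] b by (auto simp: tr_def)
  ultimately show ?thesis using that by force
qed

text \<open>The elements carried by the cells of \<open>?S\<close> form a compatible family in
  \<open>A\<close>. The limit over \<open>?S\<close> glues them to one element of \<open>A\<close>,
  and a new cell is attached by the identity, which is a display map.\<close>

lemma wf_directed:
  assumes j: "wf j" and k: "wf k"
  obtains l where "wf l" "j \<in> lower l" "k \<in> lower l"
proof -
  let ?S = "lower j \<union> lower k"
  have S: "closed ?S" using closed_Un closed_lower j k by blast
  obtain L \<pi> where L: "lim ?S L \<pi>" "\<pi> bot \<in> D" using lim_exists[OF S] .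
  have O: "L \<in> Ob T" using limD(1)[OF L(1)] .
  have "family A ?S elt"
    unfolding family_def
  proof (intro conjI ballI)
    fix s assume "s \<in> ?S"
    then have s: "wf s" using S unfolding closed_def by blast
    show "elt s \<in> FO A (ctx s)" by (rule wf_elt[OF s])
    show "act A (tr s r) (elt s) = elt r" if "r \<in> below s" for r
      using act_tr_elt[OF s, of r] that by (simp add: lower_def)
  qed
  then obtain a where a: "a \<in> FO A L" "\<forall>s\<in>?S. act A (\<pi> s) a = elt s"
    using limD(4)[OF L(1) A] by blast
  have "act A (Comp T (\<pi> s) (Id T L)) a = elt s" if "s \<in> ?S" for s
    using a(2) that Comp_Id(1)[OF T limD(2)[OF L(1) that]] by simp
  then obtain l where "wf l" "below l = ?S"
    using wf_new[OF S L D_Id[OF O] Id_hom[OF T O] a(1)] by metis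
  then show ?thesis using that unfolding lower_def by auto
qed

text \<open>Pull \<open>p\<close> back along \<open>f\<close>. The result is the display map of a
  new cell over \<open>lower j\<close>, and since \<open>A\<close> preserves this pullback,
  \<open>a\<close> and \<open>elt j\<close> combine to its element.\<close>

lemma wf_lift:
  assumes j: "wf j" and f: "f \<in> hom T (ctx j) Z" and p: "p \<in> D" "p \<in> hom T X Z"
    and a: "a \<in> FO A X" "act A p a = act A f (elt j)"
  obtains k f' where "wf k" "j \<in> lower k" "f' \<in> hom T (ctx k) X"
    "Comp T p f' = Comp T f (tr k j)" "act A f' (elt k) = a"
proof -
  obtain P p' f' where P: "is_pullback T p f p' f'" "p' \<in> D" "p' \<in> hom T P (ctx j)" "f' \<in> hom T P X"
    "Comp T p f' = Comp T f p'"
    using D_pullback[OF p f] by metis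
  obtain b where b: "b \<in> FO A P" "act A f' b = a" "act A p' b = elt j"
    using modelD(3)[OF A p(1) P(1)] homD(2)[OF p(2)] homD(2)[OF f] homD(2)[OF P(3)] a wf_elt[OF j]
    by metis
  have "act A (Comp T (tr j s) p') b = elt s" if "s \<in> lower j" for s
    using act(6)[OF A P(3) tr_hom[OF j that] b(1)] b(3) act_tr_elt[OF j that] by simp
  then obtain k where k: "wf k" "below k = lower j" "ctx k = P" "elt k = b"
    "\<And>s. s \<in> lower j \<Longrightarrow> tr k s = Comp T (tr j s) p'"
    using wf_new[OF closed_lower[OF j] lim_lower[OF j] tr_bot(1)[OF j] P(2,3) b(1)] by metis
  have jj: "j \<in> lower j" by (simp add: lower_def)
  have "tr k j = p'" using k(5)[OF jj] Comp_Id(2)[OF T P(3)] by simp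
  then show ?thesis using that[of k f'] k P b jj by (simp add: lower_def)
qed

text \<open>Cells are finitely branching trees with small sets of labels, so each depth contributes
  a small set, and there are countably many depths.\<close>

lemma card_wf: "|{j. wf j}| <o |UNIV :: 'u set|"
proof -
  define V where "V = (\<Union>X\<in>Ob T. FO A X)"
  \<comment> \<open>\<open>lv n\<close> contains the trees with at most \<open>n\<close> levels. The
    label set \<open>V\<close> joins the values of \<open>A\<close> at all objects, so an element
    need not match its context here.\<close>
  define lv where "lv n = ((\<lambda>S. (\<lambda>(l, k, a). Cell l k a) ` (lists (S \<times> Arr T) \<times> Ob T \<times> V)) ^^ n) {}"
    for n :: nat
  have V: "|V| <o |UNIV :: 'u set|"
    unfolding V_def using act(1)[OF A] by (intro card_less_UN[OF U card_Ob]) (simp add: small_def)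
  have ArrT: "|Arr T| <o |UNIV :: 'u set|" using small_Arr unfolding small_def .
  have small_lv: "|lv n| <o |UNIV :: 'u set|" for n
  proof (induction n)
    case 0
    show ?case unfolding lv_def by (simp add: card_less_finite[OF U])
  next
    case (Suc n)
    show ?case
      unfolding lv_def funpow.simps comp_def
      by (intro card_less_image card_less_Sigma[OF U] card_less_lists[OF U] Suc[unfolded lv_def]
          card_Ob V ArrT)
  qed
  have lv_Suc: "Cell l k a \<in> lv (Suc n) \<longleftrightarrow>
    (\<forall>(s, u)\<in>set l. s \<in> lv n \<and> u \<in> Arr T) \<and> k \<in> Ob T \<and> a \<in> V" for l k a n
    by (force simp: lv_def image_iff)
  have mono: "lv n \<subseteq> lv (Suc n)" for n
  proof (induction n)
    case 0
    show ?case by (simp add: lv_def)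
  next
    case (Suc n)
    show ?case
    proof
      fix j assume "j \<in> lv (Suc n)"
      then show "j \<in> lv (Suc (Suc n))"
        using Suc by (cases j) (simp only: lv_Suc, blast)
    qed
  qed
  have mono': "n \<le> n' \<Longrightarrow> lv n \<subseteq> lv n'" for n n'
    by (rule lift_Suc_mono_le[of lv, OF mono])
  have fin: "\<exists>n. S \<subseteq> lv n" if "finite S" "\<forall>s\<in>S. \<exists>n. s \<in> lv n" for S
    using that
  proof (induction S)
    case (insert s S)
    then obtain n n' where "S \<subseteq> lv n" "s \<in> lv n'" by auto
    then have "insert s S \<subseteq> lv (max n n')" using mono'[of n "max n n'"] mono'[of n' "max n n'"] by auto
    then show ?case by blast
  qed simp
  have "\<exists>n. j \<in> lv n" if "wf j" for j
    using that
  proof (induction rule: wf.induct)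
    case wf_bot
    have "Cell [] Y y \<in> lv (Suc 0)" unfolding lv_Suc using Y y by (auto simp: V_def)
    then show ?case by blast
  next
    case (wf_Cell l L \<pi> q k a)
    have "\<exists>n. fst ` set l \<subseteq> lv n" by (rule fin) (use wf_Cell.IH in auto)
    then obtain n where n: "fst ` set l \<subseteq> lv n" by blast
    have "k \<in> Ob T" using hom_Ob[OF T wf_Cell.hyps(8)] by blast
    then have "Cell l k a \<in> lv (Suc n)"
      unfolding lv_Suc using n wf_Cell.hyps(3,10) by (auto simp: V_def)
    then show ?case by blast
  qed
  then have "{j. wf j} \<subseteq> (\<Union>n\<in>UNIV. lv n)" by auto
  moreover have "|\<Union>n\<in>UNIV. lv n| <o |UNIV :: 'u set|"
    by (rule card_less_UN[OF U card_less_nat[OF U] small_lv])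
  ultimately show ?thesis by (rule card_less_subset)
qed

text \<open>The last property is all that the display maps of the cells are needed for outside this
  construction. An element \<open>x\<close> lying over the base point \<open>c\<close> along
  \<open>f\<close> is represented at a cell, and at a later cell the composite with \<open>f\<close>
  is the display map \<open>d\<close> to \<open>Y\<close>; \<open>e\<close> is the element carried
  by that later cell.\<close>

lemma full_cover:
  obtains J :: "('u, 'u) cat" and B C i \<gamma> \<pi> c where
    "is_filtered J" "small (Arr J)" "is_colimit J M B C i"
    "\<And>j. j \<in> Ob J \<Longrightarrow> \<gamma> j \<in> Ob T" "\<And>j. j \<in> Ob J \<Longrightarrow> FO B j = H_ob T (\<gamma> j)"
    "\<pi> \<in> hom M C A" "is_full T D \<pi>" "c \<in> FO C Y" "app \<pi> Y c = y"
    "\<And>X x f. x \<in> FO C X \<Longrightarrow> f \<in> hom T X Y \<Longrightarrow> act C f x = c \<Longrightarrow>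
      \<exists>Z d g e. d \<in> D \<and> d \<in> hom T Z Y \<and> g \<in> hom T Z X \<and> Comp T f g = d \<and>
        e \<in> FO A Z \<and> act A g e = app \<pi> X x \<and> act A d e = y"
proof -
  obtain enc :: "'u \<times> 'u \<Rightarrow> 'u" where enc: "inj enc" using universe_pairing[OF U] by blast
  define W where "W = {j. wf j}"
  obtain \<iota> :: "('o, 'u) cell \<Rightarrow> 'u" where \<iota>: "inj_on \<iota> W"
    using card_of_ordLeq[of W "UNIV :: 'u set"] ordLess_imp_ordLeq[OF card_wf] unfolding W_def by blast
  define \<kappa> where "\<kappa> = inv_into W \<iota>"
  have \<kappa>\<iota>: "\<kappa> (\<iota> j) = j" if "wf j" for j using \<iota> that unfolding \<kappa>_def W_def by simp
  define dec where "dec = inv enc"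
  have dec: "dec (enc p) = p" for p unfolding dec_def using enc by simp
  \<comment> \<open>The poset of cells with an arrow from \<open>s\<close> to \<open>j\<close> for
    \<open>s\<close> in \<open>lower j\<close>. An arrow is the code of its endpoints, so parallel
    arrows are equal.\<close>
  define J :: "('u, 'u) cat" where "J = \<lparr>Ob = \<iota> ` W,
    Arr = {enc (\<iota> s, \<iota> j) | s j. wf j \<and> s \<in> lower j},
    Dom = \<lambda>f. fst (dec f), Cod = \<lambda>f. snd (dec f), Id = \<lambda>x. enc (x, x),
    Comp = \<lambda>g f. enc (fst (dec f), snd (dec g))\<rparr>"
  have J_Ob: "\<exists>j. wf j \<and> x = \<iota> j" if "x \<in> Ob J" for x using that by (auto simp: J_def W_def)
  have J_ObI: "\<iota> j \<in> Ob J" if "wf j" for j using that by (auto simp: J_def W_def)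
  have J_homI: "enc (\<iota> s, \<iota> j) \<in> hom J (\<iota> s) (\<iota> j)" if "wf j" "s \<in> lower j" for s j
    using that by (auto simp: J_def hom_def dec)
  have J_homD: "\<exists>s j. wf j \<and> s \<in> lower j \<and> wf s \<and> x = \<iota> s \<and> z = \<iota> j \<and> f = enc (\<iota> s, \<iota> j)"
    if f: "f \<in> hom J x z" for f x z
  proof -
    obtain s j where "wf j" "s \<in> lower j" "f = enc (\<iota> s, \<iota> j)"
      using f by (auto simp: J_def hom_def)
    moreover from this have "x = \<iota> s" "z = \<iota> j" using f by (auto simp: J_def hom_def dec)
    ultimately show ?thesis using wf_lower by blast
  qed
  have J_Comp: "Comp J (enc (a, b)) (enc (c, d)) = enc (c, b)" for a b c d by (simp add: J_def dec)
  have J_Id: "Id J x = enc (x, x)" for x by (simp add: J_def)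
  have self: "j \<in> lower j" for j :: "('o, 'u) cell" by (simp add: lower_def)
  have \<iota>_eq: "s = t" if "\<iota> s = \<iota> t" "wf s" "wf t" for s t using that \<kappa>\<iota> by metis
  have J_cat: "category J"
  proof (rule categoryI)
    show "Dom J f \<in> Ob J" "Cod J f \<in> Ob J" if f: "f \<in> Arr J" for f
      using J_homD[OF Arr_hom[OF f]] J_ObI by metis+
    show "Id J x \<in> hom J x x" if "x \<in> Ob J" for x
      using J_Ob[OF that] J_homI[OF _ self] J_Id by metis
    show "Comp J g f \<in> hom J x w" if fg: "f \<in> hom J x z" "g \<in> hom J z w" for f g x z w
    proof -
      obtain s j where s: "wf j" "s \<in> lower j" "wf s" "x = \<iota> s" "z = \<iota> j" "f = enc (\<iota> s, \<iota> j)"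
        using J_homD[OF fg(1)] by blast
      obtain j' k where k: "wf k" "j' \<in> lower k" "wf j'" "z = \<iota> j'" "w = \<iota> k" "g = enc (\<iota> j', \<iota> k)"
        using J_homD[OF fg(2)] by blast
      have "j' = j" using \<iota>_eq s k by metis
      then show ?thesis using s k J_Comp J_homI[OF k(1) lower_trans[OF k(1)]] by metis
    qed
    show "Comp J f (Id J x) = f" "Comp J (Id J z) f = f" if "f \<in> hom J x z" for f x z
      using J_homD[OF that] J_Comp J_Id by metis+
    show "Comp J h (Comp J g f) = Comp J (Comp J h g) f"
      if "f \<in> hom J w x" "g \<in> hom J x z" "h \<in> hom J z v" for f g h w x z v
      using J_homD[OF that(1)] J_homD[OF that(2)] J_homD[OF that(3)] J_Comp by metis
  qed
  have J_filt: "is_filtered J"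
    unfolding is_filtered_def
  proof (intro conjI ballI J_cat)
    show "Ob J \<noteq> {}" using J_ObI[OF wf_bot'] by blast
  next
    fix x z assume "x \<in> Ob J" "z \<in> Ob J"
    then obtain j k where j: "wf j" "x = \<iota> j" and k: "wf k" "z = \<iota> k" using J_Ob by metis
    obtain l where "wf l" "j \<in> lower l" "k \<in> lower l" using wf_directed[OF j(1) k(1)] .
    then show "\<exists>w\<in>Ob J. hom J x w \<noteq> {} \<and> hom J z w \<noteq> {}" using j k J_homI J_ObI by blast
  next
    fix x z f g assume z: "z \<in> Ob J" and f: "f \<in> hom J x z" and g: "g \<in> hom J x z"
    have "f = g" using J_homD[OF f] J_homD[OF g] by metis
    then show "\<exists>w\<in>Ob J. \<exists>h\<in>hom J z w. Comp J h f = Comp J h g"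
      using Id_hom[OF J_cat z] z by blast
  qed
  have W_card: "|W| <o |UNIV :: 'u set|" using card_wf unfolding W_def .
  have J_small: "small (Arr J)"
    unfolding small_def
  proof (rule card_less_subset)
    show "Arr J \<subseteq> (\<lambda>(s, j). enc (\<iota> s, \<iota> j)) ` (W \<times> W)"
      using wf_lower by (auto simp: J_def W_def)
    show "|(\<lambda>(s, j). enc (\<iota> s, \<iota> j)) ` (W \<times> W)| <o |UNIV :: 'u set|"
      by (intro card_less_image card_less_Sigma[OF U] W_card)
  qed
  \<comment> \<open>H is contravariant: the transition from the context of the later cell
    \<open>j\<close> to that of \<open>s\<close> induces the map from stage \<open>s\<close> to
    stage \<open>j\<close>.\<close>
  define B where "B = \<lparr>FO = restrict (\<lambda>x. H_ob T (ctx (\<kappa> x))) (Ob J),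
    FA = restrict (\<lambda>f. H_map T (tr (\<kappa> (Cod J f)) (\<kappa> (Dom J f)))) (Arr J)\<rparr>"
  have B_Ob: "FO B (\<iota> j) = H_ob T (ctx j)" if "wf j" for j
    using J_ObI[OF that] \<kappa>\<iota>[OF that] by (simp add: B_def)
  have B_Arr: "FA B (enc (\<iota> s, \<iota> j)) = H_map T (tr j s)" if "wf j" "s \<in> lower j" for s j
    using homD[OF J_homI[OF that]] \<kappa>\<iota>[OF that(1)] \<kappa>\<iota>[OF wf_lower[OF that]] by (simp add: B_def)
  have BF: "is_functor J M B"
  proof (rule ftorI[OF J_cat M])
    show "FO B x \<in> Ob M" if "x \<in> Ob J" for x
      using J_Ob[OF that] B_Ob H_model wf_ctx M_Ob by metis
    show "FA B f \<in> hom M (FO B x) (FO B z)" if "f \<in> hom J x z" for f x z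
      using J_homD[OF that] B_Ob B_Arr H_map_hom[OF tr_hom] by metis
    show "FA B (Id J x) = Id M (FO B x)" if "x \<in> Ob J" for x
      using J_Ob[OF that] J_Id B_Arr[OF _ self] B_Ob H_map_Id wf_ctx tr_self by metis
    show "FA B (Comp J g f) = Comp M (FA B g) (FA B f)"
      if fg: "f \<in> hom J x z" "g \<in> hom J z w" for f g x z w
    proof -
      obtain s j where s: "wf j" "s \<in> lower j" "wf s" "x = \<iota> s" "z = \<iota> j" "f = enc (\<iota> s, \<iota> j)"
        using J_homD[OF fg(1)] by blast
      obtain j' k where k: "wf k" "j' \<in> lower k" "wf j'" "z = \<iota> j'" "w = \<iota> k" "g = enc (\<iota> j', \<iota> k)"
        using J_homD[OF fg(2)] by blast
      have jk: "j \<in> lower k" "g = enc (\<iota> j, \<iota> k)" using \<iota>_eq s k by metis+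
      show ?thesis
        using s(6) jk(2) J_Comp B_Arr[OF s(1,2)] B_Arr[OF k(1) jk(1)]
          B_Arr[OF k(1) lower_trans[OF k(1) jk(1) s(2)]]
          H_map_Comp[OF tr_hom[OF k(1) jk(1)] tr_hom[OF s(1,2)]] tr_comp[OF k(1) jk(1) s(2)]
        by simp
    qed
  qed (auto simp: B_def)
  obtain C i where PC: "pointwise_colimit J B C i"
    using pointwise_colimit_exists[OF J_filt J_small BF] by blast
  note P = pointwiseD[OF PC]
  \<comment> \<open>The element of C(X) represented at stage \<open>j\<close> by an arrow
    \<open>f\<close> from the context of \<open>j\<close> to \<open>X\<close>.\<close>
  define cl where "cl j X f = app (i (\<iota> j)) X f" for j X f
  have ij: "i (\<iota> j) \<in> hom M (H_ob T (ctx j)) C" if "wf j" for j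
    using P(4)[OF J_ObI[OF that]] B_Ob[OF that] by simp
  have clC: "cl j X f \<in> FO C X" if "wf j" "f \<in> hom T (ctx j) X" for j X f
    using M_homD(7)[OF ij[OF that(1)] hom_Ob(2)[OF T that(2)]] that hom_Ob[OF T that(2)]
    unfolding cl_def by simp
  have cl_surj: "\<exists>j f. wf j \<and> f \<in> hom T (ctx j) X \<and> x = cl j X f" if X: "X \<in> Ob T" and x: "x \<in> FO C X"
    for X x
  proof -
    obtain k f where k: "k \<in> Ob J" "f \<in> FO (FO B k) X" "x = app (i k) X f" using P(6)[OF X x] by blast
    obtain j where j: "wf j" "k = \<iota> j" using J_Ob[OF k(1)] by blast
    then show ?thesis using k B_Ob[OF j(1)] X unfolding cl_def by auto
  qed
  have cl_act: "act C h (cl j X f) = cl j Z (Comp T h f)"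
    if j: "wf j" and f: "f \<in> hom T (ctx j) X" and h: "h \<in> hom T X Z" for j X f Z h
    using M_homD(8)[OF ij[OF j] h, of f] f hom_Ob[OF T f] h unfolding cl_def by simp
  have cl_push: "cl s X f = cl j X (Comp T f (tr j s))"
    if j: "wf j" and s: "s \<in> lower j" and f: "f \<in> hom T (ctx s) X" for j s X f
  proof -
    note ws = wf_lower[OF j s] and X = hom_Ob[OF T f] and h = H_map_hom[OF tr_hom[OF j s]]
    have e: "Comp M (i (\<iota> j)) (H_map T (tr j s)) = i (\<iota> s)"
      using P(5)[OF J_homI[OF j s]] B_Arr[OF j s] by simp
    have "app (H_map T (tr j s)) X f = Comp T f (tr j s)"
      using H_map_yo[OF tr_hom[OF j s]] app_yo[OF f] act_H[OF f tr_hom[OF j s]] by simp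
    then show ?thesis
      unfolding cl_def e[symmetric] using app_Comp[OF h ij[OF j] X(2), of f] f X by simp
  qed
  have cl_eq: "\<exists>l. wf l \<and> j \<in> lower l \<and> k \<in> lower l \<and> Comp T f (tr l j) = Comp T g (tr l k)"
    if j: "wf j" and k: "wf k" and f: "f \<in> hom T (ctx j) X" and g: "g \<in> hom T (ctx k) X"
      and e: "cl j X f = cl k X g" for j k f g X
  proof -
    note X = hom_Ob(2)[OF T f]
    have "germ J B X (\<iota> j) f (\<iota> k) g"
      by (rule P(7)[OF X J_ObI[OF j] J_ObI[OF k]])
        (use f g X B_Ob[OF j] B_Ob[OF k] e in \<open>auto simp: cl_def\<close>)
    then obtain m u v where u: "u \<in> hom J (\<iota> j) m" and v: "v \<in> hom J (\<iota> k) m"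
      and uv: "app (FA B u) X f = app (FA B v) X g" unfolding germ_def by blast
    obtain l where l: "wf l" "j \<in> lower l" "u = enc (\<iota> j, \<iota> l)" "m = \<iota> l"
      using J_homD[OF u] \<iota>_eq j by metis
    obtain l' where l': "wf l'" "k \<in> lower l'" "v = enc (\<iota> k, \<iota> l')" "m = \<iota> l'"
      using J_homD[OF v] \<iota>_eq k by metis
    have ll: "l' = l" using \<iota>_eq l l' by metis
    have kl: "k \<in> lower l" using l' ll by simp
    have "FA B u = H_map T (tr l j)" "FA B v = H_map T (tr l k)"
      using B_Arr l l' ll by auto
    then have "Comp T f (tr l j) = Comp T g (tr l k)"
      using uv H_map_yo[OF tr_hom[OF l(1,2)]] H_map_yo[OF tr_hom[OF l(1) kl]]
        app_yo[OF f] app_yo[OF g] act_H[OF f tr_hom[OF l(1,2)]] act_H[OF g tr_hom[OF l(1) kl]] by simp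
    then show ?thesis using l kl by blast
  qed
  \<comment> \<open>By Yoneda the element carried by a cell is a map from its stage to
    \<open>A\<close>; the compatibility of these maps is \<open>act_tr_elt\<close>.\<close>
  have "is_cocone J M B A (\<lambda>x. yo A (ctx (\<kappa> x)) (elt (\<kappa> x)))"
    unfolding is_cocone_def M_Ob
  proof (intro conjI ballI A)
    show "yo A (ctx (\<kappa> x)) (elt (\<kappa> x)) \<in> hom M (FO B x) A" if "x \<in> Ob J" for x
      using J_Ob[OF that] yo_hom[OF A wf_ctx wf_elt] B_Ob \<kappa>\<iota> by metis
    fix f assume "f \<in> Arr J"
    from J_homD[OF Arr_hom[OF this]] obtain s j where s: "wf j" "s \<in> lower j" "wf s"
      "Dom J f = \<iota> s" "Cod J f = \<iota> j" "f = enc (\<iota> s, \<iota> j)" by blast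
    show "Comp M (yo A (ctx (\<kappa> (Cod J f))) (elt (\<kappa> (Cod J f)))) (FA B f)
        = yo A (ctx (\<kappa> (Dom J f))) (elt (\<kappa> (Dom J f)))"
      using yo_H_map[OF A tr_hom[OF s(1,2)] wf_elt[OF s(1)]] act_tr_elt[OF s(1,2)]
        \<kappa>\<iota>[OF s(1)] \<kappa>\<iota>[OF s(3)] B_Arr[OF s(1,2)] s(4,5,6) by simp
  qed
  then obtain \<pi> where \<pi>: "\<pi> \<in> hom M C A"
    and \<pi>i: "\<And>x. x \<in> Ob J \<Longrightarrow> Comp M \<pi> (i x) = yo A (ctx (\<kappa> x)) (elt (\<kappa> x))"
    using pointwise_is_colimit[OF PC] unfolding is_colimit_def by blast
  have \<pi>cl: "app \<pi> X (cl j X f) = act A f (elt j)" if j: "wf j" and f: "f \<in> hom T (ctx j) X" for j X f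
  proof -
    note X = hom_Ob(2)[OF T f]
    have "app \<pi> X (cl j X f) = app (Comp M \<pi> (i (\<iota> j))) X f"
      using app_Comp[OF ij[OF j] \<pi> X, of f] f X unfolding cl_def by simp
    then show ?thesis using \<pi>i[OF J_ObI[OF j]] \<kappa>\<iota>[OF j] app_yo[OF f] by simp
  qed
  have full: "is_full T D \<pi>"
    unfolding is_full_def has_lifting_def
  proof (intro conjI ballI impI)
    show "\<pi> \<in> Arr M" by (rule homD(1)[OF \<pi>])
    fix p u v
    assume p: "p \<in> D" and u: "u \<in> hom M (Dom M (H_map T p)) (Dom M \<pi>)"
      and v: "v \<in> hom M (Cod M (H_map T p)) (Cod M \<pi>)"
      and e: "Comp M \<pi> u = Comp M v (H_map T p)"
    let ?X = "Dom T p" and ?Z = "Cod T p"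
    have ph: "p \<in> hom T ?X ?Z" by (rule Arr_hom[OF D_Arr[OF p]])
    note O = hom_Ob[OF T ph]
    note Hp = H_map_hom[OF ph]
    have u': "u \<in> hom M (H_ob T ?Z) C" and v': "v \<in> hom M (H_ob T ?X) A"
      using u v homD[OF Hp] homD[OF \<pi>] by simp_all
    note yu = yoneda[OF u' O(2)] and yv = yoneda[OF v' O(1)]
    \<comment> \<open>By Yoneda the lifting problem consists of \<open>x\<close> in C(?Z) and
      \<open>a\<close> in A(?X) with the same image in A(?Z); a solution is an element of C(?X) over
      both.\<close>
    define x where "x = app u ?Z (Id T ?Z)"
    define a where "a = app v ?X (Id T ?X)"
    have x: "x \<in> FO C ?Z" "u = yo C ?Z x" and a: "a \<in> FO A ?X" "v = yo A ?X a"
      using yu yv unfolding x_def a_def by auto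
    have "yo A ?Z (app \<pi> ?Z x) = yo A ?Z (act A p a)"
      using e x(2) a(2) yo_Comp[OF \<pi> O(2) x(1)] yo_H_map[OF A ph a(1)] by simp
    then have xa: "app \<pi> ?Z x = act A p a"
      using yo_inj[OF A O(2) M_homD(7)[OF \<pi> O(2) x(1)] act(4)[OF A ph a(1)]] by simp
    obtain j f where j: "wf j" and f: "f \<in> hom T (ctx j) ?Z" and xc: "x = cl j ?Z f"
      using cl_surj[OF O(2) x(1)] by blast
    have "act A p a = act A f (elt j)" using xa xc \<pi>cl[OF j f] by simp
    from wf_lift[OF j f p ph a(1) this] obtain k f' where k: "wf k" "j \<in> lower k"
      "f' \<in> hom T (ctx k) ?X" "Comp T p f' = Comp T f (tr k j)" "act A f' (elt k) = a" .
    let ?h = "yo C ?X (cl k ?X f')"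
    note ck = clC[OF k(1,3)]
    have "act C p (cl k ?X f') = x"
      using cl_act[OF k(1,3) ph] k(4) cl_push[OF k(1,2) f] xc by simp
    then have "Comp M ?h (H_map T p) = u"
      using yo_H_map[OF P(3) ph ck] x(2) by simp
    moreover have "Comp M \<pi> ?h = v"
      using yo_Comp[OF \<pi> O(1) ck] \<pi>cl[OF k(1,3)] k(5) a(2) by simp
    moreover have "?h \<in> hom M (Cod M (H_map T p)) (Dom M \<pi>)"
      using yo_hom[OF P(3) O(1) ck] homD[OF Hp] homD[OF \<pi>] by simp
    ultimately show "\<exists>h\<in>hom M (Cod M (H_map T p)) (Dom M \<pi>). Comp M h (H_map T p) = u \<and> Comp M \<pi> h = v"
      by blast
  qed
  have IdY: "Id T Y \<in> hom T (ctx bot) Y" using Id_hom[OF T Y] by simp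
  show ?thesis
  \<comment> \<open>The base point of \<open>C\<close> is the class of the identity of
    \<open>Y\<close> at the lowest cell.\<close>
  proof (rule that[of J B C i "\<lambda>x. ctx (\<kappa> x)" \<pi> "cl bot Y (Id T Y)"])
    show "ctx (\<kappa> x) \<in> Ob T" "FO B x = H_ob T (ctx (\<kappa> x))" if "x \<in> Ob J" for x
      using J_Ob[OF that] \<kappa>\<iota> wf_ctx B_Ob by metis+
    show "cl bot Y (Id T Y) \<in> FO C Y" by (rule clC[OF wf_bot' IdY])
    show "app \<pi> Y (cl bot Y (Id T Y)) = y" using \<pi>cl[OF wf_bot' IdY] act(5)[OF A Y y] by simp
    fix X x f assume x: "x \<in> FO C X" and f: "f \<in> hom T X Y" and e: "act C f x = cl bot Y (Id T Y)"
    obtain j g where j: "wf j" and g: "g \<in> hom T (ctx j) X" and xc: "x = cl j X g"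
      using cl_surj[OF hom_Ob(1)[OF T f] x] by blast
    note fg = Comp_hom[OF T g f]
    have "cl j Y (Comp T f g) = cl bot Y (Id T Y)" using e cl_act[OF j g f] xc by simp
    \<comment> \<open>Two representatives of one element agree at a later cell \<open>l\<close>;
      there the composite with \<open>f\<close> is the transition from \<open>l\<close> to
      \<open>bot\<close>, which is a display map.\<close>
    then obtain l where l: "wf l" "j \<in> lower l" "bot \<in> lower l"
      "Comp T (Comp T f g) (tr l j) = Comp T (Id T Y) (tr l bot)"
      using cl_eq[OF j wf_bot' fg IdY] by blast
    note tj = tr_hom[OF l(1,2)] and tb = tr_bot[OF l(1)]
    have "Comp T f (Comp T g (tr l j)) = tr l bot"
      using Comp_assoc[OF T tj g f] l(4) Comp_Id(2)[OF T tb(2)] by simp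
    moreover have "act A (Comp T g (tr l j)) (elt l) = app \<pi> X x"
      using act(6)[OF A tj g wf_elt[OF l(1)]] act_tr_elt[OF l(1,2)] \<pi>cl[OF j g] xc by simp
    moreover have "act A (tr l bot) (elt l) = y" using act_tr_elt[OF l(1,3)] by simp
    ultimately show "\<exists>Z d g e. d \<in> D \<and> d \<in> hom T Z Y \<and> g \<in> hom T Z X \<and> Comp T f g = d \<and>
        e \<in> FO A Z \<and> act A g e = app \<pi> X x \<and> act A d e = y"
      using tb Comp_hom[OF T tj g] wf_elt[OF l(1)] by blast
  qed (use J_filt J_small pointwise_is_colimit[OF PC] \<pi> full in auto)
qed

end

section \<open>Equivalences of clans\<close>

lemma natural_isomorphic:
  assumes F: "is_functor C D F" and G: "is_functor C D G"
    and t: "\<And>X. X \<in> Ob C \<Longrightarrow> t X \<in> hom D (FO F X) (FO G X)"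
    and t': "\<And>X. X \<in> Ob C \<Longrightarrow> t' X \<in> hom D (FO G X) (FO F X)"
    and i: "\<And>X. X \<in> Ob C \<Longrightarrow> Comp D (t' X) (t X) = Id D (FO F X)"
      "\<And>X. X \<in> Ob C \<Longrightarrow> Comp D (t X) (t' X) = Id D (FO G X)"
    and n: "\<And>X Y f. f \<in> hom C X Y \<Longrightarrow> Comp D (t Y) (FA F f) = Comp D (FA G f) (t X)"
  shows "isomorphic (functor_cat C D) F G"
proof -
  let ?t = "Arrow F (restrict t (Ob C)) G" and ?t' = "Arrow G (restrict t' (Ob C)) F"
  note C = ftorD(1)[OF F] and D = ftorD(2)[OF F]
  have h: "?t \<in> hom (functor_cat C D) F G"
    unfolding functor_cat_hom nat_trans_def
  proof (intro conjI ballI)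
    show "Comp D (body ?t (Cod C f)) (FA F f) = Comp D (FA G f) (body ?t (Dom C f))"
      if f: "f \<in> Arr C" for f
      using n[OF Arr_hom[OF f]] Dom_Ob[OF C f] Cod_Ob[OF C f] by simp
  qed (use F G t in auto)
  \<comment> \<open>Naturality of the inverses: insert \<open>t X\<close> after \<open>t' X\<close>,
    move \<open>t\<close> across by its naturality, and cancel at \<open>Y\<close>.\<close>
  have n': "Comp D (t' Y) (FA G f) = Comp D (FA F f) (t' X)" if f: "f \<in> hom C X Y" for f X Y
  proof -
    note O = hom_Ob[OF C f] and Ff = ftorD(6)[OF F f] and Gf = ftorD(6)[OF G f]
    have "Comp D (t' Y) (FA G f) = Comp D (t' Y) (Comp D (FA G f) (Comp D (t X) (t' X)))"
      using i(2)[OF O(1)] Comp_Id(1)[OF D Gf] by simp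
    also have "\<dots> = Comp D (t' Y) (Comp D (Comp D (t Y) (FA F f)) (t' X))"
      using Comp_assoc[OF D t'[OF O(1)] t[OF O(1)] Gf] n[OF f] by simp
    also have "\<dots> = Comp D (t' Y) (Comp D (t Y) (Comp D (FA F f) (t' X)))"
      using Comp_assoc[OF D t'[OF O(1)] Ff t[OF O(2)]] by simp
    also have "\<dots> = Comp D (FA F f) (t' X)"
      using Comp_assoc[OF D Comp_hom[OF D t'[OF O(1)] Ff] t[OF O(2)] t'[OF O(2)]] i(1)[OF O(2)]
        Comp_Id(2)[OF D Comp_hom[OF D t'[OF O(1)] Ff]] by simp
    finally show ?thesis .
  qed
  have h': "?t' \<in> hom (functor_cat C D) G F"
    unfolding functor_cat_hom nat_trans_def
  proof (intro conjI ballI)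
    show "Comp D (body ?t' (Cod C f)) (FA G f) = Comp D (FA F f) (body ?t' (Dom C f))"
      if f: "f \<in> Arr C" for f
      using n'[OF Arr_hom[OF f]] Dom_Ob[OF C f] Cod_Ob[OF C f] by simp
  qed (use F G t' in auto)
  have "is_iso (functor_cat C D) ?t"
    by (rule isoI[OF h h']) (simp_all add: i cong: restrict_cong)
  then show ?thesis unfolding isomorphic_def using h by blast
qed

text \<open>In a clan every pullback of a display map has to be a display map, while transport along
  an equivalence constructs a particular one; the comparison isomorphism carries membership to the
  others.\<close>

lemma pullback_unique:
  assumes C: "category C" and P: "is_pullback C p f p' f'" and Q: "is_pullback C p f q' g'"
  obtains k where "k \<in> hom C (Dom C q') (Dom C p')" "is_iso C k" "Comp C p' k = q'"
proof -
  note p = pullbackD[OF P] and q = pullbackD[OF Q]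
  have O: "Dom C p' \<in> Ob C" "Dom C q' \<in> Ob C" using hom_Ob[OF C p(3)] hom_Ob[OF C q(3)] by auto
  obtain k where k: "k \<in> hom C (Dom C q') (Dom C p')" "Comp C f' k = g'" "Comp C p' k = q'"
    using pullback_univ[OF P O(2) q(4,3,5)] by blast
  obtain l where l: "l \<in> hom C (Dom C p') (Dom C q')" "Comp C g' l = f'" "Comp C q' l = p'"
    using pullback_univ[OF Q O(1) p(4,3,5)] by blast
  have "Comp C k l = Id C (Dom C p')"
  proof -
    have "Comp C f' (Comp C k l) = f'" "Comp C p' (Comp C k l) = p'"
      using Comp_assoc[OF C l(1) k(1) p(4)] Comp_assoc[OF C l(1) k(1) p(3)] k l by simp_all
    then show ?thesis
      using pullback_univ[OF P O(1) p(4,3,5)] Comp_hom[OF C l(1) k(1)] Id_hom[OF C O(1)]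
        Comp_Id(1)[OF C p(4)] Comp_Id(1)[OF C p(3)] by blast
  qed
  moreover have "Comp C l k = Id C (Dom C q')"
  proof -
    have "Comp C g' (Comp C l k) = g'" "Comp C q' (Comp C l k) = q'"
      using Comp_assoc[OF C k(1) l(1) q(4)] Comp_assoc[OF C k(1) l(1) q(3)] k l by simp_all
    then show ?thesis
      using pullback_univ[OF Q O(2) q(4,3,5)] Comp_hom[OF C k(1) l(1)] Id_hom[OF C O(2)]
        Comp_Id(1)[OF C q(4)] Comp_Id(1)[OF C q(3)] by blast
  qed
  ultimately show ?thesis using that[of k] isoI[OF k(1) l(1)] k by blast
qed

section \<open>Transport along a fully faithful and essentially surjective functor\<close>

locale weak_equivalence =
  fixes C :: "('o, 'a) cat" and C' :: "('p, 'b) cat" and F :: "('o, 'a, 'p, 'b) ftor"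
    and G :: "'p \<Rightarrow> 'o" and u v :: "'p \<Rightarrow> 'b"
  assumes F: "is_functor C C' F"
    and full: "\<And>X Y g. X \<in> Ob C \<Longrightarrow> Y \<in> Ob C \<Longrightarrow> g \<in> hom C' (FO F X) (FO F Y) \<Longrightarrow>
      \<exists>f\<in>hom C X Y. FA F f = g"
    and faithful: "\<And>X Y f g. f \<in> hom C X Y \<Longrightarrow> g \<in> hom C X Y \<Longrightarrow> FA F f = FA F g \<Longrightarrow> f = g"
    and G: "\<And>Z. Z \<in> Ob C' \<Longrightarrow> G Z \<in> Ob C"
    and u: "\<And>Z. Z \<in> Ob C' \<Longrightarrow> u Z \<in> hom C' Z (FO F (G Z))"
    and v: "\<And>Z. Z \<in> Ob C' \<Longrightarrow> v Z \<in> hom C' (FO F (G Z)) Z"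
    and vu: "\<And>Z. Z \<in> Ob C' \<Longrightarrow> Comp C' (v Z) (u Z) = Id C' Z"
    and uv: "\<And>Z. Z \<in> Ob C' \<Longrightarrow> Comp C' (u Z) (v Z) = Id C' (FO F (G Z))"
begin

lemmas C = ftorD(1)[OF F] and C' = ftorD(2)[OF F] and FO = ftorD(5)[OF F] and FA = ftorD(6)[OF F]
  and F_Id = ftorD(7)[OF F] and F_Comp = ftorD(8)[OF F]

lemma v_u:
  assumes "h \<in> hom C' Y Z"
  shows "Comp C' (v Z) (Comp C' (u Z) h) = h"
  using Comp_assoc[OF C' assms u v] vu Comp_Id(2)[OF C' assms] hom_Ob[OF C' assms] by simp

lemma u_v:
  assumes "h \<in> hom C' Y (FO F (G Z))" "Z \<in> Ob C'"
  shows "Comp C' (u Z) (Comp C' (v Z) h) = h"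
  using Comp_assoc[OF C' assms(1) v u] uv Comp_Id(2)[OF C' assms(1)] assms(2) by simp

lemma u_cancel:
  assumes "h \<in> hom C' Z W" "k \<in> hom C' Z W" "Comp C' h (v Z) = Comp C' k (v Z)"
  shows "h = k"
proof -
  have Z: "Z \<in> Ob C'" using hom_Ob[OF C' assms(1)] by blast
  have "Comp C' (Comp C' h (v Z)) (u Z) = Comp C' (Comp C' k (v Z)) (u Z)" using assms(3) by simp
  then show ?thesis
    using Comp_assoc[OF C' u[OF Z] v[OF Z] assms(1)] Comp_assoc[OF C' u[OF Z] v[OF Z] assms(2)]
      vu[OF Z] Comp_Id(1)[OF C' assms(1)] Comp_Id(1)[OF C' assms(2)] by simp
qed

text \<open>The quasi-inverse of \<open>F\<close> on arrows: the preimage of \<open>g\<close>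
  conjugated by the chosen isomorphisms.\<close>

definition L where
  "L g = (SOME f. f \<in> hom C (G (Dom C' g)) (G (Cod C' g)) \<and>
     FA F f = Comp C' (u (Cod C' g)) (Comp C' g (v (Dom C' g))))"

lemma L:
  assumes g: "g \<in> hom C' Z W"
  shows "L g \<in> hom C (G Z) (G W)" "FA F (L g) = Comp C' (u W) (Comp C' g (v Z))"
proof -
  note O = hom_Ob[OF C' g]
  have "\<exists>f\<in>hom C (G Z) (G W). FA F f = Comp C' (u W) (Comp C' g (v Z))"
    by (rule full[OF G[OF O(1)] G[OF O(2)]])
      (rule Comp_hom[OF C' Comp_hom[OF C' v[OF O(1)] g] u[OF O(2)]])
  then have "\<exists>f. f \<in> hom C (G (Dom C' g)) (G (Cod C' g)) \<and>
     FA F f = Comp C' (u (Cod C' g)) (Comp C' g (v (Dom C' g)))"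
    unfolding homD(2,3)[OF g] by blast
  from someI_ex[OF this]
  show "L g \<in> hom C (G Z) (G W)" "FA F (L g) = Comp C' (u W) (Comp C' g (v Z))"
    unfolding L_def homD(2,3)[OF g] by blast+
qed

lemma L_Comp:
  assumes f: "f \<in> hom C' X Y" and g: "g \<in> hom C' Y Z"
  shows "L (Comp C' g f) = Comp C (L g) (L f)"
proof (rule faithful[OF L(1)[OF Comp_hom[OF C' f g]] Comp_hom[OF C L(1)[OF f] L(1)[OF g]]])
  have O: "X \<in> Ob C'" "Y \<in> Ob C'" "Z \<in> Ob C'" using hom_Ob[OF C'] f g by blast+
  note fv = Comp_hom[OF C' v[OF O(1)] f]
  note gv = Comp_hom[OF C' v[OF O(2)] g]
  note ufv = Comp_hom[OF C' fv u[OF O(2)]]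
  have "FA F (Comp C (L g) (L f))
      = Comp C' (Comp C' (u Z) (Comp C' g (v Y))) (Comp C' (u Y) (Comp C' f (v X)))"
    using F_Comp[OF L(1)[OF f] L(1)[OF g]] L(2)[OF f] L(2)[OF g] by simp
  also have "\<dots> = Comp C' (u Z) (Comp C' (Comp C' g (v Y)) (Comp C' (u Y) (Comp C' f (v X))))"
    using Comp_assoc[OF C' ufv gv u[OF O(3)]] by simp
  also have "\<dots> = Comp C' (u Z) (Comp C' g (Comp C' f (v X)))"
    using Comp_assoc[OF C' ufv v[OF O(2)] g] v_u[OF fv] by simp
  also have "\<dots> = Comp C' (u Z) (Comp C' (Comp C' g f) (v X))"
    using Comp_assoc[OF C' v[OF O(1)] f g] by simp
  finally show "FA F (L (Comp C' g f)) = FA F (Comp C (L g) (L f))"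
    using L(2)[OF Comp_hom[OF C' f g]] by simp
qed

lemma L_Id:
  assumes Z: "Z \<in> Ob C'" shows "L (Id C' Z) = Id C (G Z)"
  by (rule faithful[OF L(1)[OF Id_hom[OF C' Z]] Id_hom[OF C G[OF Z]]])
    (use L(2)[OF Id_hom[OF C' Z]] F_Id[OF G[OF Z]] Comp_Id(2)[OF C' v[OF Z]] uv[OF Z] in simp)

lemma equivalence: "is_equivalence C C' F"
proof -
  define K where "K = \<lparr>FO = restrict G (Ob C'), FA = restrict L (Arr C')\<rparr>"
  have K: "is_functor C' C K"
  proof (rule ftorI[OF C' C])
    show "FA K f \<in> hom C (FO K X) (FO K Y)" if "f \<in> hom C' X Y" for f X Y
      using L(1)[OF that] homD(1)[OF that] hom_Ob[OF C' that] by (simp add: K_def)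
    show "FA K (Id C' X) = Id C (FO K X)" if "X \<in> Ob C'" for X
      using L_Id[OF that] homD(1)[OF Id_hom[OF C' that]] that by (simp add: K_def)
    show "FA K (Comp C' g f) = Comp C (FA K g) (FA K f)"
      if "f \<in> hom C' X Y" "g \<in> hom C' Y Z" for f g X Y Z
      using L_Comp[OF that] homD(1)[OF that(1)] homD(1)[OF that(2)] homD(1)[OF Comp_hom[OF C' that]]
      by (simp add: K_def)
  qed (use G in \<open>auto simp: K_def\<close>)
  have id_ftor: "is_functor B B (id_ftor B)" if "category B" for B :: "('x, 'y) cat"
  proof (rule ftorI[OF that that])
    show "FA (id_ftor B) f \<in> hom B (FO (id_ftor B) X) (FO (id_ftor B) Y)" if f: "f \<in> hom B X Y" for f X Y
      using f homD(1)[OF f] hom_Ob[OF \<open>category B\<close> f] by (simp add: id_ftor_def)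
    show "FA (id_ftor B) (Id B X) = Id B (FO (id_ftor B) X)" if "X \<in> Ob B" for X
      using that homD(1)[OF Id_hom[OF \<open>category B\<close> that]] by (simp add: id_ftor_def)
    show "FA (id_ftor B) (Comp B g f) = Comp B (FA (id_ftor B) g) (FA (id_ftor B) f)"
      if "f \<in> hom B X Y" "g \<in> hom B Y Z" for f g X Y Z
      using homD(1)[OF that(1)] homD(1)[OF that(2)] homD(1)[OF Comp_hom[OF \<open>category B\<close> that]]
      by (simp add: id_ftor_def)
  qed (auto simp: id_ftor_def)
  note CC = comp_ftor_functor[OF F K] and CC' = comp_ftor_functor[OF K F]
  \<comment> \<open>The unit of the equivalence and its inverse are preimages under \<open>F\<close>
    of the chosen isomorphisms at objects in the image.\<close>
  have "\<exists>s. \<forall>X\<in>Ob C. s X \<in> hom C X (G (FO F X)) \<and> FA F (s X) = u (FO F X)"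
    using full[OF _ G[OF FO] u[OF FO]] by (intro bchoice) blast
  then obtain s where s: "\<And>X. X \<in> Ob C \<Longrightarrow> s X \<in> hom C X (G (FO F X))"
    "\<And>X. X \<in> Ob C \<Longrightarrow> FA F (s X) = u (FO F X)" by blast
  have "\<exists>s. \<forall>X\<in>Ob C. s X \<in> hom C (G (FO F X)) X \<and> FA F (s X) = v (FO F X)"
    using full[OF G[OF FO] _ v[OF FO]] by (intro bchoice) blast
  then obtain s' where s': "\<And>X. X \<in> Ob C \<Longrightarrow> s' X \<in> hom C (G (FO F X)) X"
    "\<And>X. X \<in> Ob C \<Longrightarrow> FA F (s' X) = v (FO F X)" by blast
  have "isomorphic (functor_cat C C) (id_ftor C) (comp_ftor C K F)"
  proof (rule natural_isomorphic[OF id_ftor[OF C] CC, of s s'])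
    fix X assume X: "X \<in> Ob C"
    have FX: "FO (id_ftor C) X = X" "FO (comp_ftor C K F) X = G (FO F X)"
      using X FO[OF X] by (simp_all add: id_ftor_def comp_ftor_def K_def)
    show "s X \<in> hom C (FO (id_ftor C) X) (FO (comp_ftor C K F) X)"
      and "s' X \<in> hom C (FO (comp_ftor C K F) X) (FO (id_ftor C) X)"
      unfolding FX using s(1)[OF X] s'(1)[OF X] by auto
    show "Comp C (s' X) (s X) = Id C (FO (id_ftor C) X)"
      unfolding FX
      by (rule faithful[OF Comp_hom[OF C s(1)[OF X] s'(1)[OF X]] Id_hom[OF C X]])
        (use F_Comp[OF s(1)[OF X] s'(1)[OF X]] s(2)[OF X] s'(2)[OF X] vu[OF FO[OF X]] F_Id[OF X] in simp)
    show "Comp C (s X) (s' X) = Id C (FO (comp_ftor C K F) X)"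
      unfolding FX
      by (rule faithful[OF Comp_hom[OF C s'(1)[OF X] s(1)[OF X]] Id_hom[OF C G[OF FO[OF X]]]])
        (use F_Comp[OF s'(1)[OF X] s(1)[OF X]] s(2)[OF X] s'(2)[OF X] uv[OF FO[OF X]]
          F_Id[OF G[OF FO[OF X]]] in simp)
  next
    fix X Y f assume f: "f \<in> hom C X Y"
    note O = hom_Ob[OF C f] and Ff = FA[OF f]
    have fX: "FA (id_ftor C) f = f" "FA (comp_ftor C K F) f = L (FA F f)"
      using homD(1)[OF f] homD(1)[OF Ff] by (simp_all add: id_ftor_def comp_ftor_def K_def)
    note uf = Comp_hom[OF C' v[OF FO[OF O(1)]] Ff] and uX = u[OF FO[OF O(1)]] and uY = u[OF FO[OF O(2)]]
    have "FA F (Comp C (L (FA F f)) (s X)) = Comp C' (u (FO F Y)) (FA F f)"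
      using F_Comp[OF s(1)[OF O(1)] L(1)[OF Ff]] L(2)[OF Ff] s(2)[OF O(1)]
        Comp_assoc[OF C' uX uf uY] Comp_assoc[OF C' uX v[OF FO[OF O(1)]] Ff] vu[OF FO[OF O(1)]]
        Comp_Id(1)[OF C' Ff] by simp
    moreover have "FA F (Comp C (s Y) f) = Comp C' (u (FO F Y)) (FA F f)"
      using F_Comp[OF f s(1)[OF O(2)]] s(2)[OF O(2)] by simp
    ultimately show "Comp C (s Y) (FA (id_ftor C) f) = Comp C (FA (comp_ftor C K F) f) (s X)"
      unfolding fX
      by (intro faithful[OF Comp_hom[OF C f s(1)[OF O(2)]] Comp_hom[OF C s(1)[OF O(1)] L(1)[OF Ff]]]) simp
  qed
  moreover have "isomorphic (functor_cat C' C') (comp_ftor C' F K) (id_ftor C')"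
  proof (rule natural_isomorphic[OF CC' id_ftor[OF C'], of v u])
    fix Z assume Z: "Z \<in> Ob C'"
    have FZ: "FO (id_ftor C') Z = Z" "FO (comp_ftor C' F K) Z = FO F (G Z)"
      using Z by (simp_all add: id_ftor_def comp_ftor_def K_def)
    show "v Z \<in> hom C' (FO (comp_ftor C' F K) Z) (FO (id_ftor C') Z)"
      "u Z \<in> hom C' (FO (id_ftor C') Z) (FO (comp_ftor C' F K) Z)"
      "Comp C' (u Z) (v Z) = Id C' (FO (comp_ftor C' F K) Z)"
      "Comp C' (v Z) (u Z) = Id C' (FO (id_ftor C') Z)"
      unfolding FZ using u v uv vu Z by auto
  next
    fix Z W g assume g: "g \<in> hom C' Z W"
    note O = hom_Ob[OF C' g]
    have "FA (id_ftor C') g = g" "FA (comp_ftor C' F K) g = FA F (L g)"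
      using homD(1)[OF g] by (simp_all add: id_ftor_def comp_ftor_def K_def)
    then show "Comp C' (v W) (FA (comp_ftor C' F K) g) = Comp C' (FA (id_ftor C') g) (v Z)"
      using L(2)[OF g] v_u[OF Comp_hom[OF C' v[OF O(1)] g]] by simp
  qed
  ultimately show ?thesis unfolding is_equivalence_def using F K by blast
qed

text \<open>A test object \<open>Q\<close> is replaced by the isomorphic image of
  \<open>G Q\<close>; maps out of the latter come from \<open>C\<close> uniquely, so the universal
  property there applies.\<close>

lemma pullback:
  assumes P: "is_pullback C p f p' f'"
  shows "is_pullback C' (FA F p) (FA F f) (FA F p') (FA F f')"
proof -
  note h = pullbackD[OF P]
  note Fh = FA[OF h(1)] FA[OF h(2)] FA[OF h(3)] FA[OF h(4)]
  have O: "Dom C p \<in> Ob C" "Dom C f \<in> Ob C" "Dom C p' \<in> Ob C"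
    using hom_Ob[OF C h(1)] hom_Ob[OF C h(2)] hom_Ob[OF C h(3)] by auto
  show ?thesis
    unfolding is_pullback_def homD(2,3)[OF Fh(1)] homD(2,3)[OF Fh(2)] homD(2,3)[OF Fh(3)]
      homD(2,3)[OF Fh(4)]
  proof (intro conjI ballI impI refl homD(1)[OF Fh(1)] homD(1)[OF Fh(2)] homD(1)[OF Fh(3)]
      homD(1)[OF Fh(4)])
    show "Comp C' (FA F p) (FA F f') = Comp C' (FA F f) (FA F p')"
      using F_Comp[OF h(4,1)] F_Comp[OF h(3,2)] h(5) by simp
    fix Q x y
    assume Q: "Q \<in> Ob C'" and x: "x \<in> hom C' Q (FO F (Dom C p))"
      and y: "y \<in> hom C' Q (FO F (Dom C f))" and e: "Comp C' (FA F p) x = Comp C' (FA F f) y"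
    note xv = Comp_hom[OF C' v[OF Q] x] and yv = Comp_hom[OF C' v[OF Q] y]
    obtain x0 where x0: "x0 \<in> hom C (G Q) (Dom C p)" "FA F x0 = Comp C' x (v Q)"
      using full[OF G[OF Q] O(1) xv] by blast
    obtain y0 where y0: "y0 \<in> hom C (G Q) (Dom C f)" "FA F y0 = Comp C' y (v Q)"
      using full[OF G[OF Q] O(2) yv] by blast
    have "Comp C p x0 = Comp C f y0"
      by (rule faithful[OF Comp_hom[OF C x0(1) h(1)] Comp_hom[OF C y0(1) h(2)]])
        (use F_Comp[OF x0(1) h(1)] F_Comp[OF y0(1) h(2)] x0(2) y0(2)
          Comp_assoc[OF C' v[OF Q] x Fh(1)] Comp_assoc[OF C' v[OF Q] y Fh(2)] e in simp)
    from pullback_univ[OF P G[OF Q] x0(1) y0(1) this] obtain k where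
      k: "k \<in> hom C (G Q) (Dom C p')" "Comp C f' k = x0" "Comp C p' k = y0"
      and ku: "\<And>l. l \<in> hom C (G Q) (Dom C p') \<Longrightarrow> Comp C f' l = x0 \<Longrightarrow> Comp C p' l = y0 \<Longrightarrow> l = k"
      by blast
    have vuQ: "Comp C' (Comp C' z (v Q)) (u Q) = z" if "z \<in> hom C' Q W" for z W
      using Comp_assoc[OF C' u[OF Q] v[OF Q] that] vu[OF Q] Comp_Id(1)[OF C' that] by simp
    show "\<exists>!h. h \<in> hom C' Q (FO F (Dom C p')) \<and> Comp C' (FA F f') h = x \<and> Comp C' (FA F p') h = y"
    proof (rule ex1I[of _ "Comp C' (FA F k) (u Q)"], intro conjI)
      show "Comp C' (FA F k) (u Q) \<in> hom C' Q (FO F (Dom C p'))"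
        by (rule Comp_hom[OF C' u[OF Q] FA[OF k(1)]])
      show "Comp C' (FA F f') (Comp C' (FA F k) (u Q)) = x"
        using Comp_assoc[OF C' u[OF Q] FA[OF k(1)] Fh(4)] F_Comp[OF k(1) h(4)] k(2) x0(2) vuQ[OF x]
        by simp
      show "Comp C' (FA F p') (Comp C' (FA F k) (u Q)) = y"
        using Comp_assoc[OF C' u[OF Q] FA[OF k(1)] Fh(3)] F_Comp[OF k(1) h(3)] k(3) y0(2) vuQ[OF y]
        by simp
      fix l assume l: "l \<in> hom C' Q (FO F (Dom C p')) \<and> Comp C' (FA F f') l = x \<and> Comp C' (FA F p') l = y"
      then have lh: "l \<in> hom C' Q (FO F (Dom C p'))" by blast
      obtain l0 where l0: "l0 \<in> hom C (G Q) (Dom C p')" "FA F l0 = Comp C' l (v Q)"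
        using full[OF G[OF Q] O(3) Comp_hom[OF C' v[OF Q] lh]] by blast
      have "l0 = k"
      proof (rule ku[OF l0(1)])
        show "Comp C f' l0 = x0"
          by (rule faithful[OF Comp_hom[OF C l0(1) h(4)] x0(1)])
            (use F_Comp[OF l0(1) h(4)] l0(2) x0(2) Comp_assoc[OF C' v[OF Q] lh Fh(4)] l in simp)
        show "Comp C p' l0 = y0"
          by (rule faithful[OF Comp_hom[OF C l0(1) h(3)] y0(1)])
            (use F_Comp[OF l0(1) h(3)] l0(2) y0(2) Comp_assoc[OF C' v[OF Q] lh Fh(3)] l in simp)
      qed
      then show "l = Comp C' (FA F k) (u Q)" using l0(2) vuQ[OF lh] by simp
    qed
  qed
qed

text \<open>\<open>p\<close> and \<open>g\<close> are isomorphic to the images of \<open>L p\<close>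
  and \<open>L g\<close>, so a pullback of those images, composed with the isomorphisms
  \<open>v\<close>, is one of \<open>p\<close> and \<open>g\<close>.\<close>

lemma pullback_transport:
  assumes p: "p \<in> hom C' X B" and g: "g \<in> hom C' Y B"
    and P: "is_pullback C' (FA F (L p)) (FA F (L g)) a b"
  shows "is_pullback C' p g (Comp C' (v Y) a) (Comp C' (v X) b)"
proof -
  have O: "X \<in> Ob C'" "Y \<in> Ob C'" "B \<in> Ob C'" using hom_Ob[OF C' p] hom_Ob[OF C' g] by auto
  note Lp = FA[OF L(1)[OF p]] and Lg = FA[OF L(1)[OF g]]
  note P1 = pullbackD[OF P, unfolded homD(2,3)[OF Lp] homD(2,3)[OF Lg]]
  note va = Comp_hom[OF C' P1(3) v[OF O(2)]] and vb = Comp_hom[OF C' P1(4) v[OF O(1)]]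
  have FLp: "Comp C' (FA F (L p)) w = Comp C' (u B) (Comp C' p (Comp C' (v X) w))"
    if w: "w \<in> hom C' W (FO F (G X))" for w W
    using L(2)[OF p] Comp_assoc[OF C' w Comp_hom[OF C' v[OF O(1)] p] u[OF O(3)]]
      Comp_assoc[OF C' w v[OF O(1)] p] by simp
  have FLg: "Comp C' (FA F (L g)) w = Comp C' (u B) (Comp C' g (Comp C' (v Y) w))"
    if w: "w \<in> hom C' W (FO F (G Y))" for w W
    using L(2)[OF g] Comp_assoc[OF C' w Comp_hom[OF C' v[OF O(2)] g] u[OF O(3)]]
      Comp_assoc[OF C' w v[OF O(2)] g] by simp
  show ?thesis
    unfolding is_pullback_def homD(2,3)[OF va] homD(2,3)[OF vb] homD(2,3)[OF p] homD(2,3)[OF g]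
  proof (intro conjI ballI impI refl homD(1)[OF p] homD(1)[OF g] homD(1)[OF va] homD(1)[OF vb])
    have "Comp C' (u B) (Comp C' p (Comp C' (v X) b)) = Comp C' (u B) (Comp C' g (Comp C' (v Y) a))"
      using P1(5) FLp[OF P1(4)] FLg[OF P1(3)] by simp
    then have "Comp C' (v B) (Comp C' (u B) (Comp C' p (Comp C' (v X) b))) =
      Comp C' (v B) (Comp C' (u B) (Comp C' g (Comp C' (v Y) a)))" by simp
    then show "Comp C' p (Comp C' (v X) b) = Comp C' g (Comp C' (v Y) a)"
      using v_u[OF Comp_hom[OF C' vb p]] v_u[OF Comp_hom[OF C' va g]] by simp
    fix Q x y
    assume Q: "Q \<in> Ob C'" and x: "x \<in> hom C' Q X" and y: "y \<in> hom C' Q Y"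
      and e: "Comp C' p x = Comp C' g y"
    note ux = Comp_hom[OF C' x u[OF O(1)]] and uy = Comp_hom[OF C' y u[OF O(2)]]
    have "Comp C' (FA F (L p)) (Comp C' (u X) x) = Comp C' (FA F (L g)) (Comp C' (u Y) y)"
      using FLp[OF ux] FLg[OF uy] v_u[OF x] v_u[OF y] e by simp
    then have "\<exists>!h. h \<in> hom C' Q (Dom C' a) \<and> Comp C' b h = Comp C' (u X) x \<and>
      Comp C' a h = Comp C' (u Y) y"
      using ux uy homD(2)[OF Lp] homD(2)[OF Lg] by (intro pullback_univ[OF P Q]) simp_all
    then obtain h where h: "h \<in> hom C' Q (Dom C' a)" "Comp C' b h = Comp C' (u X) x"
      "Comp C' a h = Comp C' (u Y) y"
      and hu: "\<And>k. k \<in> hom C' Q (Dom C' a) \<Longrightarrow> Comp C' b k = Comp C' (u X) x \<Longrightarrow>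
        Comp C' a k = Comp C' (u Y) y \<Longrightarrow> k = h" by blast
    show "\<exists>!h. h \<in> hom C' Q (Dom C' a) \<and> Comp C' (Comp C' (v X) b) h = x \<and>
      Comp C' (Comp C' (v Y) a) h = y"
    proof (rule ex1I[of _ h], intro conjI)
      show "Comp C' (Comp C' (v X) b) h = x"
        using Comp_assoc[OF C' h(1) P1(4) v[OF O(1)]] h(2) v_u[OF x] by simp
      show "Comp C' (Comp C' (v Y) a) h = y"
        using Comp_assoc[OF C' h(1) P1(3) v[OF O(2)]] h(3) v_u[OF y] by simp
      fix k assume k: "k \<in> hom C' Q (Dom C' a) \<and> Comp C' (Comp C' (v X) b) k = x \<and>
        Comp C' (Comp C' (v Y) a) k = y"
      then have kh: "k \<in> hom C' Q (Dom C' a)" by blast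
      show "k = h"
        using hu[OF kh] k Comp_assoc[OF C' kh P1(4) v[OF O(1)]] Comp_assoc[OF C' kh P1(3) v[OF O(2)]]
          u_v[OF Comp_hom[OF C' kh P1(4)] O(1)] u_v[OF Comp_hom[OF C' kh P1(3)] O(2)] by metis
    qed (fact h)
  qed
qed

lemma terminal_FO:
  assumes t: "is_terminal C t" shows "is_terminal C' (FO F t)"
  unfolding is_terminal_def
proof (intro conjI ballI)
  have tO: "t \<in> Ob C" using t unfolding is_terminal_def by blast
  show "FO F t \<in> Ob C'" by (rule FO[OF tO])
  fix Z assume Z: "Z \<in> Ob C'"
  obtain f where f: "f \<in> hom C (G Z) t" and fu: "\<And>g. g \<in> hom C (G Z) t \<Longrightarrow> g = f"
    using t G[OF Z] unfolding is_terminal_def by blast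
  show "\<exists>!f. f \<in> hom C' Z (FO F t)"
  proof (rule ex1I)
    show k: "Comp C' (FA F f) (u Z) \<in> hom C' Z (FO F t)" by (rule Comp_hom[OF C' u[OF Z] FA[OF f]])
    fix g assume g: "g \<in> hom C' Z (FO F t)"
    have gen: "Comp C' h (v Z) = FA F f" if h: "h \<in> hom C' Z (FO F t)" for h
    proof -
      obtain k where "k \<in> hom C (G Z) t" "FA F k = Comp C' h (v Z)"
        using full[OF G[OF Z] tO Comp_hom[OF C' v[OF Z] h]] by blast
      then show ?thesis using fu by simp
    qed
    show "g = Comp C' (FA F f) (u Z)" by (rule u_cancel[OF g k]) (simp add: gen[OF g] gen[OF k])
  qed
qed

lemma terminal_G:
  assumes t: "is_terminal C' t" shows "is_terminal C (G t)"
  unfolding is_terminal_def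
proof (intro conjI ballI)
  have tO: "t \<in> Ob C'" using t unfolding is_terminal_def by blast
  show "G t \<in> Ob C" by (rule G[OF tO])
  fix X assume X: "X \<in> Ob C"
  obtain f where f: "f \<in> hom C' (FO F X) t" and fu: "\<And>g. g \<in> hom C' (FO F X) t \<Longrightarrow> g = f"
    using t FO[OF X] unfolding is_terminal_def by blast
  obtain k where k: "k \<in> hom C X (G t)" using full[OF X G[OF tO] Comp_hom[OF C' f u[OF tO]]] by blast
  have gen: "FA F h = Comp C' (u t) f" if h: "h \<in> hom C X (G t)" for h
    using u_v[OF FA[OF h] tO] fu[OF Comp_hom[OF C' FA[OF h] v[OF tO]]] by simp
  show "\<exists>!f. f \<in> hom C X (G t)"
    using k gen faithful by metis
qed

text \<open>Closure under isomorphisms and composition, together with reflection by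
  \<open>F\<close>, already determines membership in \<open>D'\<close> by that of \<open>L p\<close>
  in \<open>D\<close>. The pullback and terminal axioms of \<open>C'\<close> are then read off from
  those of \<open>C\<close>.\<close>

lemma clan_equivalence:
  assumes D: "clan C D" and D': "D' \<subseteq> Arr C'" "\<And>f. f \<in> Arr C \<Longrightarrow> f \<in> D \<longleftrightarrow> FA F f \<in> D'"
    and iso: "\<And>f. is_iso C' f \<Longrightarrow> f \<in> D'"
    and comp: "\<And>f g. f \<in> D' \<Longrightarrow> g \<in> D' \<Longrightarrow> Cod C' f = Dom C' g \<Longrightarrow> Comp C' g f \<in> D'"
  shows "clan_equivalence C D C' D' F"
proof -
  have D_Arr: "D \<subseteq> Arr C" using D unfolding clan_def by blast
  have uD: "u Z \<in> D'" and vD: "v Z \<in> D'" if "Z \<in> Ob C'" for Z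
    using iso isoI[OF u[OF that] v[OF that] vu[OF that] uv[OF that]]
      isoI[OF v[OF that] u[OF that] uv[OF that] vu[OF that]] by auto
  have comp': "Comp C' g f \<in> D'" if "f \<in> D'" "g \<in> D'" "f \<in> hom C' X Y" "g \<in> hom C' Y Z" for f g X Y Z
    using comp that homD by metis
  \<comment> \<open>The image of \<open>L p\<close> differs from \<open>p\<close> by the
    isomorphisms \<open>u\<close> and \<open>v\<close>, which lie in \<open>D'\<close>.\<close>
  have LD: "L p \<in> D \<longleftrightarrow> p \<in> D'" if p: "p \<in> hom C' X Y" for p X Y
  proof -
    have O: "X \<in> Ob C'" "Y \<in> Ob C'" using hom_Ob[OF C' p] by auto
    note pv = Comp_hom[OF C' v[OF O(1)] p]
    note upv = Comp_hom[OF C' pv u[OF O(2)]]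
    have "Comp C' (v Y) (Comp C' (Comp C' (u Y) (Comp C' p (v X))) (u X)) = p"
      using Comp_assoc[OF C' u[OF O(1)] pv u[OF O(2)]] Comp_assoc[OF C' u[OF O(1)] v[OF O(1)] p]
        vu[OF O(1)] Comp_Id(1)[OF C' p] v_u[OF p] by simp
    then have "p \<in> D' \<longleftrightarrow> Comp C' (u Y) (Comp C' p (v X)) \<in> D'"
      using comp'[OF vD[OF O(1)] _ v[OF O(1)] p] comp'[OF _ uD[OF O(2)] pv u[OF O(2)]]
        comp'[OF uD[OF O(1)] _ u[OF O(1)] upv]
        comp'[OF _ vD[OF O(2)] Comp_hom[OF C' u[OF O(1)] upv] v[OF O(2)]] by metis
    then show ?thesis using D'(2)[OF homD(1)[OF L(1)[OF p]]] L(2)[OF p] by simp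
  qed
  have clan': "clan C' D'"
    unfolding clan_def
  proof (intro conjI ballI allI impI C' D'(1))
    show "f \<in> D'" if "is_iso C' f" for f by (rule iso[OF that])
    show "Comp C' g f \<in> D'" if "f \<in> D'" "g \<in> D'" "Cod C' f = Dom C' g" for f g
      by (rule comp[OF that])
  next
    fix p g assume pD: "p \<in> D'" and gA: "g \<in> Arr C'" and gp: "Cod C' g = Cod C' p"
    have p: "p \<in> hom C' (Dom C' p) (Cod C' p)" using pD D'(1) by (blast intro: Arr_hom)
    have g: "g \<in> hom C' (Dom C' g) (Cod C' p)" using Arr_hom[OF gA] gp by simp
    let ?X = "Dom C' p" and ?Y = "Dom C' g"
    have "L p \<in> D" using LD[OF p] pD by blast
    moreover have "Cod C (L g) = Cod C (L p)" using homD(3)[OF L(1)[OF p]] homD(3)[OF L(1)[OF g]] by simp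
    ultimately obtain a b where ab: "is_pullback C (L p) (L g) a b" "a \<in> D"
      using D homD(1)[OF L(1)[OF g]] unfolding clan_def by blast
    let ?a = "Comp C' (v ?Y) (FA F a)"
    have Q: "is_pullback C' p g ?a (Comp C' (v ?X) (FA F b))"
      by (rule pullback_transport[OF p g pullback[OF ab(1)]])
    then show "\<exists>p' f'. is_pullback C' p g p' f'" by blast
    have ah: "FA F a \<in> hom C' (FO F (Dom C a)) (FO F (G ?Y))"
      using FA[OF pullbackD(3)[OF ab(1)]] homD(2)[OF L(1)[OF g]] by simp
    have YO: "?Y \<in> Ob C'" using hom_Ob[OF C' g] by blast
    have "FA F a \<in> D'" using D'(2) ab(2) D_Arr by blast
    then have aD: "?a \<in> D'" using comp'[OF _ vD[OF YO] ah v[OF YO]] by blast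
    fix p' f' assume P: "is_pullback C' p g p' f'"
    obtain k where k: "k \<in> hom C' (Dom C' p') (Dom C' ?a)" "is_iso C' k" "Comp C' ?a k = p'"
      using pullback_unique[OF C' Q P] .
    show "p' \<in> D'"
      using comp'[OF iso[OF k(2)] aD k(1) Arr_hom] k(3) D'(1) aD by (simp add: subset_iff)
  next
    obtain t where "is_terminal C t" using D unfolding clan_def by blast
    then show "\<exists>t. is_terminal C' t" using terminal_FO by blast
  next
    fix f assume f: "f \<in> Arr C'" and t: "is_terminal C' (Cod C' f)"
    have "L f \<in> D"
      using D terminal_G[OF t] L(1)[OF Arr_hom[OF f]] unfolding clan_def hom_def by auto
    then show "f \<in> D'" using LD[OF Arr_hom[OF f]] by blast
  qed
  then show ?thesis
    unfolding clan_equivalence_def clan_morphism_def preserves_display_pullbacks_def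
      preserves_terminal_def
    using D F D'(2) D_Arr pullback terminal_FO equivalence by blast
qed

end

section \<open>Compact 0-extensions and extensions between representables\<close>

lemma has_lifting_Comp:
  assumes C: "category C" and l: "l \<in> hom C X Y" and m: "m \<in> hom C Y Z" and r: "r \<in> hom C P Q"
    and L: "has_lifting C l r" "has_lifting C m r"
  shows "has_lifting C (Comp C m l) r"
  unfolding has_lifting_def homD(2,3)[OF Comp_hom[OF C l m]] homD(2,3)[OF r]
proof (intro ballI impI)
  fix a b assume a: "a \<in> hom C X P" and b: "b \<in> hom C Z Q" and e: "Comp C r a = Comp C b (Comp C m l)"
  have "Comp C r a = Comp C (Comp C b m) l" using e Comp_assoc[OF C l m b] by simp
  then obtain h where h: "h \<in> hom C Y P" "Comp C h l = a" "Comp C r h = Comp C b m"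
    using L(1) a Comp_hom[OF C m b]
    unfolding has_lifting_def homD(2,3)[OF l] homD(2,3)[OF r] by blast
  then obtain k where k: "k \<in> hom C Z P" "Comp C k m = h" "Comp C r k = b"
    using L(2) b unfolding has_lifting_def homD(2,3)[OF m] homD(2,3)[OF r] by blast
  then show "\<exists>k\<in>hom C Z P. Comp C k (Comp C m l) = a \<and> Comp C r k = b"
    using Comp_assoc[OF C l m k(1)] h(2) by auto
qed

lemma has_lifting_iso:
  assumes C: "category C" and l: "l \<in> hom C X Y" and i: "is_iso C l" and r: "r \<in> hom C P Q"
  shows "has_lifting C l r"
  unfolding has_lifting_def homD(2,3)[OF l] homD(2,3)[OF r]
proof (intro ballI impI)
  fix a b assume a: "a \<in> hom C X P" and b: "b \<in> hom C Y Q" and e: "Comp C r a = Comp C b l"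
  obtain g where g: "g \<in> hom C Y X" "Comp C g l = Id C X" "Comp C l g = Id C Y"
    using isoD[OF i l] .
  have "Comp C (Comp C a g) l = a"
    using Comp_assoc[OF C l g(1) a] g(2) Comp_Id(1)[OF C a] by simp
  moreover have "Comp C r (Comp C a g) = b"
    using Comp_assoc[OF C g(1) a r] e Comp_assoc[OF C g(1) l b] g(3) Comp_Id(1)[OF C b] by simp
  ultimately show "\<exists>h\<in>hom C Y P. Comp C h l = a \<and> Comp C r h = b"
    using Comp_hom[OF C g(1) a] by blast
qed

section \<open>Extensions of models and the two uses of the cover\<close>

context small_clan
begin

lemma extension_Comp:
  assumes l: "is_extension T D l" "l \<in> hom M X Y" and m: "is_extension T D m" "m \<in> hom M Y Z"
  shows "is_extension T D (Comp M m l)"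
  unfolding is_extension_def
proof (intro conjI allI impI)
  show "Comp M m l \<in> Arr M" by (rule homD(1)[OF Comp_hom[OF M l(2) m(2)]])
  fix r assume r: "is_full T D r"
  then have "r \<in> hom M (Dom M r) (Cod M r)" unfolding is_full_def by (blast intro: Arr_hom)
  then show "has_lifting M (Comp M m l) r"
    using has_lifting_Comp[OF M l(2) m(2)] l(1) m(1) r unfolding is_extension_def by blast
qed

lemma extension_iso:
  assumes "is_iso M l" shows "is_extension T D l"
  unfolding is_extension_def
proof (intro conjI allI impI)
  show l: "l \<in> Arr M" using assms unfolding is_iso_def by blast
  fix r assume "is_full T D r"
  then have "r \<in> hom M (Dom M r) (Cod M r)" unfolding is_full_def by (blast intro: Arr_hom)
  then show "has_lifting M l r" by (rule has_lifting_iso[OF M Arr_hom[OF l] assms])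
qed

lemma display_if_extension:
  assumes cc: "cauchy_complete T D" and f: "f \<in> hom T X Y" and e: "is_extension T D (H_map T f)"
  shows "f \<in> D"
proof -
  note O = hom_Ob[OF T f]
  have fY: "f \<in> FO (H_ob T X) Y" using f O by simp
  interpret cell_complex T D "H_ob T X" Y f
    by unfold_locales (use H_model O fY in auto)
  obtain J :: "('u, 'u) cat" and B C i \<gamma> \<pi> c where
    \<pi>: "\<pi> \<in> hom M C (H_ob T X)" "is_full T D \<pi>" and c: "c \<in> FO C Y" "app \<pi> Y c = f"
    and lift: "\<And>Z x g. x \<in> FO C Z \<Longrightarrow> g \<in> hom T Z Y \<Longrightarrow> act C g x = c \<Longrightarrow>
      \<exists>W d h s. d \<in> D \<and> d \<in> hom T W Y \<and> h \<in> hom T W Z \<and> Comp T g h = d \<and>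
        s \<in> FO (H_ob T X) W \<and> act (H_ob T X) h s = app \<pi> Z x \<and> act (H_ob T X) d s = f"
    by (rule full_cover) blast
  have C: "is_model T D C" by (rule M_homD(1)[OF \<pi>(1)])
  note Hf = H_map_hom[OF f] and yc = yo_hom[OF C O(2) c(1)]
  have "has_lifting M (H_map T f) \<pi>" using e \<pi>(2) unfolding is_extension_def by blast
  \<comment> \<open>The square has \<open>c\<close> as its upper map and the identity of H(X) as its
    lower one; it commutes because \<open>c\<close> lies over \<open>f\<close>. Its diagonal is a
    section of \<open>\<pi>\<close> compatible with the maps from H(Y).\<close>
  moreover have "Comp M \<pi> (yo C Y c) = Comp M (Id M (H_ob T X)) (H_map T f)"
    using yo_Comp[OF \<pi>(1) O(2) c(1)] c(2) H_map_yo[OF f] Comp_Id(2)[OF M Hf] by simp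
  moreover have "Id M (H_ob T X) \<in> hom M (H_ob T X) (H_ob T X)"
    using Id_hom[OF M] H_model[OF O(1)] M_Ob by blast
  ultimately obtain k where k: "k \<in> hom M (H_ob T X) C" "Comp M k (H_map T f) = yo C Y c"
    "Comp M \<pi> k = Id M (H_ob T X)"
    using yc unfolding has_lifting_def homD(2,3)[OF Hf] homD(2,3)[OF \<pi>(1)] by blast
  \<comment> \<open>As an element, the diagonal lies over \<open>c\<close> along \<open>f\<close>
    and is sent to the identity of \<open>X\<close> by \<open>\<pi>\<close>.\<close>
  define x where "x = app k X (Id T X)"
  have x: "x \<in> FO C X" "k = yo C X x" using yoneda[OF k(1) O(1)] unfolding x_def by auto
  have IdX: "Id T X \<in> FO (H_ob T X) X" using Id_hom[OF T O(1)] O(1) by simp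
  have "yo C Y (act C f x) = yo C Y c" using k(2) yo_H_map[OF C f x(1)] x(2) by simp
  then have "act C f x = c" using yo_inj[OF C O(2) act(4)[OF C f x(1)] c(1)] by simp
  moreover have px: "app \<pi> X x = Id T X"
    using app_Comp[OF k(1) \<pi>(1) O(1) IdX] k(3) O(1) IdX unfolding x_def by simp
  ultimately obtain W d h s where W: "d \<in> D" "d \<in> hom T W Y" "h \<in> hom T W X" "Comp T f h = d"
    "s \<in> FO (H_ob T X) W" "act (H_ob T X) h s = Id T X" "act (H_ob T X) d s = f"
    using lift[OF x(1) f] by metis
  have s: "s \<in> hom T X W" using W(5) hom_Ob[OF T W(2)] by simp
  have "Comp T h s = Id T X" "Comp T d s = f" using W(6,7) act_H[OF W(3) s] act_H[OF W(2) s] by simp_all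
  \<comment> \<open>The retraction takes place over \<open>Y\<close>: \<open>s\<close> and
    \<open>h\<close> on the domains, identities on the codomains.\<close>
  then have "retract_of_arrow T f d"
    unfolding retract_of_arrow_def homD(2,3)[OF f] homD(2,3)[OF W(2)]
    using s W(3,4) Id_hom[OF T O(2)] Comp_Id(2)[OF T f] Comp_Id(2)[OF T W(2)]
      Comp_Id(1)[OF T Id_hom[OF T O(2)]] homD(1)[OF f] homD(1)[OF W(2)] by metis
  then show ?thesis using cc W(1) unfolding cauchy_complete_def by blast
qed

lemma compact_zero_extension_representable:
  assumes cc: "cauchy_complete T D" and c: "is_compact T D A" and z: "zero_extension T D A"
  obtains X s r where "X \<in> Ob T" "s \<in> hom M A (H_ob T X)" "r \<in> hom M (H_ob T X) A"
    "Comp M r s = Id M A" "Comp M s r = Id M (H_ob T X)"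
proof -
  have A: "is_model T D A" using c unfolding is_compact_def M_Ob by blast
  have IdA: "Id M A \<in> hom M A A" using Id_hom[OF M] A M_Ob by blast
  obtain t where t: "is_terminal T t" using terminal .
  have tO: "t \<in> Ob T" using t unfolding is_terminal_def by blast
  \<comment> \<open>A model has exactly one element at the terminal object, so a cover over the base
    \<open>(t, a)\<close> exists for every \<open>A\<close>.\<close>
  obtain a where a: "a \<in> FO A t" using modelD(2)[OF A t] by blast
  interpret cell_complex T D A t a
    by unfold_locales (use A tO a in auto)
  obtain J :: "('u, 'u) cat" and B C i \<gamma> \<pi> where
    J: "is_filtered J" "small (Arr J)" "is_colimit J M B C i"
    and \<gamma>: "\<And>j. j \<in> Ob J \<Longrightarrow> \<gamma> j \<in> Ob T" "\<And>j. j \<in> Ob J \<Longrightarrow> FO B j = H_ob T (\<gamma> j)"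
    and \<pi>: "\<pi> \<in> hom M C A" "is_full T D \<pi>"
    by (rule full_cover) blast
  obtain Z f where Z: "is_initial M Z" and f: "f \<in> hom M Z A" "is_extension T D f"
    using z unfolding zero_extension_def by blast
  have C: "C \<in> Ob M" using hom_Ob[OF M \<pi>(1)] by blast
  obtain g where g: "g \<in> hom M Z C" using Z C unfolding is_initial_def by blast
  \<comment> \<open>Both are maps out of the initial model, so the square over the identity of
    \<open>A\<close> commutes; its diagonal is a section of \<open>\<pi>\<close>.\<close>
  have "Comp M \<pi> g = Comp M (Id M A) f"
    using Z A M_Ob Comp_hom[OF M g \<pi>(1)] Comp_hom[OF M f(1) IdA] unfolding is_initial_def by blast
  moreover have "has_lifting M f \<pi>" using f(2) \<pi>(2) unfolding is_extension_def by blast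
  ultimately obtain h where h: "h \<in> hom M A C" "Comp M \<pi> h = Id M A"
    using g IdA unfolding has_lifting_def homD(2,3)[OF f(1)] homD(2,3)[OF \<pi>(1)] by blast
  let ?H = "hom_functor M A"
  have P: "is_functor J M B" "is_cocone J M B C i" using J(3) unfolding is_colimit_def by auto
  have cl: "is_colimit J (set_cat (\<lambda>_. True)) (comp_ftor J ?H B) (FO ?H C) (\<lambda>j. FA ?H (i j))"
    using c J unfolding is_compact_def by blast
  \<comment> \<open>Compactness makes Hom(A,C) the colimit of the sets Hom(A,B j), so the section
    \<open>h\<close> comes from a stage.\<close>
  have "h \<in> FO ?H C" using h(1) C by (simp add: hom_functor_def)
  from colimit_set_cat_surj[OF cl this] obtain j s where j: "j \<in> Ob J" and s: "s \<in> FO (comp_ftor J ?H B) j"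
    and hs: "h = body (FA ?H (i j)) s" by blast
  have ij: "i j \<in> hom M (H_ob T (\<gamma> j)) C" using P(2) j \<gamma>(2) unfolding is_cocone_def by metis
  note \<gamma>O = \<gamma>(1)[OF j]
  have HO: "H_ob T (\<gamma> j) \<in> Ob M" using H_model[OF \<gamma>O] M_Ob by blast
  have s: "s \<in> hom M A (H_ob T (\<gamma> j))"
    using s j \<gamma>(2)[OF j] HO by (simp add: comp_ftor_def hom_functor_def)
  have hs: "h = Comp M (i j) s" using hs s ij by (simp add: hom_functor_def hom_def)
  define r where "r = Comp M \<pi> (i j)"
  have r: "r \<in> hom M (H_ob T (\<gamma> j)) A" unfolding r_def by (rule Comp_hom[OF M ij \<pi>(1)])
  have rs: "Comp M r s = Id M A" unfolding r_def using Comp_assoc[OF M s ij \<pi>(1)] h(2) hs by simp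
  note sr = Comp_hom[OF M r s]
  \<comment> \<open>\<open>A\<close> is now a retract of H(\<gamma> j). The idempotent on H(\<gamma>
    j) comes from one in \<open>T\<close> by full faithfulness, and that one splits.\<close>
  have idem: "Comp M (Comp M s r) (Comp M s r) = Comp M s r"
    using Comp_assoc[OF M sr r s] Comp_assoc[OF M r s r] rs Comp_Id(2)[OF M r] by simp
  obtain e where e: "e \<in> hom T (\<gamma> j) (\<gamma> j)" "Comp M s r = H_map T e"
    using H_map_full[OF sr \<gamma>O \<gamma>O] by blast
  have "Comp T e e = e"
    using H_map_inj[OF Comp_hom[OF T e(1) e(1)] e(1)] H_map_Comp[OF e(1) e(1)] idem e(2) by simp
  then obtain X p q where X: "X \<in> Ob T" and p: "p \<in> hom T (\<gamma> j) X" and q: "q \<in> hom T X (\<gamma> j)"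
    and pq: "Comp T q p = e" "Comp T p q = Id T X"
    using cc \<gamma>O e(1) unfolding cauchy_complete_def idempotents_split_def by blast
  note Hp = H_map_hom[OF p] and Hq = H_map_hom[OF q]
  have Hpq: "Comp M (H_map T p) (H_map T q) = Comp M s r" using H_map_Comp[OF p q] pq(1) e(2) by simp
  have Hqp: "Comp M (H_map T q) (H_map T p) = Id M (H_ob T X)"
    using H_map_Comp[OF q p] pq(2) H_map_Id[OF X] by simp
  \<comment> \<open>\<open>A\<close> and H(X) split the same idempotent of H(\<gamma> j), so each
    inclusion followed by the other retraction gives an isomorphism.\<close>
  let ?s = "Comp M (H_map T q) s" and ?r = "Comp M r (H_map T p)"
  have s': "?s \<in> hom M A (H_ob T X)" by (rule Comp_hom[OF M s Hq])
  have r': "?r \<in> hom M (H_ob T X) A" by (rule Comp_hom[OF M Hp r])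
  have "Comp M ?r ?s = Comp M r (Comp M (Comp M (H_map T p) (H_map T q)) s)"
    using Comp_assoc[OF M s' Hp r] Comp_assoc[OF M s Hq Hp] by simp
  also have "\<dots> = Comp M r (Comp M s (Comp M r s))"
    using Hpq Comp_assoc[OF M s r s] by simp
  also have "\<dots> = Id M A" using rs Comp_Id(1)[OF M s] by simp
  finally have 1: "Comp M ?r ?s = Id M A" .
  have "Comp M ?s ?r = Comp M (H_map T q) (Comp M (Comp M s r) (H_map T p))"
    using Comp_assoc[OF M r' s Hq] Comp_assoc[OF M Hp r s] by simp
  also have "\<dots> = Comp M (H_map T q) (Comp M (H_map T p) (Comp M (H_map T q) (H_map T p)))"
    using Hpq[symmetric] Comp_assoc[OF M Hp Hq Hp] by simp
  also have "\<dots> = Id M (H_ob T X)" using Hqp Comp_Id(1)[OF M Hp] by simp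
  finally have 2: "Comp M ?s ?r = Id M (H_ob T X)" .
  show ?thesis by (rule that[OF X s' r' 1 2])
qed

section \<open>The functor E as an equivalence of clans\<close>

lemma CMod_hom: "f \<in> hom (CMod T D) A B \<longleftrightarrow> is_compact T D A \<and> zero_extension T D A \<and>
    is_compact T D B \<and> zero_extension T D B \<and> f \<in> hom M A B"
  unfolding CMod_def full_subcat_simps by blast

lemma CMod_Ob: "A \<in> Ob (CMod T D) \<longleftrightarrow> is_compact T D A \<and> zero_extension T D A"
  unfolding CMod_def full_subcat_simps by (auto simp: is_compact_def)

lemma CMod_simps: "Comp (CMod T D) = Comp M" "Id (CMod T D) = Id M"
  unfolding CMod_def by simp_all

lemma CMod: "category (CMod T D)"
  unfolding CMod_def by (rule category_full_subcat[OF M])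

lemma E_functor: "is_functor T (opposite (CMod T D)) (E T)"
proof (rule ftorI[OF T category_opposite[OF CMod]])
  show "FO (E T) X \<in> Ob (opposite (CMod T D))" if "X \<in> Ob T" for X
    using that H_compact H_zero_extension by (simp add: E_def CMod_Ob)
  show "FA (E T) f \<in> hom (opposite (CMod T D)) (FO (E T) X) (FO (E T) Y)" if f: "f \<in> hom T X Y" for f X Y
    using H_map_hom[OF f] hom_Ob[OF T f] homD(1)[OF f] H_compact H_zero_extension
    by (simp add: E_def CMod_hom)
  show "FA (E T) (Id T X) = Id (opposite (CMod T D)) (FO (E T) X)" if X: "X \<in> Ob T" for X
    using X homD(1)[OF Id_hom[OF T X]] H_map_Id by (simp add: E_def CMod_simps)
  show "FA (E T) (Comp T g f) = Comp (opposite (CMod T D)) (FA (E T) g) (FA (E T) f)"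
    if fg: "f \<in> hom T X Y" "g \<in> hom T Y Z" for f g X Y Z
    using homD(1)[OF fg(1)] homD(1)[OF fg(2)] homD(1)[OF Comp_hom[OF T fg]] H_map_Comp[OF fg]
    by (simp add: E_def CMod_simps)
qed (simp_all add: E_def)

lemma E_equivalence:
  assumes cc: "cauchy_complete T D"
  shows "clan_equivalence T D (opposite (CMod T D)) (CMod_display T D) (E T)"
proof -
  let ?C = "opposite (CMod T D)"
  have E_Ob: "FO (E T) X = H_ob T X" if "X \<in> Ob T" for X using that by (simp add: E_def)
  have E_Arr: "FA (E T) f = H_map T f" if "f \<in> hom T X Y" for f X Y using homD(1)[OF that] by (simp add: E_def)
  \<comment> \<open>In the opposite category the directions are exchanged: \<open>r\<close> serves
    as \<open>u\<close> and \<open>s\<close> as \<open>v\<close>.\<close>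
  have "\<exists>X u v. X \<in> Ob T \<and> u \<in> hom ?C A (H_ob T X) \<and> v \<in> hom ?C (H_ob T X) A \<and>
      Comp ?C v u = Id ?C A \<and> Comp ?C u v = Id ?C (H_ob T X)" if "A \<in> Ob ?C" for A
  proof -
    have "is_compact T D A" "zero_extension T D A" using that by (simp_all add: CMod_Ob)
    then obtain X s r where "X \<in> Ob T" "s \<in> hom M A (H_ob T X)" "r \<in> hom M (H_ob T X) A"
      "Comp M r s = Id M A" "Comp M s r = Id M (H_ob T X)" "is_compact T D A" "zero_extension T D A"
      using compact_zero_extension_representable[OF cc] by metis
    then show ?thesis using H_compact H_zero_extension by (auto simp: CMod_hom CMod_simps)
  qed
  then obtain G u v where G: "\<And>A. A \<in> Ob ?C \<Longrightarrow> G A \<in> Ob T \<and> u A \<in> hom ?C A (H_ob T (G A)) \<and>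
      v A \<in> hom ?C (H_ob T (G A)) A \<and> Comp ?C (v A) (u A) = Id ?C A \<and>
      Comp ?C (u A) (v A) = Id ?C (H_ob T (G A))" by metis
  interpret weak_equivalence T ?C "E T" G u v
  proof (unfold_locales, rule E_functor)
    show "\<exists>f\<in>hom T X Y. FA (E T) f = g"
      if X: "X \<in> Ob T" and Y: "Y \<in> Ob T" and g: "g \<in> hom ?C (FO (E T) X) (FO (E T) Y)" for X Y g
    proof -
      have "g \<in> hom M (H_ob T Y) (H_ob T X)" using g E_Ob X Y by (simp add: CMod_hom)
      then show ?thesis using H_map_full[OF _ X Y] E_Arr by metis
    qed
    show "f = g" if "f \<in> hom T X Y" "g \<in> hom T X Y" "FA (E T) f = FA (E T) g" for X Y f g
      using that H_map_inj E_Arr by metis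
  qed (use G E_Ob in auto)
  show ?thesis
  proof (rule clan_equivalence[OF clan])
    show "CMod_display T D \<subseteq> Arr ?C" by (auto simp: CMod_display_def)
    show "f \<in> D \<longleftrightarrow> FA (E T) f \<in> CMod_display T D" if "f \<in> Arr T" for f
    proof -
      note f = Arr_hom[OF that]
      have "FA (E T) f \<in> Arr (CMod T D)" using homD(1)[OF ftorD(6)[OF E_functor f]] by simp
      then show ?thesis
        using E_Arr[OF f] H_extension display_if_extension[OF cc f] by (auto simp: CMod_display_def)
    qed
  next
    fix f assume f: "is_iso ?C f"
    then have "f \<in> Arr ?C" unfolding is_iso_def by blast
    then have fh: "f \<in> hom ?C (Dom ?C f) (Cod ?C f)" by (rule Arr_hom)
    obtain g where g: "g \<in> hom ?C (Cod ?C f) (Dom ?C f)" "Comp ?C g f = Id ?C (Dom ?C f)"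
      "Comp ?C f g = Id ?C (Cod ?C f)" using isoD[OF f fh] .
    have "f \<in> hom M (Cod ?C f) (Dom ?C f)" "g \<in> hom M (Dom ?C f) (Cod ?C f)"
      using fh g(1) by (simp_all add: CMod_hom)
    then have "is_iso M f" by (rule isoI) (use g in \<open>simp_all add: CMod_simps\<close>)
    then show "f \<in> CMod_display T D"
      using extension_iso \<open>f \<in> Arr ?C\<close> by (simp add: CMod_display_def)
  next
    fix f g assume fg: "f \<in> CMod_display T D" "g \<in> CMod_display T D" and c: "Cod ?C f = Dom ?C g"
    have A: "f \<in> Arr (CMod T D)" "g \<in> Arr (CMod T D)" using fg by (simp_all add: CMod_display_def)
    have fh: "f \<in> hom (CMod T D) (Dom (CMod T D) f) (Cod (CMod T D) f)"
      and gh: "g \<in> hom (CMod T D) (Dom (CMod T D) g) (Dom (CMod T D) f)"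
      using Arr_hom[OF A(1)] Arr_hom[OF A(2)] c by simp_all
    have "Comp (CMod T D) f g \<in> Arr (CMod T D)" using homD(1)[OF Comp_hom[OF CMod gh fh]] .
    moreover have "is_extension T D (Comp M f g)"
      using extension_Comp fg fh gh by (auto simp: CMod_display_def CMod_hom)
    ultimately show "Comp ?C g f \<in> CMod_display T D"
      by (simp add: CMod_display_def CMod_simps)
  qed
qed

end

theorem theorem5p9:
  fixes T :: "('o, 'u) cat" and D :: "'u set"
  assumes "universe TYPE('u)"
    and "clan T D" and "small (Arr T)"
    and "cauchy_complete T D"
  shows "clan_equivalence T D (opposite (CMod T D)) (CMod_display T D) (E T)"
proof -
  interpret small_clan T D using assms by unfold_locales
  show ?thesis by (rule E_equivalence[OF assms(4)])
qed

end
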